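(* Let $\bar X\in\mathcal K$, $\bar V\in\mathcal H_{\bar X}$, and let $X_t$ be the corresponding Lagrangian solution, with natural velocity $\bar\Psi$. Suppose $m',m''\in\Omega$. If $\mathrm P_{\mathcal K}\bar\Psi(m')<\mathrm P_{\mathcal K}\bar\Psi(m'')$, then there is a time-independent constant $c>0$ such that $X_t(m'')-X_t(m')\ge c>0$ for all $t\ge0$. Furthermore, for $m\in\Omega$: I. If $m\in\Sigma_+$, there is no finite- or infinite-time clustering at $m$. II. If $m\in\Sigma_-$, there is a finite-time cluster at $m$ for sufficiently large $t\ge0$. III. (i) Suppose $\int_0^1\frac{1}{\Phi(x)}dx=\infty$, including the case $\phi\equiv0$. If $[m',m'')\ni m$ is a finite-time cluster, then either $m\in\Sigma_0$ and $[m',m'')$ is an initial cluster, or $m\in\Sigma_-$ and $[m',m'')\subset[m_-,m_+)$, where $(m_-,m_+)$ is a connected component of $\Sigma_-$. No other finite-time clusters are possible. (ii) Suppose $\phi$ is not identically zero. If $m\notin\Sigma_+$ and $\{\bar X(\omega):\omega\in L(m)\}$ is bounded, then there is an infinite-time cluster at $m$, given by $L(m)$. (iii) Suppose in the previous case (ii) that in addition $\int_0^1\frac1{\Phi(x)}dx<\infty$. Then $L(m)$ is a finite-time cluster.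
   Context: The communication protocol $\phi$ on $\mathbb R$ is nonnegative, symmetric, radially nonincreasing and locally integrable; $\Phi(x)=\int_0^x\phi(y)dy$. $\Omega=(0,1)$. $\mathcal K\subset L^2(\Omega)$: closed convex cone of nondecreasing right-continuous functions; $\mathrm P_{\mathcal K}$ the metric projection onto it; for $X\in\mathcal K$, $\partial I_{\mathcal K}(X)=\{W\in L^2(\Omega):\langle W,Y-X\rangle\le0\ \forall Y\in\mathcal K\}$. $\Omega_X=\{m\in\Omega:X\text{ is constant in a neighborhood of }m\}$; $\mathcal H_X=\{U\in L^2(\Omega):U\text{ is constant on each interval contained in }\Omega_X\}$. Natural velocity: $\bar\Psi=\bar V+\int_\Omega\Phi(\bar X-\bar X(\omega))d\omega$. The Lagrangian solution with data $(\bar X,\bar V)$ is the unique absolutely continuous curve $X_t:[0,\infty)\to\mathcal K$ with $X_0=\bar X$ and $\bar\Psi-\int_\Omega\Phi(X_t-X_t(\omega))d\omega-\dot X_t\in\partial I_{\mathcal K}(X_t)$ for a.e. $t>0$. Pointwise values $X_t(m)$ are those of the right-continuous representative. $A(m)=\int_0^m\bar\Psi(\omega)d\omega$ on $[0,1]$ and $A^{**}$ is its lower convex envelope on $[0,1]$ (the greatest convex lower semicontinuous function below $A$). $\mathrm P_{\mathcal K}\bar\Psi$ is represented by the right-derivative $\frac{d^+}{dm}A^{**}$, which is nondecreasing and right-continuous on $\Omega$. Define $\Sigma_-=\{m\in\Omega:A(m)>A^{**}(m)\}$; $\Sigma_+=\{m\in[0,1):A^{**}\text{ is not linear on any interval }[m,m')\}$;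 $\Sigma_0$ = the union of all intervals $[m',m'')$ on which $A^{**}$ is linear and equal to $A$. For $m\in\Omega$, $L(m)=\{\omega\in\Omega:\mathrm P_{\mathcal K}\bar\Psi(\omega)=\mathrm P_{\mathcal K}\bar\Psi(m)\}$. Clusters: a finite-time cluster (at time $t$) is an interval $[m',m'')$ such that $(m',m'')$ is a connected component of $\Omega_{X_t}$ for some $t\ge0$; it is a cluster at $m$ if it contains $m$, and an initial cluster if it is a cluster for $t=0$. Intervals are understood intersected with $\Omega$ (if the left endpoint is $0$). An infinite-time cluster is a nondegenerate interval $I\subset\Omega$ with $\lim_{t\to\infty}\sup_{\omega_1,\omega_2\in I}|X_t(\omega_1)-X_t(\omega_2)|=0$; it is an infinite-time cluster at $m$ if $m\in I$, where $I$ contains its left endpoint whenever that endpoint lies in $\Omega$ (half-open intervals).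
   Formalization: The first bound holds for all t≥0 if X̄(m')<X̄(m''), otherwise for t≥s with c depending on s, for each s>0; III(i) also allows m=m_-; "not identically zero" is meant a.e.; the cluster at m in III(ii) and the one in III(iii) are L(m) without its right endpoint. *)

theory Defs
  imports "HOL-Analysis.Analysis"
begin

text \<open>
  Elements of \<open>L\<^sup>2(\<Omega>)\<close> are represented by functions \<open>real \<Rightarrow> real\<close>; values outside \<open>\<Omega>\<close> are
  irrelevant. Properties of \<open>L\<^sup>2\<close>-classes are stated up to null sets, while nondecreasing
  elements are represented by their right-continuous version, which is unique on \<open>\<Omega>\<close>.
\<close>

definition Omega :: "real set" where
  "Omega = {0<..<1}"

definition L2 :: "(real \<Rightarrow> real) set" where
  "L2 = {f. set_borel_measurable lborel Omega f \<and> set_integrable lborel Omega (\<lambda>x. (f x)\<^sup>2)}"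

definition l2_inner :: "(real \<Rightarrow> real) \<Rightarrow> (real \<Rightarrow> real) \<Rightarrow> real" where
  "l2_inner f g = (LINT x:Omega|lborel. f x * g x)"

definition l2_norm :: "(real \<Rightarrow> real) \<Rightarrow> real" where
  "l2_norm f = sqrt (l2_inner f f)"

text \<open>
  Monotonicity is required away from \<open>0\<close> only, so that weakly singular protocols such as
  \<open>\<bar>x\<bar> powr (-1/2)\<close> are included; the value at \<open>0\<close> plays no role.
\<close>

definition protocol :: "(real \<Rightarrow> real) \<Rightarrow> bool" where
  "protocol \<phi> \<longleftrightarrow>
     (\<forall>x. 0 \<le> \<phi> x) \<and>
     (\<forall>x. \<phi> (- x) = \<phi> x) \<and>
     (\<forall>x y. 0 < \<bar>x\<bar> \<longrightarrow> \<bar>x\<bar> \<le> \<bar>y\<bar> \<longrightarrow> \<phi> y \<le> \<phi> x) \<and>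
     (\<forall>C. compact C \<longrightarrow> set_integrable lborel C \<phi>)"

definition Phi :: "(real \<Rightarrow> real) \<Rightarrow> real \<Rightarrow> real" where
  "Phi \<phi> x = interval_lebesgue_integral lborel (ereal 0) (ereal x) \<phi>"

text \<open>In \<^typ>\<open>ennreal\<close> one has \<open>1 / 0 = \<infinity>\<close>, so the integral is infinite when \<open>\<Phi>\<close> vanishes.\<close>

definition reciprocal_integral :: "(real \<Rightarrow> real) \<Rightarrow> ennreal" where
  "reciprocal_integral \<phi> = (\<integral>\<^sup>+ x\<in>{0<..<1}. (1 / ennreal (Phi \<phi> x)) \<partial>lborel)"

definition K :: "(real \<Rightarrow> real) set" where
  "K = {X \<in> L2. mono_on Omega X \<and> (\<forall>m\<in>Omega. continuous (at_right m) X)}"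

definition proj_K :: "(real \<Rightarrow> real) \<Rightarrow> real \<Rightarrow> real" where
  "proj_K U = arg_min_on (\<lambda>Y. l2_norm (\<lambda>m. U m - Y m)) K"

definition subdiff_I_K :: "(real \<Rightarrow> real) \<Rightarrow> (real \<Rightarrow> real) set" where
  "subdiff_I_K X = {W \<in> L2. \<forall>Y\<in>K. l2_inner W (\<lambda>m. Y m - X m) \<le> 0}"

definition Omega_of :: "(real \<Rightarrow> real) \<Rightarrow> real set" where
  "Omega_of X = {m \<in> Omega. \<exists>N. open N \<and> m \<in> N \<and> N \<subseteq> Omega \<and> X constant_on N}"

definition H_of :: "(real \<Rightarrow> real) \<Rightarrow> (real \<Rightarrow> real) set" where
  "H_of X = {U \<in> L2. \<forall>J. is_interval J \<and> J \<subseteq> Omega_of X \<longrightarrow>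
                          (\<exists>c. AE m in lborel. m \<in> J \<longrightarrow> U m = c)}"

definition alignment :: "(real \<Rightarrow> real) \<Rightarrow> (real \<Rightarrow> real) \<Rightarrow> real \<Rightarrow> real" where
  "alignment \<phi> X m = (LINT \<omega>:Omega|lborel. Phi \<phi> (X m - X \<omega>))"

definition natural_velocity ::
    "(real \<Rightarrow> real) \<Rightarrow> (real \<Rightarrow> real) \<Rightarrow> (real \<Rightarrow> real) \<Rightarrow> real \<Rightarrow> real" where
  "natural_velocity \<phi> Xbar Vbar m = Vbar m + alignment \<phi> Xbar m"

text \<open>
  Absolute continuity of a curve \<open>[0,\<infinity>) \<rightarrow> L\<^sup>2(\<Omega>)\<close> (on compact time intervals), in the usual
  metric form: increments are dominated by integrals of a locally integrable function.
\<close>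

definition abs_cont_curve :: "(real \<Rightarrow> real \<Rightarrow> real) \<Rightarrow> bool" where
  "abs_cont_curve X \<longleftrightarrow>
     (\<exists>g :: real \<Rightarrow> real.
        (\<forall>T\<ge>0. set_integrable lborel {0..T} g) \<and>
        (\<forall>s t. 0 \<le> s \<and> s \<le> t \<longrightarrow>
           l2_norm (\<lambda>m. X t m - X s m) \<le> (LINT r:{s..t}|lborel. g r)))"

definition has_L2_derivative :: "(real \<Rightarrow> real \<Rightarrow> real) \<Rightarrow> (real \<Rightarrow> real) \<Rightarrow> real \<Rightarrow> bool" where
  "has_L2_derivative X V t \<longleftrightarrow>
     V \<in> L2 \<and> ((\<lambda>h. l2_norm (\<lambda>m. (X (t + h) m - X t m) / h - V m)) \<longlongrightarrow> 0) (at 0)"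

definition lagrangian_solution ::
    "(real \<Rightarrow> real) \<Rightarrow> (real \<Rightarrow> real) \<Rightarrow> (real \<Rightarrow> real) \<Rightarrow> (real \<Rightarrow> real \<Rightarrow> real) \<Rightarrow> bool" where
  "lagrangian_solution \<phi> Xbar Vbar X \<longleftrightarrow>
     (\<forall>t\<ge>0. X t \<in> K) \<and>
     (\<forall>m\<in>Omega. X 0 m = Xbar m) \<and>
     abs_cont_curve X \<and>
     (AE t in lborel. 0 < t \<longrightarrow>
        (\<exists>V. has_L2_derivative X V t \<and>
             (\<lambda>m. natural_velocity \<phi> Xbar Vbar m - alignment \<phi> (X t) m - V m)
               \<in> subdiff_I_K (X t)))"

text \<open>The functions \<open>A\<close> and \<open>A\<^sup>*\<^sup>*\<close> on \<open>[0,1]\<close>.\<close>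

definition primitive :: "(real \<Rightarrow> real) \<Rightarrow> real \<Rightarrow> real" where
  "primitive \<Psi> m = (LINT \<omega>:{0<..<m}|lborel. \<Psi> \<omega>)"

definition lsc_on :: "real set \<Rightarrow> (real \<Rightarrow> real) \<Rightarrow> bool" where
  "lsc_on S g \<longleftrightarrow> (\<forall>x\<in>S. \<forall>c<g x. \<forall>\<^sub>F y in at x within S. c < g y)"

definition convex_envelope :: "(real \<Rightarrow> real) \<Rightarrow> real \<Rightarrow> real" where
  "convex_envelope f m =
     (SUP g \<in> {g. convex_on {0..1} g \<and> lsc_on {0..1} g \<and> (\<forall>x\<in>{0..1}. g x \<le> f x)}. g m)"

definition affine_on :: "real set \<Rightarrow> (real \<Rightarrow> real) \<Rightarrow> bool" where
  "affine_on S f \<longleftrightarrow> (\<exists>a b. \<forall>x\<in>S. f x = a * x + b)"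

definition Sigma_minus :: "(real \<Rightarrow> real) \<Rightarrow> real set" where
  "Sigma_minus \<Psi> = {m \<in> Omega. primitive \<Psi> m > convex_envelope (primitive \<Psi>) m}"

definition Sigma_plus :: "(real \<Rightarrow> real) \<Rightarrow> real set" where
  "Sigma_plus \<Psi> =
     {m \<in> {0..<1}. \<forall>m'. m < m' \<and> m' \<le> 1 \<longrightarrow> \<not> affine_on {m..<m'} (convex_envelope (primitive \<Psi>))}"

definition Sigma_zero :: "(real \<Rightarrow> real) \<Rightarrow> real set" where
  "Sigma_zero \<Psi> =
     \<Union> {J. \<exists>m' m''. 0 \<le> m' \<and> m' < m'' \<and> m'' \<le> 1 \<and> J = {m'..<m''} \<and>
              affine_on J (convex_envelope (primitive \<Psi>)) \<and>
              (\<forall>x\<in>J. convex_envelope (primitive \<Psi>) x = primitive \<Psi> x)}"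

definition level_set :: "(real \<Rightarrow> real) \<Rightarrow> real \<Rightarrow> real set" where
  "level_set \<Psi> m = {\<omega> \<in> Omega. proj_K \<Psi> \<omega> = proj_K \<Psi> m}"

definition cluster_at_time :: "(real \<Rightarrow> real \<Rightarrow> real) \<Rightarrow> real \<Rightarrow> real set \<Rightarrow> bool" where
  "cluster_at_time X t C \<longleftrightarrow>
     (\<exists>m' m''. {m'<..<m''} \<in> components (Omega_of (X t)) \<and> C = {m'..<m''} \<inter> Omega)"

definition finite_time_cluster :: "(real \<Rightarrow> real \<Rightarrow> real) \<Rightarrow> real set \<Rightarrow> bool" where
  "finite_time_cluster X C \<longleftrightarrow> (\<exists>t\<ge>0. cluster_at_time X t C)"

definition initial_cluster :: "(real \<Rightarrow> real \<Rightarrow> real) \<Rightarrow> real set \<Rightarrow> bool" where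
  "initial_cluster X C \<longleftrightarrow> cluster_at_time X 0 C"

text \<open>The supremum is taken in \<^typ>\<open>ennreal\<close>, since it may be infinite for some times.\<close>

definition infinite_time_cluster :: "(real \<Rightarrow> real \<Rightarrow> real) \<Rightarrow> real set \<Rightarrow> bool" where
  "infinite_time_cluster X I \<longleftrightarrow>
     is_interval I \<and> I \<subseteq> Omega \<and> (\<exists>x\<in>I. \<exists>y\<in>I. x < y) \<and>
     ((\<lambda>t. SUP \<omega>1\<in>I. SUP \<omega>2\<in>I. ennreal \<bar>X t \<omega>1 - X t \<omega>2\<bar>) \<longlongrightarrow> 0) at_top"

text \<open>
  Membership of a point in an infinite-time cluster is tested on half-open intervals
  \<open>[a,b) \<inter> \<Omega>\<close>. The right endpoint must be left out: it may belong to \<open>\<Sigma>\<^sub>+\<close> and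
  still be approached asymptotically by the points to its left.
\<close>

definition infinite_time_cluster_at :: "(real \<Rightarrow> real \<Rightarrow> real) \<Rightarrow> real \<Rightarrow> real set \<Rightarrow> bool" where
  "infinite_time_cluster_at X m I \<longleftrightarrow>
     infinite_time_cluster X I \<and> m \<in> I \<and> (\<exists>a b. I = {a..<b} \<inter> Omega)"

text \<open>
  A level set of \<open>P\<^sub>K \<Psi>\<close> contains its right endpoint if \<open>P\<^sub>K \<Psi>\<close> is continuous there;
  as a cluster it is understood as the half-open interval with the same endpoints.
\<close>

definition half_open :: "real set \<Rightarrow> real set" where
  "half_open J = {Inf J..<Sup J} \<inter> Omega"

end

theory Submission
  imports Defs
begin

text \<open>
  For almost every time the solution satisfies \<open>X' = \<Psi> - F - W\<close> with the alignment force \<open>F\<close>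
  and \<open>W\<close> in the normal cone of \<open>K\<close> at \<open>X\<close>. The primitive \<open>Z\<close> of \<open>W\<close> is nonnegative and vanishes
  outside the clusters. At such a time the derivative on a cluster is also a limit of backward
  difference quotients, which are nonincreasing in the mass variable. Hence \<open>A\<close> exceeds its
  chord over the cluster by at least \<open>Z\<close>, which yields both the monotonicity of the clusters in time
  and the bound \<open>0 \<le> Z \<le> A - B\<close> with \<open>B = A\<^sup>*\<^sup>*\<close> the primitive of the projection \<open>P\<close>.

  Thus no momentum crosses a contact point (\<open>A = B\<close>), and the gap between the mean
  positions on two adjacent intervals changes with the difference of the means of \<open>P\<close> minus that
  of the means of \<open>F\<close>. Concavity of \<open>\<Phi>\<close> bounds the latter from above by \<open>2 \<Phi>\<close> of the gap, so gaps
  stay positive if \<open>P\<close> increases or if \<open>1 / \<Phi>\<close> is not integrable, and from below by a multiple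
  of \<open>\<Phi>\<close> of the gap, so the level sets of \<open>P\<close> collapse.
\<close>

section \<open>Square integrable functions on the unit interval\<close>

text \<open>The solution is only a curve in \<open>L2\<close>, so \<open>X t m\<close> need not be
  differentiable in \<open>t\<close> for a single \<open>m\<close>. Evolution arguments are
  therefore run on means over intervals. Pointwise statements are recovered from monotonicity in
  \<open>m\<close>, which brackets differences of values by gaps of means, and from
  right-continuity, which lets an interval shrink to a point.

  The estimates of \<open>Z\<close> hold at times where the differential inclusion is satisfied,
  hence almost everywhere and never at \<open>t = 0\<close>. Initial clusters need their own
  argument: there \<open>Vbar \<in> H_of Xbar\<close> makes \<Psi> constant, which has the same
  effect as the momentum condition found at later times.

  No differential equation is integrated. Absolute continuity enters through one comparison
  principle: a derivative bound almost everywhere bounds the increment. The Osgood and the collapse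
  argument are discretised along the scales 2^-k. Their bounds for the time between consecutive
  scales are multiples of 2^-k / \<Phi>(2^-k), and for positive \<Phi> these are summable exactly if
  1 / \<Phi> is integrable near 0.\<close>

abbreviation MO :: "real measure" where
  "MO \<equiv> restrict_space lborel Omega"

lemma sets_Omega [measurable, simp]: "Omega \<in> sets borel"
  by (simp add: Omega_def)

lemma space_MO [simp]: "space MO = Omega"
  by (simp add: space_restrict_space)

lemma emeasure_MO: "emeasure MO Omega = 1"
  by (simp add: emeasure_restrict_space Omega_def)

lemma prob_MO: "finite_measure MO" "measure MO Omega = 1"
proof -
  show "finite_measure MO"
    by (rule finite_measureI) (simp add: emeasure_MO)
  show "measure MO Omega = 1"
    by (simp add: measure_def emeasure_MO)
qed

interpretation MO: finite_measure MO
  by (rule prob_MO)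

lemma set_integrable_MO: "set_integrable lborel Omega f = integrable MO f"
  for f :: "real \<Rightarrow> real"
  by (simp add: set_integrable_def integrable_restrict_space)

lemma set_integral_MO: "(LINT x:Omega|lborel. f x) = (\<integral>x. f x \<partial>MO)"
  for f :: "real \<Rightarrow> real"
  by (simp add: set_lebesgue_integral_def integral_restrict_space)

lemma AE_MO: "(AE x in MO. Q x) \<longleftrightarrow> (AE x in lborel. x \<in> Omega \<longrightarrow> Q x)"
  by (simp add: AE_restrict_space_iff)

lemma L2_iff: "f \<in> L2 \<longleftrightarrow> f \<in> borel_measurable MO \<and> integrable MO (\<lambda>x. (f x)\<^sup>2)"
  by (simp add: L2_def set_borel_measurable_def set_integrable_MO borel_measurable_restrict_space_iff)

lemma l2_inner_MO: "l2_inner f g = (\<integral>x. f x * g x \<partial>MO)"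
  by (simp add: l2_inner_def set_integral_MO)

lemma alignment_MO: "alignment \<phi> X m = (\<integral>\<omega>. Phi \<phi> (X m - X \<omega>) \<partial>MO)"
  by (simp add: alignment_def set_integral_MO)

lemma measurable_MO_borel: "f \<in> borel_measurable borel \<Longrightarrow> f \<in> borel_measurable MO"
  by (simp add: measurable_restrict_space1)

lemma L2_measurable [measurable_dest]: "f \<in> L2 \<Longrightarrow> f \<in> borel_measurable MO"
  by (simp add: L2_iff)

lemma L2_mult_integrable:
  assumes "f \<in> L2" "g \<in> L2"
  shows "integrable MO (\<lambda>x. f x * g x)"
proof (rule Bochner_Integration.integrable_bound[where f = "\<lambda>x. (f x)\<^sup>2 + (g x)\<^sup>2"])
  show "integrable MO (\<lambda>x. (f x)\<^sup>2 + (g x)\<^sup>2)"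
    using assms by (auto simp: L2_iff)
  show "(\<lambda>x. f x * g x) \<in> borel_measurable MO"
    using assms by (auto simp: L2_iff)
  have "\<bar>a * b\<bar> \<le> a\<^sup>2 + b\<^sup>2" for a b :: real
  proof -
    have "0 \<le> (\<bar>a\<bar> - \<bar>b\<bar>)\<^sup>2" by simp
    also have "\<dots> = a\<^sup>2 + b\<^sup>2 - 2 * \<bar>a * b\<bar>" by (simp add: power2_diff abs_mult)
    finally show ?thesis using abs_ge_zero[of "a * b"] by linarith
  qed
  then show "AE x in MO. norm (f x * g x) \<le> norm ((f x)\<^sup>2 + (g x)\<^sup>2)"
    by auto
qed

lemma L2_const [simp]: "(\<lambda>x. c) \<in> L2"
  by (simp add: L2_iff)

lemma L2_integrable: "f \<in> L2 \<Longrightarrow> integrable MO f"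
  using L2_mult_integrable[of f "\<lambda>x. 1"] by simp

lemma L2_add [intro]: "f \<in> L2 \<Longrightarrow> g \<in> L2 \<Longrightarrow> (\<lambda>x. f x + g x) \<in> L2"
  using L2_mult_integrable[of f g] by (auto simp: L2_iff power2_sum mult.assoc)

lemma L2_cmult [intro]: "f \<in> L2 \<Longrightarrow> (\<lambda>x. c * f x) \<in> L2"
  by (auto simp: L2_iff power_mult_distrib)

lemma L2_diff [intro]: "f \<in> L2 \<Longrightarrow> g \<in> L2 \<Longrightarrow> (\<lambda>x. f x - g x) \<in> L2"
  using L2_add[of f "\<lambda>x. (-1) * g x"] L2_cmult[of g "-1"] by simp

lemma L2_divide [intro]: "f \<in> L2 \<Longrightarrow> (\<lambda>x. f x / c) \<in> L2"
  using L2_cmult[of f "inverse c"] by (simp add: field_simps)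

lemma L2_bound:
  assumes "f \<in> borel_measurable MO" "g \<in> L2" "\<And>x. x \<in> Omega \<Longrightarrow> \<bar>f x\<bar> \<le> \<bar>g x\<bar>"
  shows "f \<in> L2"
proof -
  have "integrable MO (\<lambda>x. (f x)\<^sup>2)"
  proof (rule Bochner_Integration.integrable_bound[where f = "\<lambda>x. (g x)\<^sup>2"])
    show "integrable MO (\<lambda>x. (g x)\<^sup>2)" using assms by (simp add: L2_iff)
    show "(\<lambda>x. (f x)\<^sup>2) \<in> borel_measurable MO" using assms(1) by simp
    show "AE x in MO. norm ((f x)\<^sup>2) \<le> norm ((g x)\<^sup>2)"
      using assms(3) by (auto simp: abs_le_square_iff[symmetric])
  qed
  with assms(1) show ?thesis by (simp add: L2_iff)
qed

lemma L2_abs: "f \<in> L2 \<Longrightarrow> (\<lambda>x. \<bar>f x\<bar>) \<in> L2"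
  by (rule L2_bound) auto

lemma L2_indicator: "A \<in> sets borel \<Longrightarrow> indicator A \<in> L2"
  by (rule L2_bound[of _ "\<lambda>_. 1"]) (auto intro!: measurable_MO_borel simp: indicator_def)

lemma L2_indicator_mult: "A \<in> sets borel \<Longrightarrow> f \<in> L2 \<Longrightarrow> (\<lambda>x. indicator A x * f x) \<in> L2"
  by (rule L2_bound[of _ f])
    (auto intro!: borel_measurable_times intro: measurable_MO_borel borel_measurable_indicator
      simp: L2_iff, auto simp: indicator_def)

lemma l2_inner_add_left: "f \<in> L2 \<Longrightarrow> g \<in> L2 \<Longrightarrow> h \<in> L2 \<Longrightarrow>
    l2_inner (\<lambda>x. f x + g x) h = l2_inner f h + l2_inner g h"
  by (simp add: l2_inner_MO distrib_right L2_mult_integrable)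

lemma l2_inner_diff_left: "f \<in> L2 \<Longrightarrow> g \<in> L2 \<Longrightarrow> h \<in> L2 \<Longrightarrow>
    l2_inner (\<lambda>x. f x - g x) h = l2_inner f h - l2_inner g h"
  by (simp add: l2_inner_MO left_diff_distrib L2_mult_integrable)

lemma l2_inner_cmult_left: "l2_inner (\<lambda>x. c * f x) h = c * l2_inner f h"
  by (simp add: l2_inner_MO mult.assoc)

lemma l2_inner_divide_left: "l2_inner (\<lambda>x. f x / c) h = l2_inner f h / c"
  by (simp add: l2_inner_MO)

lemma l2_inner_commute: "l2_inner f g = l2_inner g f"
  by (simp add: l2_inner_MO mult.commute)

lemma l2_inner_add_right: "f \<in> L2 \<Longrightarrow> g \<in> L2 \<Longrightarrow> h \<in> L2 \<Longrightarrow>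
    l2_inner h (\<lambda>x. f x + g x) = l2_inner h f + l2_inner h g"
  using l2_inner_add_left[of f g h] by (simp add: l2_inner_commute)

lemma l2_inner_diff_right: "f \<in> L2 \<Longrightarrow> g \<in> L2 \<Longrightarrow> h \<in> L2 \<Longrightarrow>
    l2_inner h (\<lambda>x. f x - g x) = l2_inner h f - l2_inner h g"
  using l2_inner_diff_left[of f g h] by (simp add: l2_inner_commute)

lemma l2_inner_cmult_right: "l2_inner h (\<lambda>x. c * f x) = c * l2_inner h f"
  using l2_inner_cmult_left[of c f h] by (simp add: l2_inner_commute)

lemma l2_inner_self_nonneg: "0 \<le> l2_inner f f"
  by (simp add: l2_inner_MO)

lemma l2_norm_nonneg: "0 \<le> l2_norm f"
  by (simp add: l2_norm_def l2_inner_self_nonneg)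

lemma l2_norm_square: "(l2_norm f)\<^sup>2 = l2_inner f f"
  by (simp add: l2_norm_def l2_inner_self_nonneg)

lemma Cauchy_Schwarz_L2:
  assumes f: "f \<in> L2" and g: "g \<in> L2"
  shows "\<bar>l2_inner f g\<bar> \<le> l2_norm f * l2_norm g"
proof -
  define a b c where "a = l2_inner f f" and "b = l2_inner f g" and "c = l2_inner g g"
  have pos: "0 \<le> a + 2 * s * b + s\<^sup>2 * c" for s
  proof -
    have "(\<lambda>x. s * g x) \<in> L2" using g by (rule L2_cmult)
    then have "l2_inner (\<lambda>x. f x + s * g x) (\<lambda>x. f x + s * g x) = a + 2 * s * b + s\<^sup>2 * c"
      using f g L2_add[OF f \<open>(\<lambda>x. s * g x) \<in> L2\<close>]
      by (simp add: l2_inner_add_left l2_inner_add_right l2_inner_cmult_left l2_inner_cmult_right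
          l2_inner_commute[of g f] a_def b_def c_def power2_eq_square algebra_simps)
    then show ?thesis using l2_inner_self_nonneg by metis
  qed
  have "b\<^sup>2 \<le> a * c"
  proof (cases "c = 0")
    case True
    have "b = 0"
    proof (rule ccontr)
      assume "b \<noteq> 0"
      \<comment> \<open>Without the quadratic term the polynomial is linear in \<open>s\<close>; the
        chosen \<open>s\<close> gives it the value -1.\<close>
      have "0 \<le> a + 2 * (- (a + 1) / (2 * b)) * b" using pos[of "- (a + 1) / (2 * b)"] True by simp
      with \<open>b \<noteq> 0\<close> show False by (simp add: field_simps)
    qed
    with True show ?thesis by simp
  next
    case False
    then have c: "c > 0" using l2_inner_self_nonneg[of g] by (simp add: c_def)
    \<comment> \<open>\<open>- b / c\<close> minimises the quadratic.\<close>
    have "0 \<le> a + 2 * (- b / c) * b + (- b / c)\<^sup>2 * c" by (rule pos)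
    also have "\<dots> = a - b\<^sup>2 / c" using c by (simp add: field_simps power2_eq_square)
    finally show ?thesis using c by (simp add: field_simps)
  qed
  then have "sqrt (b\<^sup>2) \<le> sqrt (a * c)" by (rule real_sqrt_le_mono)
  then show ?thesis by (simp add: l2_norm_def a_def b_def c_def real_sqrt_mult)
qed

lemma l2_norm_triangle:
  assumes f: "f \<in> L2" and g: "g \<in> L2"
  shows "l2_norm (\<lambda>x. f x + g x) \<le> l2_norm f + l2_norm g"
proof (rule power2_le_imp_le)
  have "(l2_norm (\<lambda>x. f x + g x))\<^sup>2 = (l2_norm f)\<^sup>2 + 2 * l2_inner f g + (l2_norm g)\<^sup>2"
    using f g L2_add[OF f g] by (simp add: l2_norm_square l2_inner_add_left l2_inner_add_right
        l2_inner_commute[of g f])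
  also have "\<dots> \<le> (l2_norm f + l2_norm g)\<^sup>2"
    using Cauchy_Schwarz_L2[OF f g] by (simp add: power2_sum)
  finally show "(l2_norm (\<lambda>x. f x + g x))\<^sup>2 \<le> (l2_norm f + l2_norm g)\<^sup>2" .
qed (simp add: l2_norm_nonneg)

lemma l2_norm_indicator_le:
  assumes "f \<in> L2" "A \<in> sets borel"
  shows "l2_norm (\<lambda>x. indicator A x * f x) \<le> l2_norm f"
  unfolding l2_norm_def l2_inner_MO using L2_indicator_mult[OF assms(2,1)] assms(1)
  by (auto intro!: real_sqrt_le_mono integral_mono L2_mult_integrable simp: indicator_def)

lemma set_integral_restrict_Omega:
  fixes f :: "real \<Rightarrow> real"
  assumes "A \<subseteq> Omega" "A \<in> sets borel"
  shows "(LINT x:A|lborel. f x) = (\<integral>x. indicator A x * f x \<partial>MO)"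
proof -
  have "(\<integral>x. indicator A x * f x \<partial>MO) = (\<integral>x. indicator Omega x * (indicator A x * f x) \<partial>lborel)"
    by (simp add: integral_restrict_space)
  also have "\<dots> = (\<integral>x. indicator A x * f x \<partial>lborel)"
    by (rule Bochner_Integration.integral_cong) (use assms in \<open>auto simp: indicator_def\<close>)
  finally show ?thesis by (simp add: set_lebesgue_integral_def)
qed

section \<open>Integrals over subintervals of \<Omega>\<close>

definition seg_int :: "(real \<Rightarrow> real) \<Rightarrow> real \<Rightarrow> real \<Rightarrow> real" where
  "seg_int f p q = (\<integral>x. indicator {p<..<q} x * f x \<partial>MO)"

lemma seg_int_inner: "seg_int f p q = l2_inner f (indicator {p<..<q})"
  by (simp add: seg_int_def l2_inner_MO mult.commute)

lemma primitive_seg_int: "m \<le> 1 \<Longrightarrow> primitive f m = seg_int f 0 m"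
  unfolding primitive_def seg_int_def by (rule set_integral_restrict_Omega) (auto simp: Omega_def)

lemma integrable_indicator_MO:
  fixes f :: "real \<Rightarrow> real"
  assumes "integrable MO f"
  shows "integrable MO (\<lambda>x. indicator {p<..<q} x * f x)"
proof (rule Bochner_Integration.integrable_bound[OF assms])
  have [measurable]: "indicator {p<..<q} \<in> borel_measurable MO"
    by (rule measurable_MO_borel) simp
  show "(\<lambda>x. indicator {p<..<q} x * f x) \<in> borel_measurable MO"
    using borel_measurable_integrable[OF assms] by measurable
qed (auto simp: indicator_def)

lemma AE_MO_neq: "AE x in MO. x \<noteq> c"
  unfolding AE_MO using AE_lborel_singleton[of c] by eventually_elim simp

lemma seg_int_add_interval:
  assumes "integrable MO f" "p \<le> q" "q \<le> r"
  shows "seg_int f p r = seg_int f p q + seg_int f q r"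
proof -
  have "seg_int f p r = (\<integral>x. indicator {p<..<q} x * f x + indicator {q<..<r} x * f x \<partial>MO)"
    unfolding seg_int_def
  proof (rule integral_cong_AE)
    show "AE x in MO. indicator {p<..<r} x * f x =
        indicator {p<..<q} x * f x + indicator {q<..<r} x * f x"
      using AE_MO_neq[of q] by eventually_elim (use assms in \<open>auto simp: indicator_def\<close>)
  qed (use integrable_indicator_MO[OF assms(1)] in \<open>auto intro!: borel_measurable_integrable\<close>)
  also have "\<dots> = seg_int f p q + seg_int f q r"
    unfolding seg_int_def using integrable_indicator_MO[OF assms(1)] by simp
  finally show ?thesis .
qed

lemma seg_int_add: "integrable MO f \<Longrightarrow> integrable MO g \<Longrightarrow>
    seg_int (\<lambda>x. f x + g x) p q = seg_int f p q + seg_int g p q"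
  unfolding seg_int_def using integrable_indicator_MO by (simp add: distrib_left)

lemma seg_int_diff: "integrable MO f \<Longrightarrow> integrable MO g \<Longrightarrow>
    seg_int (\<lambda>x. f x - g x) p q = seg_int f p q - seg_int g p q"
  unfolding seg_int_def using integrable_indicator_MO by (simp add: right_diff_distrib)

lemma seg_int_cmult: "seg_int (\<lambda>x. c * f x) p q = c * seg_int f p q"
  unfolding seg_int_def by (simp add: mult.left_commute)

lemma seg_int_const: "0 \<le> p \<Longrightarrow> p \<le> q \<Longrightarrow> q \<le> 1 \<Longrightarrow> seg_int (\<lambda>x. c) p q = c * (q - p)"
proof -
  assume *: "0 \<le> p" "p \<le> q" "q \<le> 1"
  have "seg_int (\<lambda>x. c) p q = (LINT x:{p<..<q}|lborel. c)"
    unfolding seg_int_def by (rule set_integral_restrict_Omega[symmetric]) (use * in \<open>auto simp: Omega_def\<close>)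
  also have "\<dots> = c * (q - p)"
    using * by (simp add: set_lebesgue_integral_def)
  finally show ?thesis .
qed

lemma seg_int_empty [simp]: "seg_int f p p = 0"
  by (simp add: seg_int_def)

lemma seg_int_mono:
  assumes "integrable MO f" "integrable MO g" "\<And>x. x \<in> Omega \<Longrightarrow> p < x \<Longrightarrow> x < q \<Longrightarrow> f x \<le> g x"
  shows "seg_int f p q \<le> seg_int g p q"
  unfolding seg_int_def
  by (rule integral_mono) (use assms integrable_indicator_MO in \<open>auto simp: indicator_def\<close>)

lemma seg_int_cong_AE:
  assumes "f \<in> borel_measurable MO" "g \<in> borel_measurable MO"
    and "AE x in lborel. p < x \<and> x < q \<longrightarrow> f x = g x"
  shows "seg_int f p q = seg_int g p q"
  unfolding seg_int_def
proof (rule integral_cong_AE)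
  have [measurable]: "indicator {p<..<q} \<in> borel_measurable MO" for p q :: real
    by (rule measurable_MO_borel) simp
  show "(\<lambda>x. indicator {p<..<q} x * f x) \<in> borel_measurable MO"
    "(\<lambda>x. indicator {p<..<q} x * g x) \<in> borel_measurable MO"
    using assms(1,2) by measurable
  show "AE x in MO. indicator {p<..<q} x * f x = indicator {p<..<q} x * g x"
    unfolding AE_MO using assms(3) by eventually_elim (auto simp: indicator_def)
qed

lemma seg_int_cong:
  assumes "\<And>x. x \<in> Omega \<Longrightarrow> p < x \<Longrightarrow> x < q \<Longrightarrow> f x = g x"
  shows "seg_int f p q = seg_int g p q"
  unfolding seg_int_def by (rule Bochner_Integration.integral_cong) (use assms in \<open>auto simp: indicator_def\<close>)

lemma seg_int_all: "(\<integral>x. f x \<partial>MO) = seg_int f 0 1"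
  unfolding seg_int_def by (rule Bochner_Integration.integral_cong) (auto simp: Omega_def indicator_def)

section \<open>The primitive of the protocol\<close>

lemma Phi_nonneg_eq: "0 \<le> x \<Longrightarrow> Phi \<phi> x = (LINT y:{0<..<x}|lborel. \<phi> y)"
  by (simp add: Phi_def interval_lebesgue_integral_def einterval_eq)

context
  fixes \<phi> :: "real \<Rightarrow> real"
  assumes protocol: "protocol \<phi>"
begin

lemma phi_nonneg: "0 \<le> \<phi> x"
  using protocol by (simp add: protocol_def)

lemma phi_antimono: "0 < x \<Longrightarrow> x \<le> y \<Longrightarrow> \<phi> y \<le> \<phi> x"
  using protocol by (auto simp: protocol_def)

lemma phi_integrable: "set_integrable lborel {x<..<y} \<phi>"
proof -
  have "set_integrable lborel {x..y} \<phi>"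
    using protocol by (auto simp: protocol_def)
  then show ?thesis by (rule set_integrable_subset) auto
qed

lemma phi_integral_split:
  assumes "x \<le> y" "y \<le> z"
  shows "(LINT u:{x<..<z}|lborel. \<phi> u) = (LINT u:{x<..<y}|lborel. \<phi> u) + (LINT u:{y<..<z}|lborel. \<phi> u)"
proof -
  have "(LINT u:{x<..<z}|lborel. \<phi> u) = (LINT u:{x<..<y} \<union> {y<..<z}|lborel. \<phi> u)"
    unfolding set_lebesgue_integral_def
  proof (rule integral_cong_AE)
    show "AE u in lborel. indicator {x<..<z} u *\<^sub>R \<phi> u = indicator ({x<..<y} \<union> {y<..<z}) u *\<^sub>R \<phi> u"
      using AE_lborel_singleton[of y] by eventually_elim (use assms in \<open>auto simp: indicator_def\<close>)
    show "(\<lambda>u. indicator {x<..<z} u *\<^sub>R \<phi> u) \<in> borel_measurable lborel"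
      using phi_integrable[of x z] by (simp add: set_integrable_def)
    have "set_integrable lborel ({x<..<y} \<union> {y<..<z}) \<phi>"
      by (rule set_integrable_subset[OF phi_integrable[of x z]]) (use assms in auto)
    then show "(\<lambda>u. indicator ({x<..<y} \<union> {y<..<z}) u *\<^sub>R \<phi> u) \<in> borel_measurable lborel"
      by (simp add: set_integrable_def)
  qed
  also have "\<dots> = (LINT u:{x<..<y}|lborel. \<phi> u) + (LINT u:{y<..<z}|lborel. \<phi> u)"
    by (rule set_integral_Un) (auto simp: phi_integrable)
  finally show ?thesis .
qed

lemma phi_integral_bounds:
  assumes "x \<le> y" "\<And>u. x < u \<Longrightarrow> u < y \<Longrightarrow> c \<le> \<phi> u" "\<And>u. x < u \<Longrightarrow> u < y \<Longrightarrow> \<phi> u \<le> d"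
  shows "c * (y - x) \<le> (LINT u:{x<..<y}|lborel. \<phi> u)"
    and "(LINT u:{x<..<y}|lborel. \<phi> u) \<le> d * (y - x)"
proof -
  have c: "(LINT u:{x<..<y}|lborel. k) = k * (y - x)" "set_integrable lborel {x<..<y} (\<lambda>_. k)" for k :: real
    using assms(1) by (simp_all add: set_lebesgue_integral_def set_integrable_def)
  show "c * (y - x) \<le> (LINT u:{x<..<y}|lborel. \<phi> u)"
    unfolding c(1)[symmetric] by (rule set_integral_mono) (use assms c phi_integrable in auto)
  show "(LINT u:{x<..<y}|lborel. \<phi> u) \<le> d * (y - x)"
    unfolding c(1)[symmetric] by (rule set_integral_mono) (use assms c phi_integrable in auto)
qed

lemma phi_integral_nonneg: "0 \<le> (LINT u:{x<..<y}|lborel. \<phi> u)"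
  unfolding set_lebesgue_integral_def by (rule integral_nonneg_AE) (simp add: phi_nonneg)

lemma Phi_zero [simp]: "Phi \<phi> 0 = 0"
  by (simp add: Phi_nonneg_eq set_lebesgue_integral_def)

lemma Phi_nonneg: "0 \<le> x \<Longrightarrow> 0 \<le> Phi \<phi> x"
  by (simp add: Phi_nonneg_eq phi_integral_nonneg)

lemma Phi_odd: "Phi \<phi> (- x) = - Phi \<phi> x"
proof -
  have *: "Phi \<phi> (- x) = - Phi \<phi> x" if "0 < x" for x
  proof -
    have "Phi \<phi> (- x) = - (LINT u:{-x<..<0}|lborel. \<phi> u)"
      using that by (simp add: Phi_def interval_lebesgue_integral_def einterval_eq zero_ereal_def)
    also have "(LINT u:{-x<..<0}|lborel. \<phi> u) = (\<integral>u. indicator {-x<..<0} u * \<phi> u \<partial>lborel)"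
      by (simp add: set_lebesgue_integral_def)
    also have "\<dots> = (\<integral>u. indicator {-x<..<0} (- u) * \<phi> (- u) \<partial>lborel)"
      using lborel_integral_real_affine[of "-1" "\<lambda>u. indicator {-x<..<0} u * \<phi> u" 0] by simp
    also have "\<dots> = (\<integral>u. indicator {0<..<x} u * \<phi> u \<partial>lborel)"
      by (rule Bochner_Integration.integral_cong) (use protocol in \<open>auto simp: protocol_def indicator_def\<close>)
    finally show ?thesis using that by (simp add: Phi_nonneg_eq set_lebesgue_integral_def)
  qed
  consider "x < 0" | "x = 0" | "0 < x" by linarith
  then show ?thesis using *[of x] *[of "-x"] by cases auto
qed

lemma Phi_mono_nonneg: "0 \<le> x \<Longrightarrow> x \<le> y \<Longrightarrow> Phi \<phi> x \<le> Phi \<phi> y"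
  using phi_integral_split[of 0 x y] phi_integral_nonneg[of x y] by (simp add: Phi_nonneg_eq)

lemma Phi_mono:
  assumes "x \<le> y"
  shows "Phi \<phi> x \<le> Phi \<phi> y"
proof -
  consider "0 \<le> x" | "x < 0" "0 \<le> y" | "y < 0" by linarith
  then show ?thesis
  proof cases
    case 1 then show ?thesis using Phi_mono_nonneg assms by blast
  next
    case 2
    then show ?thesis using Phi_nonneg[of "-x"] Phi_nonneg[of y] Phi_odd[of x] by simp
  next
    case 3
    then show ?thesis using Phi_mono_nonneg[of "-y" "-x"] assms by (simp add: Phi_odd)
  qed
qed

text \<open>Concavity on the half line: \<phi> is at least \<open>\<phi> d\<close> to the left of
  \<open>d\<close> and at most \<open>\<phi> d\<close> to the right. The later concavity arguments
  rest on this inequality, which needs no differentiability of \<Phi>.\<close>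

lemma Phi_tangent:
  assumes "0 < d" "0 \<le> x"
  shows "Phi \<phi> x \<le> Phi \<phi> d + \<phi> d * (x - d)"
proof (cases "x \<le> d")
  case True
  have c: "(LINT u:{x<..<d}|lborel. \<phi> d) = \<phi> d * (d - x)" "set_integrable lborel {x<..<d} (\<lambda>_. \<phi> d)"
    using True by (simp_all add: set_lebesgue_integral_def set_integrable_def)
  have "\<phi> d * (d - x) \<le> (LINT u:{x<..<d}|lborel. \<phi> u)"
    unfolding c(1)[symmetric]
    by (rule set_integral_mono) (use assms c phi_integrable phi_antimono in auto)
  then show ?thesis
    using phi_integral_split[of 0 x d] assms True by (simp add: Phi_nonneg_eq algebra_simps)
next
  case False
  then have "(LINT u:{d<..<x}|lborel. \<phi> u) \<le> \<phi> d * (x - d)"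
    using phi_integral_bounds(2)[of d x 0 "\<phi> d"] phi_nonneg phi_antimono assms by auto
  then show ?thesis
    using phi_integral_split[of 0 d x] assms False by (simp add: Phi_nonneg_eq algebra_simps)
qed

text \<open>In multiplied form, the quotient of \<Phi> by its argument is nonincreasing. The tangent
  at \<open>x\<close> bounds \<Phi> at \<open>y\<close> and, evaluated at 0, gives
  \<open>\<phi> x * x \<le> Phi \<phi> x\<close>.\<close>

lemma Phi_star:
  assumes "0 < x" "x \<le> y"
  shows "Phi \<phi> y * x \<le> Phi \<phi> x * y"
proof -
  have 0: "\<phi> x * x \<le> Phi \<phi> x" using Phi_tangent[of x 0] assms by simp
  have "Phi \<phi> y * x \<le> (Phi \<phi> x + \<phi> x * (y - x)) * x"
    using Phi_tangent[of x y] assms by (intro mult_right_mono) auto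
  also have "\<dots> = Phi \<phi> x * x + (\<phi> x * x) * (y - x)" by (simp add: algebra_simps)
  also have "\<dots> \<le> Phi \<phi> x * x + Phi \<phi> x * (y - x)"
    using 0 assms by (intro add_left_mono mult_right_mono) auto
  finally show ?thesis by (simp add: algebra_simps)
qed

lemma Phi_subadditive:
  assumes "0 \<le> x" "0 \<le> y"
  shows "Phi \<phi> (x + y) \<le> Phi \<phi> x + Phi \<phi> y"
proof (cases "x = 0 \<or> y = 0")
  case False
  with assms have pos: "0 < x" "0 < y" by auto
  have "Phi \<phi> (x + y) * (x + y) \<le> (Phi \<phi> x + Phi \<phi> y) * (x + y)"
    using Phi_star[of x "x + y"] Phi_star[of y "x + y"] pos by (simp add: algebra_simps)
  with pos show ?thesis by simp
qed auto

text \<open>The factor 2 comes from the case \<open>x < z < y\<close>, where the two terms have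
  opposite signs and each is bounded separately by \<open>Phi \<phi> (y - x)\<close>. With
  \<open>z\<close> outside, subadditivity gives the bound with factor 1.\<close>

lemma Phi_increment:
  assumes "x \<le> y"
  shows "Phi \<phi> (y - z) - Phi \<phi> (x - z) \<le> 2 * Phi \<phi> (y - x)"
proof -
  have nn: "0 \<le> Phi \<phi> (y - x)" using assms by (simp add: Phi_nonneg)
  consider "z \<le> x" | "y \<le> z" | "x < z" "z < y" by linarith
  then show ?thesis
  proof cases
    case 1
    then show ?thesis using Phi_subadditive[of "x - z" "y - x"] assms nn by simp
  next
    case 2
    have "Phi \<phi> (z - x) \<le> Phi \<phi> (z - y) + Phi \<phi> (y - x)"
      using Phi_subadditive[of "z - y" "y - x"] assms 2 by simp
    moreover have "Phi \<phi> (x - z) = - Phi \<phi> (z - x)" "Phi \<phi> (y - z) = - Phi \<phi> (z - y)"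
      using Phi_odd[of "z - x"] Phi_odd[of "z - y"] by simp_all
    ultimately show ?thesis using nn by simp
  next
    case 3
    have "Phi \<phi> (y - z) \<le> Phi \<phi> (y - x)" "Phi \<phi> (z - x) \<le> Phi \<phi> (y - x)"
      using 3 by (auto intro!: Phi_mono)
    moreover have "Phi \<phi> (x - z) = - Phi \<phi> (z - x)"
      using Phi_odd[of "z - x"] by simp
    ultimately show ?thesis by simp
  qed
qed

text \<open>Subadditivity with the difference split at \<open>z\<close>. This is what lets the mass
  lying between two particles pull them together.\<close>

lemma Phi_increment_between:
  assumes "x \<le> z" "z \<le> y"
  shows "Phi \<phi> (y - x) \<le> Phi \<phi> (y - z) - Phi \<phi> (x - z)"
  using Phi_subadditive[of "y - z" "z - x"] Phi_odd[of "z - x"] assms by simp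

lemma Phi_linear_growth: "\<bar>Phi \<phi> x\<bar> \<le> Phi \<phi> 1 + \<phi> 1 * \<bar>x\<bar>"
proof -
  have *: "\<bar>Phi \<phi> x\<bar> \<le> Phi \<phi> 1 + \<phi> 1 * \<bar>x\<bar>" if "0 \<le> x" for x
    using Phi_tangent[of 1 x] Phi_nonneg[of x] phi_nonneg[of 1] that by (simp add: algebra_simps)
  show ?thesis using *[of x] *[of "-x"] Phi_odd[of x] by (cases "0 \<le> x") auto
qed

lemma Phi_measurable [measurable]: "Phi \<phi> \<in> borel_measurable borel"
  by (rule borel_measurable_mono) (auto intro!: monoI Phi_mono)

text \<open>\<phi> may be unbounded near 0; only its integrability makes \<Phi> small there, hence
  dominated convergence.\<close>

lemma Phi_small:
  assumes "0 < e"
  shows "\<exists>d>0. Phi \<phi> d \<le> e"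
proof -
  have "(\<lambda>n. LINT u:{0<..<1 / real (Suc n)}|lborel. \<phi> u) \<longlonglongrightarrow> (LINT u:({}::real set)|lborel. \<phi> u)"
    unfolding set_lebesgue_integral_def
  proof (rule integral_dominated_convergence[where w = "\<lambda>u. indicator {0<..<1} u * \<phi> u"])
    show "integrable lborel (\<lambda>u. indicator {0<..<1} u * \<phi> u)"
      using phi_integrable[of 0 1] by (simp add: set_integrable_def)
    show "(\<lambda>u. indicator {0<..<1 / real (Suc n)} u *\<^sub>R \<phi> u) \<in> borel_measurable lborel" for n
      using phi_integrable[of 0 "1 / real (Suc n)"] by (simp add: set_integrable_def)
    show "AE u in lborel. norm (indicator {0<..<1 / real (Suc n)} u *\<^sub>R \<phi> u) \<le> indicator {0<..<1} u * \<phi> u" for n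
    proof (rule AE_I2)
      fix u
      have "u < 1" if "u < 1 / real (Suc n)"
        using less_le_trans[OF that, of 1] by simp
      then show "norm (indicator {0<..<1 / real (Suc n)} u *\<^sub>R \<phi> u) \<le> indicator {0<..<1} u * \<phi> u"
        by (cases "u \<in> {0<..<1 / real (Suc n)}") (auto simp: phi_nonneg simp del: of_nat_Suc)
    qed
    show "AE u in lborel. (\<lambda>n. indicator {0<..<1 / real (Suc n)} u *\<^sub>R \<phi> u) \<longlonglongrightarrow> indicator {} u *\<^sub>R \<phi> u"
    proof (rule AE_I2)
      fix u :: real
      have "\<forall>\<^sub>F n in sequentially. u \<notin> {0<..<1 / real (Suc n)}"
      proof (cases "u > 0")
        case True
        have "(\<lambda>n. 1 / real (Suc n)) \<longlonglongrightarrow> 0" by (rule LIMSEQ_Suc[OF lim_1_over_n])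
        then have "\<forall>\<^sub>F n in sequentially. 1 / real (Suc n) < u"
          using True order_tendstoD(2) by blast
        then show ?thesis by eventually_elim auto
      qed auto
      then have "\<forall>\<^sub>F n in sequentially. indicator {0<..<1 / real (Suc n)} u *\<^sub>R \<phi> u = 0"
        by eventually_elim simp
      then show "(\<lambda>n. indicator {0<..<1 / real (Suc n)} u *\<^sub>R \<phi> u) \<longlonglongrightarrow> indicator {} u *\<^sub>R \<phi> u"
        by (simp add: tendsto_eventually)
    qed
  qed simp
  then have "(\<lambda>n. Phi \<phi> (1 / real (Suc n))) \<longlonglongrightarrow> 0"
    by (simp add: Phi_nonneg_eq set_lebesgue_integral_def del: of_nat_Suc)
  then have "\<forall>\<^sub>F n in sequentially. Phi \<phi> (1 / real (Suc n)) < e"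
    using assms order_tendstoD(2) by blast
  then obtain n where "Phi \<phi> (1 / real (Suc n)) < e"
    by (auto simp: eventually_sequentially)
  then show ?thesis by (intro exI[of _ "1 / real (Suc n)"]) auto
qed

text \<open>If \<Phi> vanishes at one \<open>x > 0\<close>, then
  \<open>\<phi> d * d \<le> Phi \<phi> d = 0\<close> for all positive \<open>d \<le> x\<close>, and
  radial monotonicity carries the zero to larger arguments. The value at 0 stays undetermined, hence
  the almost everywhere form.\<close>

lemma Phi_pos_iff:
  assumes "0 < x"
  shows "0 < Phi \<phi> x \<longleftrightarrow> \<not> (AE y in lborel. \<phi> y = 0)"
proof
  assume pos: "0 < Phi \<phi> x"
  show "\<not> (AE y in lborel. \<phi> y = 0)"
  proof
    assume "AE y in lborel. \<phi> y = 0"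
    then have "(LINT y:{0<..<x}|lborel. \<phi> y) = 0"
      unfolding set_lebesgue_integral_def by (intro integral_eq_zero_AE) auto
    with pos assms show False by (simp add: Phi_nonneg_eq)
  qed
next
  assume nz: "\<not> (AE y in lborel. \<phi> y = 0)"
  show "0 < Phi \<phi> x"
  proof (rule ccontr)
    assume "\<not> 0 < Phi \<phi> x"
    then have 0: "Phi \<phi> x = 0" using Phi_nonneg[of x] assms by simp
    have z: "\<phi> y = 0" if "0 < y" for y
    proof -
      define d where "d = min x y"
      have d: "0 < d" "d \<le> x" "d \<le> y" using assms that by (auto simp: d_def)
      have "\<phi> d * d \<le> Phi \<phi> d" using Phi_tangent[of d 0] d by simp
      also have "\<dots> \<le> 0" using Phi_mono[of d x] d 0 by simp
      finally have "\<phi> d \<le> 0" using d by (simp add: mult_le_0_iff)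
      then show ?thesis using phi_antimono[of d y] phi_nonneg[of y] d by linarith
    qed
    have "\<phi> y = 0" if "y \<noteq> 0" for y
      using z[of y] z[of "-y"] protocol that by (cases "0 < y") (auto simp: protocol_def)
    then have "AE y in lborel. \<phi> y = 0"
      using AE_lborel_singleton[of "0::real"] by (auto elim: eventually_mono)
    with nz show False by simp
  qed
qed

section \<open>Dyadic criterion for the integrability of 1 / \<Phi> near 0\<close>

lemma dyadic_cover: "{0<..<1} = (\<Union>k. {(1/2::real) ^ Suc k..<(1/2) ^ k})"
proof safe
  fix x :: real assume x: "x \<in> {0<..<1}"
  then obtain n where n: "(1/2) ^ n < x" using real_arch_pow_inv[of x "1/2"] by auto
  define k where "k = (LEAST k. (1/2) ^ k \<le> x)"
  have k: "(1/2) ^ k \<le> x" unfolding k_def by (rule LeastI[of _ n]) (use n in auto)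
  then obtain j where j: "k = Suc j" using x by (cases k) auto
  have "x < (1/2) ^ j"
    using not_less_Least[of j "\<lambda>k. (1/2) ^ k \<le> x"] j by (simp add: k_def not_le)
  with k j show "x \<in> (\<Union>k. {(1/2::real) ^ Suc k..<(1/2) ^ k})" by (intro UN_I[of j]) auto
next
  fix x :: real and k assume x: "x \<in> {(1/2::real) ^ Suc k..<(1/2) ^ k}"
  have "(1/2::real) ^ k \<le> 1" by (simp add: power_le_one)
  moreover have "(0::real) < (1/2) ^ Suc k" by simp
  moreover have "(1/2) ^ Suc k \<le> x" "x < (1/2) ^ k" using x by (simp_all del: power_Suc)
  ultimately have "0 < x" "x < 1" by (blast intro: less_le_trans)+
  then show "x \<in> {0<..<1}" by simp
qed

lemma dyadic_disjoint: "disjoint_family (\<lambda>k. {(1/2::real) ^ Suc k..<(1/2) ^ k})"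
proof -
  have *: "{(1/2::real) ^ Suc i..<(1/2) ^ i} \<inter> {(1/2::real) ^ Suc j..<(1/2) ^ j} = {}" if "i < j" for i j
  proof -
    have "(1/2::real) ^ j \<le> (1/2) ^ Suc i"
      using that by (intro power_decreasing) auto
    then show ?thesis by auto
  qed
  show ?thesis unfolding disjoint_family_on_def
  proof safe
    fix i j :: nat and x :: real
    assume "i \<noteq> j" "x \<in> {(1/2) ^ Suc i..<(1/2) ^ i}" "x \<in> {(1/2) ^ Suc j..<(1/2) ^ j}"
    then show "x \<in> {}" using *[of i j] *[of j i] by (cases "i < j") auto
  qed
qed

lemma reciprocal_integral_dyadic:
  "reciprocal_integral \<phi> =
    (\<Sum>k. \<integral>\<^sup>+x. (1 / ennreal (Phi \<phi> x)) * indicator {(1/2) ^ Suc k..<(1/2) ^ k} x \<partial>lborel)"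
proof -
  have m: "(\<lambda>x. 1 / ennreal (Phi \<phi> x)) \<in> borel_measurable lborel" by measurable
  have "reciprocal_integral \<phi> =
      (\<integral>\<^sup>+x. (\<Sum>k. (1 / ennreal (Phi \<phi> x)) * indicator {(1/2) ^ Suc k..<(1/2) ^ k} x) \<partial>lborel)"
    unfolding reciprocal_integral_def dyadic_cover
    by (simp add: suminf_indicator[OF dyadic_disjoint, symmetric] del: power_Suc)
  also have "\<dots> = (\<Sum>k. \<integral>\<^sup>+x. (1 / ennreal (Phi \<phi> x)) * indicator {(1/2) ^ Suc k..<(1/2) ^ k} x \<partial>lborel)"
    by (rule nn_integral_suminf) (use m in measurable)
  finally show ?thesis .
qed

text \<open>Integral test on dyadic shells: \<Phi> is monotone, so on the shell from 2^-(k+1) to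
  2^-k, which has length 2^-(k+1), the function 1 / \<Phi> lies between its values at the two ends.
  This bounds the integral over the shell by \<open>s k / 2\<close> from below and by
  \<open>s (Suc k)\<close> from above.\<close>

lemma reciprocal_integral_finite_iff:
  assumes pos: "\<And>x. 0 < x \<Longrightarrow> 0 < Phi \<phi> x"
  shows "reciprocal_integral \<phi> < \<infinity> \<longleftrightarrow> summable (\<lambda>k. (1/2) ^ k / Phi \<phi> ((1/2) ^ k))"
proof -
  define I where "I k = (\<integral>\<^sup>+x. (1 / ennreal (Phi \<phi> x)) * indicator {(1/2) ^ Suc k..<(1/2) ^ k} x \<partial>lborel)" for k
  define s where "s k = (1/2) ^ k / Phi \<phi> ((1/2) ^ k)" for k :: nat
  have s: "0 < s k" for k unfolding s_def using pos[of "(1/2) ^ k"] by simp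
  have em: "emeasure lborel {(1/2::real) ^ Suc k..<(1/2) ^ k} = ennreal ((1/2) ^ Suc k)" for k
  proof -
    have "(1/2::real) ^ k - (1/2) ^ Suc k = (1/2) ^ Suc k" by simp
    moreover have "(1/2::real) ^ Suc k \<le> (1/2) ^ k" by simp
    ultimately show ?thesis by (simp only: emeasure_lborel_Ico)
  qed
  have rec: "1 / ennreal y = ennreal (1 / y)" if "0 < y" for y
    using that by (simp add: divide_ennreal[of 1 y, symmetric] flip: ennreal_1)
  have lower: "ennreal (s k / 2) \<le> I k" for k
  proof -
    have "ennreal (s k / 2) = ennreal (1 / Phi \<phi> ((1/2) ^ k)) * ennreal ((1/2) ^ Suc k)"
      using pos[of "(1/2) ^ k"] by (simp add: s_def ennreal_mult[symmetric])
    also have "\<dots> = (\<integral>\<^sup>+(x::real). ennreal (1 / Phi \<phi> ((1/2) ^ k)) * indicator {(1/2) ^ Suc k..<(1/2) ^ k} x \<partial>lborel)"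
      by (simp add: nn_integral_cmult_indicator em del: power_Suc)
    also have "\<dots> \<le> I k"
      unfolding I_def
    proof (intro nn_integral_mono)
      fix x :: real
      have "ennreal (1 / Phi \<phi> ((1/2) ^ k)) \<le> 1 / ennreal (Phi \<phi> x)" if "x \<in> {(1/2) ^ Suc k..<(1/2) ^ k}"
      proof -
        have "(0::real) < (1/2) ^ Suc k" by simp
        moreover have "(1/2) ^ Suc k \<le> x" "x \<le> (1/2) ^ k"
          using that unfolding atLeastLessThan_iff by linarith+
        ultimately have x: "0 < x" "x \<le> (1/2) ^ k" by linarith+
        show ?thesis unfolding rec[OF pos[OF x(1)]]
          by (intro ennreal_leI divide_left_mono Phi_mono x) (use pos x in auto)
      qed
      then show "ennreal (1 / Phi \<phi> ((1/2) ^ k)) * indicator {(1/2) ^ Suc k..<(1/2) ^ k} x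
          \<le> 1 / ennreal (Phi \<phi> x) * indicator {(1/2) ^ Suc k..<(1/2) ^ k} x"
        by (auto simp: indicator_def)
    qed
    finally show ?thesis .
  qed
  have upper: "I k \<le> ennreal (s (Suc k))" for k
  proof -
    have "I k \<le> (\<integral>\<^sup>+(x::real). ennreal (1 / Phi \<phi> ((1/2) ^ Suc k)) * indicator {(1/2) ^ Suc k..<(1/2) ^ k} x \<partial>lborel)"
      unfolding I_def
    proof (intro nn_integral_mono)
      fix x :: real
      have "1 / ennreal (Phi \<phi> x) \<le> ennreal (1 / Phi \<phi> ((1/2) ^ Suc k))" if "x \<in> {(1/2) ^ Suc k..<(1/2) ^ k}"
      proof -
        have "(0::real) < (1/2) ^ Suc k" by simp
        moreover have "(1/2) ^ Suc k \<le> x" using that unfolding atLeastLessThan_iff by linarith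
        ultimately have x: "0 < x" "(1/2) ^ Suc k \<le> x" by linarith+
        show ?thesis unfolding rec[OF pos[OF x(1)]]
          by (intro ennreal_leI divide_left_mono Phi_mono x mult_pos_pos pos x) auto
      qed
      then show "1 / ennreal (Phi \<phi> x) * indicator {(1/2) ^ Suc k..<(1/2) ^ k} x
          \<le> ennreal (1 / Phi \<phi> ((1/2) ^ Suc k)) * indicator {(1/2) ^ Suc k..<(1/2) ^ k} x"
        by (auto simp: indicator_def)
    qed
    also have "\<dots> = ennreal (1 / Phi \<phi> ((1/2) ^ Suc k)) * ennreal ((1/2) ^ Suc k)"
      by (simp add: nn_integral_cmult_indicator em del: power_Suc)
    also have "\<dots> = ennreal (s (Suc k))"
      using pos[of "(1/2) ^ Suc k"] by (simp add: s_def ennreal_mult[symmetric] del: power_Suc)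
    finally show ?thesis .
  qed
  have R: "reciprocal_integral \<phi> = (\<Sum>k. I k)"
    unfolding I_def by (rule reciprocal_integral_dyadic)
  show ?thesis unfolding s_def[symmetric]
  proof
    assume fin: "reciprocal_integral \<phi> < \<infinity>"
    have "(\<Sum>k. ennreal (s k / 2)) \<le> reciprocal_integral \<phi>"
      unfolding R by (intro suminf_le lower) auto
    with fin have "(\<Sum>k. ennreal (s k / 2)) \<noteq> top" by (auto simp: top_unique)
    then have "summable (\<lambda>k. s k / 2)"
      by (intro summable_suminf_not_top) (use s in \<open>auto intro: less_imp_le\<close>)
    then show "summable s" by (simp add: summable_divide_iff)
  next
    assume "summable s"
    then have "summable (\<lambda>k. s (Suc k))" by (simp add: summable_Suc_iff)
    then have "(\<Sum>k. ennreal (s (Suc k))) = ennreal (\<Sum>k. s (Suc k))"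
      by (intro suminf_ennreal2) (use s in \<open>auto intro: less_imp_le\<close>)
    moreover have "reciprocal_integral \<phi> \<le> (\<Sum>k. ennreal (s (Suc k)))"
      unfolding R by (intro suminf_le upper) auto
    ultimately show "reciprocal_integral \<phi> < \<infinity>"
      by (metis ennreal_less_top infinity_ennreal_def order_le_less_trans)
  qed
qed

end

section \<open>Absolutely continuous scalar functions\<close>

text \<open>Cousin's lemma: near the null exceptional set the increments of \<open>f\<close> are controlled by the
  small integral of \<open>g\<close> over an open neighbourhood, elsewhere by the derivative.\<close>

lemma AE_derivative_nonpos_imp_le:
  fixes f g :: "real \<Rightarrow> real"
  assumes ab: "a \<le> b"
    and g: "set_integrable lborel {a..b} g"
    and bound: "\<And>s t. a \<le> s \<Longrightarrow> s \<le> t \<Longrightarrow> t \<le> b \<Longrightarrow> f t - f s \<le> (LINT r:{s..t}|lborel. g r)"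
    and deriv: "AE t in lborel. a < t \<and> t < b \<longrightarrow> (\<exists>f'\<le>0. (f has_real_derivative f') (at t))"
  shows "f b \<le> f a"
proof (rule field_le_epsilon)
  fix e :: real assume e: "0 < e"
  define h where "h x = indicator {a..b} x * \<bar>g x\<bar>" for x
  have h_int: "integrable lborel h"
    using set_integrable_abs[OF g] by (simp add: h_def[abs_def] set_integrable_def)
  have h_nn: "0 \<le> h x" for x by (simp add: h_def)
  \<comment> \<open>Outer regularity of this finite measure provides an open \<open>U\<close> around
    the exceptional set on which the integral of \<open>h\<close> is less than
    \<open>e / 2\<close>.\<close>
  define M where "M = density lborel (\<lambda>x. ennreal (h x))"
  have hm [measurable]: "h \<in> borel_measurable borel" using h_int by auto
  have sM: "sets M = sets borel" by (simp add: M_def)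
  have M_eq: "emeasure M A = ennreal (\<integral>x. indicator A x * h x \<partial>lborel)" if "A \<in> sets borel" for A
  proof -
    have "emeasure M A = (\<integral>\<^sup>+x. ennreal (indicator A x * h x) \<partial>lborel)"
      unfolding M_def using that
      by (subst emeasure_density) (auto simp: indicator_def intro!: nn_integral_cong)
    also have "\<dots> = ennreal (\<integral>x. indicator A x * h x \<partial>lborel)"
      by (intro nn_integral_eq_integral)
        (use that h_int h_nn in \<open>auto intro!: Bochner_Integration.integrable_bound[OF h_int] simp: indicator_def\<close>)
    finally show ?thesis .
  qed
  obtain N where N: "N \<in> sets borel" "emeasure lborel N = 0"
    "\<And>t. t \<notin> N \<Longrightarrow> a < t \<and> t < b \<longrightarrow> (\<exists>f'\<le>0. (f has_real_derivative f') (at t))"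
    using deriv by (auto elim!: AE_E simp: eventually_ae_filter null_sets_def subset_eq) blast
  \<comment> \<open>The hypothesis says nothing at the endpoints, so they join the exceptional
    set.\<close>
  define N' where "N' = N \<union> {a, b}"
  have N': "N' \<in> sets borel" using N by (simp add: N'_def)
  have nullN': "AE x in lborel. x \<notin> N'"
  proof -
    have "AE x in lborel. x \<notin> N" by (rule AE_I'[of N]) (use N in \<open>auto simp: null_sets_def\<close>)
    moreover have "AE x in lborel. x \<noteq> a" "AE x in lborel. x \<noteq> b" by (rule AE_lborel_singleton)+
    ultimately show ?thesis by eventually_elim (auto simp: N'_def)
  qed
  have "emeasure M N' = 0"
  proof -
    have "(\<integral>x. indicator N' x * h x \<partial>lborel) = 0"
      by (rule integral_eq_zero_AE) (use nullN' in \<open>eventually_elim, auto\<close>)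
    then show ?thesis using M_eq[OF N'] by simp
  qed
  moreover have "emeasure M N' = (INF U\<in>{U. N' \<subseteq> U \<and> open U}. emeasure M U)"
    by (rule outer_regular) (use sM N' M_eq[of "space M"] in \<open>auto simp: M_def\<close>)
  ultimately have "(INF U\<in>{U. N' \<subseteq> U \<and> open U}. emeasure M U) < ennreal (e / 2)"
    using e by simp
  then obtain U where U: "N' \<subseteq> U" "open U" "emeasure M U < ennreal (e / 2)"
    by (auto simp: INF_less_iff)
  define \<mu> where "\<mu> s t = (\<integral>x. indicator (U \<inter> {s<..<t}) x * h x \<partial>lborel)" for s t
  have Ub: "U \<in> sets borel" using U by auto
  have int_ind: "integrable lborel (\<lambda>x. indicator A x * h x)" if "A \<in> sets borel" for A
    using that h_int h_nn by (auto intro!: Bochner_Integration.integrable_bound[OF h_int] simp: indicator_def)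
  have mu_le: "\<mu> a b \<le> e / 2"
  proof -
    have "\<mu> a b \<le> (\<integral>x. indicator U x * h x \<partial>lborel)"
      unfolding \<mu>_def using Ub h_nn by (intro integral_mono int_ind) (auto simp: indicator_def)
    moreover have "(\<integral>x. indicator U x * h x \<partial>lborel) < e / 2"
      using U(3) M_eq[OF Ub] e by (simp add: ennreal_less_iff h_nn)
    ultimately show ?thesis by simp
  qed
  \<comment> \<open>The extra 1 keeps the denominator positive when \<open>a = b\<close>; over all
    of \<open>[a, b]\<close> the cost is \<open>e' * (b - a) \<le> e / 2\<close>.\<close>
  define e' where "e' = e / (2 * (b - a + 1))"
  have e': "0 < e'" using e ab by (simp add: e'_def)
  \<comment> \<open>\<open>Q\<close> passes from two abutting intervals to their union, because
    \<open>\<mu>\<close> is superadditive, and it holds on all short intervals around any given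
    point; \<open>Bolzano\<close> then yields it on \<open>[a, b]\<close>.\<close>
  define Q where "Q s t \<longleftrightarrow> (a \<le> s \<and> s \<le> t \<and> t \<le> b \<longrightarrow> f t - f s \<le> e' * (t - s) + \<mu> s t)" for s t
  have "Q a b"
  proof (rule Bolzano[OF ab])
    fix x y z assume Q: "Q x y" "Q y z" and le: "x \<le> y" "y \<le> z"
    have "\<mu> x y + \<mu> y z \<le> \<mu> x z"
    proof -
      have "\<mu> x y + \<mu> y z = (\<integral>u. indicator (U \<inter> {x<..<y}) u * h u + indicator (U \<inter> {y<..<z}) u * h u \<partial>lborel)"
        unfolding \<mu>_def using Ub by (subst Bochner_Integration.integral_add) (auto intro!: int_ind)
      also have "\<dots> \<le> \<mu> x z"
        unfolding \<mu>_def using Ub le h_nn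
        by (intro integral_mono Bochner_Integration.integrable_add int_ind) (auto simp: indicator_def)
      finally show ?thesis .
    qed
    moreover have "e' * (y - x) + e' * (z - y) = e' * (z - x)" by (simp add: algebra_simps)
    ultimately show "Q x z" using Q le unfolding Q_def by (smt (verit))
  next
    fix x assume x: "a \<le> x" "x \<le> b"
    show "\<exists>d>0. \<forall>s t. s \<le> x \<and> x \<le> t \<and> t - s < d \<longrightarrow> Q s t"
    proof (cases "x \<in> N'")
      case True
      then obtain d where d: "0 < d" "ball x d \<subseteq> U" using U open_contains_ball by blast
      have "Q s t" if st: "s \<le> x" "x \<le> t" "t - s < d" for s t
        unfolding Q_def
      proof (intro impI)
        assume *: "a \<le> s \<and> s \<le> t \<and> t \<le> b"
        have gi: "set_integrable lborel {s..t} g" by (rule set_integrable_subset[OF g]) (use * in auto)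
        have "f t - f s \<le> (LINT r:{s..t}|lborel. g r)" using bound * by auto
        also have "\<dots> \<le> (\<integral>r. indicator (U \<inter> {s<..<t}) r * h r \<partial>lborel)"
          unfolding set_lebesgue_integral_def
        proof (rule integral_mono_AE)
          show "integrable lborel (\<lambda>r. indicator {s..t} r *\<^sub>R g r)" using gi by (simp add: set_integrable_def)
          show "integrable lborel (\<lambda>r. indicator (U \<inter> {s<..<t}) r * h r)" using Ub by (intro int_ind) auto
          show "AE r in lborel. indicator {s..t} r *\<^sub>R g r \<le> indicator (U \<inter> {s<..<t}) r * h r"
            using AE_lborel_singleton[of s] AE_lborel_singleton[of t]
          proof eventually_elim
            case (elim r)
            have "r \<in> U" if "s < r" "r < t" using that st d(2) by (auto simp: dist_real_def subset_eq)
            then show ?case using elim * by (auto simp: indicator_def h_def)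
          qed
        qed
        also have "\<dots> \<le> e' * (t - s) + \<mu> s t" using e' * by (simp add: \<mu>_def)
        finally show "f t - f s \<le> e' * (t - s) + \<mu> s t" .
      qed
      with d show ?thesis by blast
    next
      case False
      with N x obtain f' where f': "f' \<le> 0" "(f has_real_derivative f') (at x)"
        unfolding N'_def by force
      then obtain d where d: "0 < d" "\<And>y. y \<noteq> x \<Longrightarrow> \<bar>y - x\<bar> < d \<Longrightarrow> \<bar>(f y - f x) / (y - x) - f'\<bar> < e'"
        using e' unfolding has_field_derivative_iff LIM_def dist_real_def by (metis diff_0_right real_norm_def)
      have right: "f t - f x \<le> e' * (t - x)" if "x \<le> t" "t - x < d" for t
      proof (cases "t = x")
        case False
        then have "(f t - f x) / (t - x) < f' + e'" using d(2)[of t] that by (auto simp: abs_less_iff)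
        then have "(f t - f x) / (t - x) \<le> e'" using f' by linarith
        then show ?thesis using False that by (simp add: divide_simps mult.commute split: if_splits)
      qed simp
      have left: "f x - f s \<le> e' * (x - s)" if "s \<le> x" "x - s < d" for s
      proof (cases "s = x")
        case False
        then have "(f s - f x) / (s - x) < f' + e'" using d(2)[of s] that by (auto simp: abs_less_iff)
        then have "(f s - f x) / (s - x) \<le> e'" using f' by linarith
        moreover have "(f s - f x) / (s - x) = (f x - f s) / (x - s)" by (metis minus_diff_eq minus_divide_divide)
        ultimately show ?thesis using False that by (simp add: divide_simps mult.commute split: if_splits)
      qed simp
      have mu0: "0 \<le> \<mu> s t" for s t unfolding \<mu>_def by (rule integral_nonneg_AE) (simp add: h_nn)
      have "Q s t" if "s \<le> x" "x \<le> t" "t - s < d" for s t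
        using right[of t] left[of s] that mu0[of s t] by (auto simp: Q_def algebra_simps)
      with d(1) show ?thesis by blast
    qed
  qed
  then have "f b - f a \<le> e' * (b - a) + e / 2" using ab mu_le by (auto simp: Q_def)
  also have "e' * (b - a) \<le> e / 2" using e ab by (simp add: e'_def field_simps)
  finally show "f b \<le> f a + e" by simp
qed

text \<open>Absolute continuity on every \<open>[0, T]\<close>, in the form supplied by
  \<open>abs_cont_curve\<close>. The dominating function may depend on \<open>T\<close>, because
  squaring is Lipschitz only on the bounded range of \<open>f\<close> over
  \<open>[0, T]\<close>.\<close>

definition dominated :: "(real \<Rightarrow> real) \<Rightarrow> bool" where
  "dominated f \<longleftrightarrow> (\<forall>T\<ge>0. \<exists>g. set_integrable lborel {0..T} g \<and>
     (\<forall>s t. 0 \<le> s \<and> s \<le> t \<and> t \<le> T \<longrightarrow> \<bar>f t - f s\<bar> \<le> (LINT r:{s..t}|lborel. g r)))"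

lemma dominatedI:
  assumes "\<And>T. 0 \<le> T \<Longrightarrow> \<exists>g. set_integrable lborel {0..T} g \<and>
     (\<forall>s t. 0 \<le> s \<and> s \<le> t \<and> t \<le> T \<longrightarrow> \<bar>f t - f s\<bar> \<le> (LINT r:{s..t}|lborel. g r))"
  shows "dominated f"
  using assms unfolding dominated_def by blast

lemma dominatedE:
  assumes "dominated f" "0 \<le> T"
  obtains g where "set_integrable lborel {0..T} g"
    "\<And>s t. 0 \<le> s \<Longrightarrow> s \<le> t \<Longrightarrow> t \<le> T \<Longrightarrow> \<bar>f t - f s\<bar> \<le> (LINT r:{s..t}|lborel. g r)"
  using assms unfolding dominated_def by metis

lemma set_integrable_Icc_subset:
  fixes g :: "real \<Rightarrow> real"
  assumes "set_integrable lborel {0..T} g" "0 \<le> s" "t \<le> T"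
  shows "set_integrable lborel {s..t} g"
  by (rule set_integrable_subset[OF assms(1)]) (use assms in auto)

lemma dominated_add:
  assumes "dominated f" "dominated h"
  shows "dominated (\<lambda>t. f t + h t)"
proof (rule dominatedI)
  fix T :: real assume T: "0 \<le> T"
  obtain g where g: "set_integrable lborel {0..T} g"
      "\<And>s t. 0 \<le> s \<Longrightarrow> s \<le> t \<Longrightarrow> t \<le> T \<Longrightarrow> \<bar>f t - f s\<bar> \<le> (LINT r:{s..t}|lborel. g r)"
    using dominatedE[OF assms(1) T] by blast
  obtain k where k: "set_integrable lborel {0..T} k"
      "\<And>s t. 0 \<le> s \<Longrightarrow> s \<le> t \<Longrightarrow> t \<le> T \<Longrightarrow> \<bar>h t - h s\<bar> \<le> (LINT r:{s..t}|lborel. k r)"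
    using dominatedE[OF assms(2) T] by blast
  have "set_integrable lborel {0..T} (\<lambda>r. g r + k r)"
    by (rule set_integral_add(1)[OF g(1) k(1)])
  moreover have "\<bar>f t + h t - (f s + h s)\<bar> \<le> (LINT r:{s..t}|lborel. g r + k r)"
    if st: "0 \<le> s" "s \<le> t" "t \<le> T" for s t
  proof -
    have "(LINT r:{s..t}|lborel. g r + k r) = (LINT r:{s..t}|lborel. g r) + (LINT r:{s..t}|lborel. k r)"
      by (intro set_integral_add(2) set_integrable_Icc_subset[OF g(1)] set_integrable_Icc_subset[OF k(1)] st)
    then show ?thesis using g(2)[OF st] k(2)[OF st] by linarith
  qed
  ultimately show "\<exists>g. set_integrable lborel {0..T} g \<and> (\<forall>s t. 0 \<le> s \<and> s \<le> t \<and> t \<le> T \<longrightarrow>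
      \<bar>f t + h t - (f s + h s)\<bar> \<le> (LINT r:{s..t}|lborel. g r))"
    by blast
qed

lemma dominated_Lipschitz:
  assumes f: "dominated f"
    and h: "\<And>T. 0 \<le> T \<Longrightarrow> \<exists>M\<ge>0. \<forall>s t. 0 \<le> s \<and> s \<le> t \<and> t \<le> T \<longrightarrow> \<bar>h t - h s\<bar> \<le> M * \<bar>f t - f s\<bar>"
  shows "dominated h"
proof (rule dominatedI)
  fix T :: real assume T: "0 \<le> T"
  obtain g where g: "set_integrable lborel {0..T} g"
      "\<And>s t. 0 \<le> s \<Longrightarrow> s \<le> t \<Longrightarrow> t \<le> T \<Longrightarrow> \<bar>f t - f s\<bar> \<le> (LINT r:{s..t}|lborel. g r)"
    using dominatedE[OF f T] by blast
  obtain M where M: "0 \<le> M" "\<And>s t. 0 \<le> s \<Longrightarrow> s \<le> t \<Longrightarrow> t \<le> T \<Longrightarrow> \<bar>h t - h s\<bar> \<le> M * \<bar>f t - f s\<bar>"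
    using h[OF T] by blast
  have "set_integrable lborel {0..T} (\<lambda>r. M * g r)" using g(1) by simp
  moreover have "\<bar>h t - h s\<bar> \<le> (LINT r:{s..t}|lborel. M * g r)" if st: "0 \<le> s" "s \<le> t" "t \<le> T" for s t
    using M(2)[OF st] mult_left_mono[OF g(2)[OF st] M(1)] by simp
  ultimately show "\<exists>g. set_integrable lborel {0..T} g \<and> (\<forall>s t. 0 \<le> s \<and> s \<le> t \<and> t \<le> T \<longrightarrow>
      \<bar>h t - h s\<bar> \<le> (LINT r:{s..t}|lborel. g r))"
    by blast
qed

lemma dominated_cmult:
  assumes "dominated f"
  shows "dominated (\<lambda>t. c * f t)"
proof (rule dominated_Lipschitz[OF assms])
  have "\<bar>c * f t - c * f s\<bar> \<le> \<bar>c\<bar> * \<bar>f t - f s\<bar>" for s t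
    by (simp flip: right_diff_distrib abs_mult)
  then show "\<exists>M\<ge>0. \<forall>s t. 0 \<le> s \<and> s \<le> t \<and> t \<le> T \<longrightarrow> \<bar>c * f t - c * f s\<bar> \<le> M * \<bar>f t - f s\<bar>" for T
    by (intro exI[of _ "\<bar>c\<bar>"]) auto
qed

lemma dominated_diff: "dominated f \<Longrightarrow> dominated h \<Longrightarrow> dominated (\<lambda>t. f t - h t)"
  using dominated_add[of f "\<lambda>t. (-1) * h t"] dominated_cmult[of h "-1"] by simp

lemma dominated_ident: "dominated (\<lambda>t. t)"
  by (rule dominatedI, intro exI[of _ "\<lambda>_. 1"])
    (auto simp: set_integrable_def set_lebesgue_integral_def)

lemma dominated_continuous_on:
  assumes "dominated f"
  shows "continuous_on {0..T} f"
proof (cases "0 \<le> T")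
  case True
  obtain g where g: "set_integrable lborel {0..T} g"
      "\<And>s t. 0 \<le> s \<Longrightarrow> s \<le> t \<Longrightarrow> t \<le> T \<Longrightarrow> \<bar>f t - f s\<bar> \<le> (LINT r:{s..t}|lborel. g r)"
    using dominatedE[OF assms True] by blast
  define G where "G t = integral {0..t} g" for t
  have gi: "g integrable_on {0..T}"
    using set_borel_integral_eq_integral(1)[OF g(1)] .
  have contG: "continuous_on {0..T} G"
    unfolding G_def by (rule indefinite_integral_continuous_1[OF gi])
  have diff: "\<bar>f t - f s\<bar> \<le> \<bar>G t - G s\<bar>" if "s \<in> {0..T}" "t \<in> {0..T}" for s t
  proof -
    have *: "\<bar>f t - f s\<bar> \<le> \<bar>G t - G s\<bar>" if "s \<in> {0..T}" "t \<in> {0..T}" "s \<le> t" for s t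
    proof -
      have "(LINT r:{s..t}|lborel. g r) = integral {s..t} g"
        by (rule set_borel_integral_eq_integral(2), rule set_integrable_Icc_subset[OF g(1)]) (use that in auto)
      also have "integral {0..s} g + integral {s..t} g = integral {0..t} g"
        by (rule Henstock_Kurzweil_Integration.integral_combine)
          (use that in \<open>auto intro: integrable_on_subinterval[OF gi]\<close>)
      then have "integral {s..t} g = G t - G s" by (simp add: G_def)
      finally show ?thesis using g(2)[of s t] that by simp
    qed
    show ?thesis using *[of s t] *[of t s] that by (cases "s \<le> t") (auto simp: abs_minus_commute)
  qed
  show ?thesis
    unfolding continuous_on_iff
  proof (intro ballI allI impI)
    fix x e :: real assume x: "x \<in> {0..T}" and e: "0 < e"
    obtain d where d: "0 < d" "\<And>y. y \<in> {0..T} \<Longrightarrow> dist y x < d \<Longrightarrow> dist (G y) (G x) < e"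
      using contG x e unfolding continuous_on_iff by blast
    have "dist (f y) (f x) < e" if "y \<in> {0..T}" "dist y x < d" for y
      using d(2)[OF that] diff[OF x that(1)] by (simp add: dist_real_def)
    with d(1) show "\<exists>d>0. \<forall>y\<in>{0..T}. dist y x < d \<longrightarrow> dist (f y) (f x) < e"
      by blast
  qed
qed simp

lemma dominated_square:
  assumes f: "dominated f"
  shows "dominated (\<lambda>t. (f t)\<^sup>2)"
proof (rule dominated_Lipschitz[OF f])
  fix T :: real assume "0 \<le> T"
  have "compact (f ` {0..T})"
    by (intro compact_continuous_image dominated_continuous_on f) simp
  then obtain M where "\<forall>x\<in>f ` {0..T}. norm x \<le> M"
    using compact_imp_bounded bounded_iff by metis
  then have M: "\<bar>f t\<bar> \<le> M" if "t \<in> {0..T}" for t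
    using that by simp
  have "\<bar>(f t)\<^sup>2 - (f s)\<^sup>2\<bar> \<le> (2 * M) * \<bar>f t - f s\<bar>" if "0 \<le> s" "s \<le> t" "t \<le> T" for s t
  proof -
    have "(f t)\<^sup>2 - (f s)\<^sup>2 = (f t + f s) * (f t - f s)" by (simp add: power2_eq_square algebra_simps)
    then have "\<bar>(f t)\<^sup>2 - (f s)\<^sup>2\<bar> = \<bar>f t + f s\<bar> * \<bar>f t - f s\<bar>" by (simp add: abs_mult)
    also have "\<bar>f t + f s\<bar> \<le> 2 * M" using M[of s] M[of t] that by auto
    finally show ?thesis by (simp add: mult_right_mono)
  qed
  moreover have "0 \<le> 2 * M" using M[of 0] \<open>0 \<le> T\<close> by auto
  ultimately show "\<exists>M\<ge>0. \<forall>s t. 0 \<le> s \<and> s \<le> t \<and> t \<le> T \<longrightarrow> \<bar>(f t)\<^sup>2 - (f s)\<^sup>2\<bar> \<le> M * \<bar>f t - f s\<bar>"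
    by blast
qed

lemma dominated_increment_le:
  assumes f: "dominated f" and st: "0 \<le> s" "s \<le> t"
    and d: "AE r in lborel. s < r \<and> r < t \<longrightarrow> (\<exists>f'\<le>\<kappa>. (f has_real_derivative f') (at r))"
  shows "f t - f s \<le> \<kappa> * (t - s)"
proof -
  have "dominated (\<lambda>r. f r - \<kappa> * r)"
    by (intro dominated_diff f dominated_cmult dominated_ident)
  moreover have "0 \<le> t" using st by simp
  ultimately obtain g where g: "set_integrable lborel {0..t} g"
      "\<And>u v. 0 \<le> u \<Longrightarrow> u \<le> v \<Longrightarrow> v \<le> t \<Longrightarrow>
        \<bar>(f v - \<kappa> * v) - (f u - \<kappa> * u)\<bar> \<le> (LINT r:{u..v}|lborel. g r)"
    by (rule dominatedE) blast
  have "f t - \<kappa> * t \<le> f s - \<kappa> * s"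
  proof (rule AE_derivative_nonpos_imp_le[OF st(2), of g])
    show "set_integrable lborel {s..t} g" by (rule set_integrable_Icc_subset[OF g(1)]) (use st in auto)
    show "f v - \<kappa> * v - (f u - \<kappa> * u) \<le> (LINT r:{u..v}|lborel. g r)" if "s \<le> u" "u \<le> v" "v \<le> t" for u v
      using g(2)[of u v] that st by simp
    show "AE r in lborel. s < r \<and> r < t \<longrightarrow> (\<exists>f'\<le>0. ((\<lambda>r. f r - \<kappa> * r) has_real_derivative f') (at r))"
      using d
    proof eventually_elim
      case (elim r)
      show ?case
      proof
        assume "s < r \<and> r < t"
        with elim obtain f' where f': "f' \<le> \<kappa>" "(f has_real_derivative f') (at r)" by blast
        then have "((\<lambda>r. f r - \<kappa> * r) has_real_derivative f' - \<kappa>) (at r)"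
          by (auto intro!: derivative_eq_intros)
        with f' show "\<exists>f'\<le>0. ((\<lambda>r. f r - \<kappa> * r) has_real_derivative f') (at r)"
          by (intro exI[of _ "f' - \<kappa>"]) auto
      qed
    qed
  qed
  then show ?thesis by (simp add: algebra_simps)
qed

lemma dominated_increment_ge:
  assumes f: "dominated f" and st: "0 \<le> s" "s \<le> t"
    and d: "AE r in lborel. s < r \<and> r < t \<longrightarrow> (\<exists>f'\<ge>\<kappa>. (f has_real_derivative f') (at r))"
  shows "\<kappa> * (t - s) \<le> f t - f s"
proof -
  have "(\<lambda>r. (-1) * f r) t - (\<lambda>r. (-1) * f r) s \<le> (-\<kappa>) * (t - s)"
  proof (rule dominated_increment_le[OF dominated_cmult[OF f] st])
    show "AE r in lborel. s < r \<and> r < t \<longrightarrow> (\<exists>f'\<le>-\<kappa>. ((\<lambda>r. (-1) * f r) has_real_derivative f') (at r))"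
      using d
    proof eventually_elim
      case (elim r)
      show ?case
      proof
        assume "s < r \<and> r < t"
        with elim obtain f' where "f' \<ge> \<kappa>" "(f has_real_derivative f') (at r)" by blast
        then show "\<exists>f'\<le>-\<kappa>. ((\<lambda>r. (-1) * f r) has_real_derivative f') (at r)"
          by (intro exI[of _ "-f'"]) (auto intro!: derivative_eq_intros)
      qed
    qed
  qed
  then show ?thesis by simp
qed

text \<open>The derivative bound is available only while \<open>f \<le> d\<close>. If
  \<open>f\<close> never reaches \<open>d\<close>, it holds throughout; otherwise it holds after the
  last time \<open>r\<close> in \<open>[s, t]\<close> with \<open>d \<le> f r\<close>, which exists
  by compactness. The two alternatives record from which value the growth starts.\<close>

lemma dominated_barrier:
  assumes f: "dominated f" and st: "0 \<le> s" "s \<le> t"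
    and d: "AE r in lborel. s < r \<and> r < t \<and> f r \<le> d \<longrightarrow> (\<exists>f'\<ge>\<kappa>. (f has_real_derivative f') (at r))"
  shows "f s + \<kappa> * (t - s) \<le> f t \<or> (\<exists>r\<in>{s..t}. d \<le> f r \<and> d + \<kappa> * (t - r) \<le> f t)"
proof (cases "\<exists>r\<in>{s..t}. d \<le> f r")
  case False
  have "\<kappa> * (t - s) \<le> f t - f s"
  proof (rule dominated_increment_ge[OF f st])
    show "AE r in lborel. s < r \<and> r < t \<longrightarrow> (\<exists>f'\<ge>\<kappa>. (f has_real_derivative f') (at r))"
      using d
    proof eventually_elim
      case (elim r)
      have "f r \<le> d" if "s < r" "r < t"
      proof (rule ccontr)
        assume "\<not> f r \<le> d"
        with that have "\<exists>r\<in>{s..t}. d \<le> f r" by (intro bexI[of _ r]) auto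
        with False show False by simp
      qed
      then show ?case using elim by blast
    qed
  qed
  then show ?thesis by simp
next
  case True
  define S where "S = {r\<in>{s..t}. d \<le> f r}"
  have cont: "continuous_on {s..t} f"
    by (rule continuous_on_subset[OF dominated_continuous_on[OF f, of t]]) (use st in auto)
  have "S = {s..t} \<inter> f -` {d..}" by (auto simp: S_def)
  then have "compact S"
    using continuous_closed_preimage[OF cont, of "{d..}"] by (simp add: compact_eq_bounded_closed bounded_Int)
  moreover have "S \<noteq> {}" using True by (auto simp: S_def)
  ultimately obtain r where r: "r \<in> S" "\<And>x. x \<in> S \<Longrightarrow> x \<le> r"
    using compact_attains_sup[of S] by metis
  have rs: "0 \<le> r" "r \<le> t" "s \<le> r" "d \<le> f r" using r(1) st by (auto simp: S_def)
  have "\<kappa> * (t - r) \<le> f t - f r"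
  proof (rule dominated_increment_ge[OF f rs(1,2)])
    show "AE x in lborel. r < x \<and> x < t \<longrightarrow> (\<exists>f'\<ge>\<kappa>. (f has_real_derivative f') (at x))"
      using d
    proof eventually_elim
      case (elim x)
      have "f x \<le> d" if "r < x" "x < t" using r(2)[of x] that rs by (force simp: S_def)
      then show ?case using elim rs by auto
    qed
  qed
  then show ?thesis using rs by (intro disjI2 bexI[of _ r]) auto
qed

section \<open>Nondecreasing functions and their constancy intervals\<close>

lemma sets_MO: "sets MO = sets (restrict_space borel Omega)"
  by (simp add: sets_restrict_space)

lemma mono_on_measurable_MO: "mono_on Omega f \<Longrightarrow> f \<in> borel_measurable MO" for f :: "real \<Rightarrow> real"
  using borel_measurable_mono_on_fnc[of Omega f] measurable_cong_sets[OF sets_MO refl] by blast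

lemma K_L2: "X \<in> K \<Longrightarrow> X \<in> L2"
  and K_mono: "X \<in> K \<Longrightarrow> x \<in> Omega \<Longrightarrow> y \<in> Omega \<Longrightarrow> x \<le> y \<Longrightarrow> X x \<le> X y"
  and K_right: "X \<in> K \<Longrightarrow> x \<in> Omega \<Longrightarrow> (X \<longlongrightarrow> X x) (at_right x)"
  by (auto simp: K_def mono_on_def continuous_within)

lemma K_I:
  assumes "X \<in> L2" "\<And>x y. x \<in> Omega \<Longrightarrow> y \<in> Omega \<Longrightarrow> x \<le> y \<Longrightarrow> X x \<le> X y"
    "\<And>x. x \<in> Omega \<Longrightarrow> (X \<longlongrightarrow> X x) (at_right x)"
  shows "X \<in> K"
  using assms by (auto simp: K_def mono_on_def continuous_within)

lemma K_add: "X \<in> K \<Longrightarrow> Y \<in> K \<Longrightarrow> (\<lambda>x. X x + Y x) \<in> K"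
  by (intro K_I L2_add tendsto_add) (auto simp: K_L2 K_right intro: add_mono K_mono)

lemma K_cmult: "X \<in> K \<Longrightarrow> 0 \<le> c \<Longrightarrow> (\<lambda>x. c * X x) \<in> K"
  by (intro K_I L2_cmult tendsto_mult tendsto_const) (auto simp: K_L2 K_right intro: mult_left_mono K_mono)

lemma K_const: "(\<lambda>x. c) \<in> K"
  by (intro K_I) auto

lemma tendsto_at_right_cong:
  fixes f :: "real \<Rightarrow> real"
  assumes "x < b" "\<And>y. x < y \<Longrightarrow> y < b \<Longrightarrow> f y = g y" "(g \<longlongrightarrow> l) (at_right x)"
  shows "(f \<longlongrightarrow> l) (at_right x)"
proof -
  have "\<forall>\<^sub>F y in at_right x. f y = g y"
    using assms(1,2) by (auto simp: eventually_at_right_field)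
  then show ?thesis using assms(3) tendsto_cong by blast
qed

lemma K_indicator: "(indicator {m..} :: real \<Rightarrow> real) \<in> K"
proof (rule K_I)
  fix x :: real
  show "((indicator {m..} :: real \<Rightarrow> real) \<longlongrightarrow> indicator {m..} x) (at_right x)"
  proof (cases "x < m")
    case True
    show ?thesis by (rule tendsto_at_right_cong[of x m _ "\<lambda>_. 0"]) (use True in auto)
  next
    case False
    show ?thesis by (rule tendsto_at_right_cong[of x "x + 1" _ "\<lambda>_. 1"]) (use False in auto)
  qed
next
  show "(indicator {m..} :: real \<Rightarrow> real) \<in> L2" by (rule L2_indicator) simp
qed (simp add: indicator_def)

text \<open>Since truncation and remainder are both nondecreasing, the truncation can be added to
  and subtracted from \<open>X\<close> without leaving the cone, and so elements of the normal cone
  at \<open>X\<close> are orthogonal to it.\<close>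

lemma K_clamp:
  assumes "X \<in> K" "l \<le> u"
  shows "(\<lambda>x. max l (min u (X x))) \<in> K" "(\<lambda>x. X x - max l (min u (X x))) \<in> K"
proof -
  show 1: "(\<lambda>x. max l (min u (X x))) \<in> K"
  proof (rule K_I)
    show "(\<lambda>x. max l (min u (X x))) \<in> L2"
      by (rule L2_bound[of _ "\<lambda>x. \<bar>l\<bar> + \<bar>X x\<bar>"])
        (use assms K_L2[OF assms(1)] in \<open>auto intro!: L2_add L2_abs simp: min_def max_def\<close>)
  next
    fix x y assume "x \<in> Omega" "y \<in> Omega" "x \<le> y"
    then have "X x \<le> X y" using K_mono[OF assms(1)] by blast
    then show "max l (min u (X x)) \<le> max l (min u (X y))" by (auto simp: min_def max_def)
  qed (intro tendsto_max tendsto_min tendsto_const K_right assms)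
  show "(\<lambda>x. X x - max l (min u (X x))) \<in> K"
  proof (rule K_I)
    fix x y assume "x \<in> Omega" "y \<in> Omega" "x \<le> y"
    then have "X x \<le> X y" using K_mono[OF assms(1)] by blast
    then show "X x - max l (min u (X x)) \<le> X y - max l (min u (X y))"
      using assms(2) by (auto simp: min_def max_def)
  next
    show "(\<lambda>x. X x - max l (min u (X x))) \<in> L2" by (intro L2_diff K_L2 assms 1)
  qed (intro tendsto_diff K_right assms 1)
qed

section \<open>Continuity of primitives of square integrable functions\<close>

lemma seg_int_abs_le:
  assumes "f \<in> L2" "0 \<le> p" "p \<le> q" "q \<le> 1"
  shows "seg_int (\<lambda>x. \<bar>f x\<bar>) p q \<le> l2_norm f * sqrt (q - p)"
proof -
  have "seg_int (\<lambda>x. \<bar>f x\<bar>) p q \<le> l2_norm (\<lambda>x. \<bar>f x\<bar>) * l2_norm (indicator {p<..<q})"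
    unfolding seg_int_inner using Cauchy_Schwarz_L2[OF L2_abs[OF assms(1)] L2_indicator[of "{p<..<q}"]] by simp
  also have "l2_norm (\<lambda>x. \<bar>f x\<bar>) = l2_norm f"
    by (simp add: l2_norm_def l2_inner_MO)
  also have "l2_inner (indicator {p<..<q}) (indicator {p<..<q}) = seg_int (\<lambda>x. 1) p q"
    by (simp add: l2_inner_MO seg_int_def flip: indicator_inter_arith)
  then have "l2_norm (indicator {p<..<q}) = sqrt (q - p)"
    using assms by (simp add: l2_norm_def seg_int_const)
  finally show ?thesis .
qed

lemma seg_int_abs_bound:
  assumes "f \<in> L2" "0 \<le> p" "p \<le> q" "q \<le> 1"
  shows "\<bar>seg_int f p q\<bar> \<le> l2_norm f * sqrt (q - p)"
proof -
  have "seg_int f p q \<le> seg_int (\<lambda>x. \<bar>f x\<bar>) p q" "seg_int (\<lambda>x. (-1) * f x) p q \<le> seg_int (\<lambda>x. \<bar>f x\<bar>) p q"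
    using assms(1) by (intro seg_int_mono L2_integrable L2_abs L2_cmult; simp)+
  then show ?thesis using seg_int_abs_le[OF assms] unfolding seg_int_cmult by linarith
qed

lemma seg_int_continuous_on:
  assumes "f \<in> L2"
  shows "continuous_on {0..1} (seg_int f 0)"
  unfolding continuous_on_iff
proof (intro ballI allI impI)
  fix x e :: real assume x: "x \<in> {0..1}" and e: "0 < e"
  define M where "M = l2_norm f + 1"
  have M: "0 < M" using l2_norm_nonneg[of f] by (simp add: M_def)
  have bd: "\<bar>seg_int f 0 y - seg_int f 0 z\<bar> \<le> M * sqrt \<bar>y - z\<bar>" if "y \<in> {0..1}" "z \<in> {0..1}" for y z
  proof -
    have *: "\<bar>seg_int f 0 y - seg_int f 0 z\<bar> \<le> M * sqrt \<bar>y - z\<bar>" if "y \<in> {0..1}" "z \<in> {0..1}" "y \<le> z" for y z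
    proof -
      have "\<bar>seg_int f 0 y - seg_int f 0 z\<bar> = \<bar>seg_int f y z\<bar>"
        using seg_int_add_interval[OF L2_integrable[OF assms], of 0 y z] that by auto
      also have "\<dots> \<le> l2_norm f * sqrt (z - y)" using seg_int_abs_bound[OF assms, of y z] that by auto
      also have "\<dots> \<le> M * sqrt (z - y)" by (intro mult_right_mono) (use that in \<open>auto simp: M_def\<close>)
      also have "z - y = \<bar>y - z\<bar>" using that by simp
      finally show ?thesis .
    qed
    show ?thesis using *[of y z] *[of z y] that by (cases "y \<le> z") (auto simp: abs_minus_commute)
  qed
  show "\<exists>d>0. \<forall>y\<in>{0..1}. dist y x < d \<longrightarrow> dist (seg_int f 0 y) (seg_int f 0 x) < e"
  proof (intro exI[of _ "(e / M)\<^sup>2"] conjI ballI impI)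
    show "0 < (e / M)\<^sup>2" using e M by simp
    fix y :: real assume y: "y \<in> {0..1}" "dist y x < (e / M)\<^sup>2"
    have "sqrt \<bar>y - x\<bar> < e / M"
      using y(2) e M by (intro real_less_lsqrt) (auto simp: dist_real_def)
    then have "M * sqrt \<bar>y - x\<bar> < e" using M by (simp add: field_simps)
    then show "dist (seg_int f 0 y) (seg_int f 0 x) < e"
      using bd[OF y(1) x] by (simp add: dist_real_def)
  qed
qed

section \<open>Constancy sets and their components\<close>

lemma Omega_of_subset: "Omega_of X \<subseteq> Omega"
  by (auto simp: Omega_of_def)

lemma open_Omega_of: "open (Omega_of X)"
  unfolding open_subopen[of "Omega_of X"]
proof
  fix m assume "m \<in> Omega_of X"
  then obtain N where N: "open N" "m \<in> N" "N \<subseteq> Omega" "X constant_on N"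
    by (auto simp: Omega_of_def)
  then show "\<exists>T. open T \<and> m \<in> T \<and> T \<subseteq> Omega_of X"
    by (intro exI[of _ N]) (auto simp: Omega_of_def)
qed

lemma Omega_of_cong: "(\<And>m. m \<in> Omega \<Longrightarrow> X m = Y m) \<Longrightarrow> Omega_of X = Omega_of Y"
  unfolding Omega_of_def constant_on_def by (intro Collect_cong) (metis subsetD)

lemma constant_imp_Omega_of:
  assumes "0 \<le> a" "b \<le> 1" "\<And>x. a < x \<Longrightarrow> x < b \<Longrightarrow> X x = c"
  shows "{a<..<b} \<subseteq> Omega_of X"
  unfolding Omega_of_def
  by safe (use assms in \<open>auto simp: Omega_def constant_on_def intro!: exI[of _ "{a<..<b}"]\<close>)

lemma Omega_of_imp_constant:
  assumes "{a<..<b} \<subseteq> Omega_of X" "a < b"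
  obtains c where "\<And>x. a < x \<Longrightarrow> x < b \<Longrightarrow> X x = c"
proof -
  have loc: "\<forall>u\<in>{a<..<b}. \<forall>\<^sub>F v in at u within {a<..<b}. X u = X v"
    proof
      fix u assume "u \<in> {a<..<b}"
      then obtain N where "open N" "u \<in> N" "X constant_on N"
        using assms(1) by (auto simp: Omega_of_def)
      then show "\<forall>\<^sub>F v in at u within {a<..<b}. X u = X v"
        unfolding eventually_at_topological constant_on_def by metis
    qed
  have "X x = X ((a + b) / 2)" if "a < x" "x < b" for x
    by (rule connected_local_const[OF _ _ _ loc]) (use that assms(2) in auto)
  then show thesis by (rule that)
qed

lemma Omega_of_imp_constant_right:
  assumes "X \<in> K" "{a<..<b} \<subseteq> Omega_of X" "a < b"
  obtains c where "\<And>x. x \<in> Omega \<Longrightarrow> a \<le> x \<Longrightarrow> x < b \<Longrightarrow> X x = c"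
proof -
  obtain c where c: "\<And>x. a < x \<Longrightarrow> x < b \<Longrightarrow> X x = c"
    using Omega_of_imp_constant assms by metis
  have "X a = c" if "a \<in> Omega"
  proof (rule tendsto_unique[OF _ K_right[OF assms(1) that]])
    show "(X \<longlongrightarrow> c) (at_right a)"
      by (rule tendsto_at_right_cong[of a b _ "\<lambda>_. c"]) (use c assms in auto)
  qed simp
  then show thesis using c that[of c] by force
qed

text \<open>\<open>a\<close> and \<open>b\<close> are the nearest points outside \<open>S\<close> on
  either side of \<open>m\<close>; they exist because 0 and 1 lie outside
  \<open>S \<subseteq> Omega\<close>. This gives the cluster around \<open>m\<close> in a form that
  is directly usable in estimates.\<close>

lemma open_interval_around:
  fixes S :: "real set"
  assumes "open S" "S \<subseteq> Omega" "m \<in> S"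
  obtains a b where "a < m" "m < b" "{a<..<b} \<subseteq> S" "a \<notin> S" "b \<notin> S" "0 \<le> a" "b \<le> 1"
proof -
  define L where "L = {0..m} - S"
  define R where "R = {m..1} - S"
  have m: "0 < m" "m < 1" using assms by (auto simp: Omega_def)
  have "compact L" "compact R"
    using assms(1) by (auto simp: L_def R_def intro!: compact_diff)
  moreover have "0 \<in> L" "1 \<in> R" using assms(2) m by (auto simp: L_def R_def Omega_def)
  ultimately obtain a b where a: "a \<in> L" "\<And>x. x \<in> L \<Longrightarrow> x \<le> a" and b: "b \<in> R" "\<And>x. x \<in> R \<Longrightarrow> b \<le> x"
    using compact_attains_sup[of L] compact_attains_inf[of R] by (metis empty_iff)
  show thesis
  proof
    show "a < m" "m < b" using a b assms(3) by (auto simp: L_def R_def less_le)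
    show "a \<notin> S" "b \<notin> S" "0 \<le> a" "b \<le> 1" using a b by (auto simp: L_def R_def)
    show "{a<..<b} \<subseteq> S"
    proof
      fix x assume x: "x \<in> {a<..<b}"
      show "x \<in> S"
      proof (rule ccontr)
        assume "x \<notin> S"
        then show False
          using a(2)[of x] b(2)[of x] x \<open>0 \<le> a\<close> \<open>b \<le> 1\<close> by (cases "x \<le> m") (auto simp: L_def R_def)
      qed
    qed
  qed
qed

lemma components_interval_iff:
  fixes S :: "real set"
  assumes "open S" "a < b"
  shows "{a<..<b} \<in> components S \<longleftrightarrow> {a<..<b} \<subseteq> S \<and> a \<notin> S \<and> b \<notin> S"
proof
  assume *: "{a<..<b} \<subseteq> S \<and> a \<notin> S \<and> b \<notin> S"
  show "{a<..<b} \<in> components S"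
    unfolding in_components_maximal
  proof (intro conjI allI impI)
    fix D assume D: "D \<noteq> {} \<and> {a<..<b} \<subseteq> D \<and> D \<subseteq> S \<and> connected D"
    show "D = {a<..<b}"
    proof
      show "D \<subseteq> {a<..<b}"
      proof
        fix x assume x: "x \<in> D"
        have "(a + b) / 2 \<in> {a<..<b}" using assms by simp
        then have mid: "(a + b) / 2 \<in> D" using D by blast
        show "x \<in> {a<..<b}"
        proof (rule ccontr)
          assume "x \<notin> {a<..<b}"
          then consider "x \<le> a" | "b \<le> x" by force
          then show False
          proof cases
            case 1
            then have "a \<in> D" using D connectedD_interval[of D x "(a + b) / 2" a] x mid assms by simp
            with D * show False by blast
          next
            case 2
            then have "b \<in> D" using D connectedD_interval[of D "(a + b) / 2" x b] x mid assms by simp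
            with D * show False by blast
          qed
        qed
      qed
    qed (use D in blast)
  qed (use * assms in auto)
next
  assume c: "{a<..<b} \<in> components S"
  then have sub: "{a<..<b} \<subseteq> S" by (rule in_components_subset)
  have max: "D = {a<..<b}" if "D \<noteq> {}" "D \<subseteq> S" "connected D" "{a<..<b} \<subseteq> D" for D
    using c that unfolding in_components_maximal by blast
  have "a \<notin> S"
  proof
    assume "a \<in> S"
    with sub have "{a..<b} \<subseteq> S" by (auto simp: less_eq_real_def)
    then have "{a..<b} = {a<..<b}" by (intro max) (use assms(2) in auto)
    moreover have "a \<in> {a..<b}" using assms(2) by simp
    ultimately have "a \<in> {a<..<b}" by simp
    then show False by simp
  qed
  moreover have "b \<notin> S"
  proof
    assume "b \<in> S"
    with sub have "{a<..b} \<subseteq> S" by (auto simp: less_eq_real_def)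
    then have "{a<..b} = {a<..<b}" by (intro max) (use assms(2) in auto)
    moreover have "b \<in> {a<..b}" using assms(2) by simp
    ultimately have "b \<in> {a<..<b}" by simp
    then show False by simp
  qed
  ultimately show "{a<..<b} \<subseteq> S \<and> a \<notin> S \<and> b \<notin> S" using sub by blast
qed

section \<open>The normal cone and the projection\<close>

lemma subdiff_cone:
  assumes X: "X \<in> K" and W: "W \<in> subdiff_I_K X" and E: "(\<lambda>m. X m + E m) \<in> K"
  shows "l2_inner W E \<le> 0"
proof -
  have "l2_inner W (\<lambda>m. (X m + E m) - X m) \<le> 0"
    using W E by (auto simp: subdiff_I_K_def)
  then show ?thesis by simp
qed

lemma subdiff_K_le: "X \<in> K \<Longrightarrow> W \<in> subdiff_I_K X \<Longrightarrow> E \<in> K \<Longrightarrow> l2_inner W E \<le> 0"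
  by (rule subdiff_cone) (auto intro: K_add)

lemma subdiff_L2: "W \<in> subdiff_I_K X \<Longrightarrow> W \<in> L2"
  by (simp add: subdiff_I_K_def)

lemma l2_inner_const: "l2_inner W (\<lambda>_. c) = c * seg_int W 0 1"
  by (simp add: l2_inner_MO seg_int_all[symmetric])

lemma l2_inner_indicator_atLeast:
  assumes "W \<in> L2" "m \<le> 1"
  shows "l2_inner W (indicator {m..}) = seg_int W m 1"
  unfolding seg_int_inner l2_inner_MO
proof (rule integral_cong_AE)
  show "AE x in MO. W x * indicator {m..} x = W x * indicator {m<..<1} x"
    unfolding AE_MO using AE_lborel_singleton[of m]
    by eventually_elim (auto simp: indicator_def Omega_def)
qed (intro borel_measurable_times L2_measurable[OF assms(1)] L2_measurable[OF L2_indicator]; simp)+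

lemma subdiff_total:
  assumes "X \<in> K" "W \<in> subdiff_I_K X"
  shows "seg_int W 0 1 = 0"
  using subdiff_K_le[OF assms K_const[of 1]] subdiff_K_le[OF assms K_const[of "-1"]]
  unfolding l2_inner_const by simp

text \<open>The step function \<open>indicator {m..}\<close> lies in \<open>K\<close>, so
  \<open>W\<close> has nonpositive integral to the right of \<open>m\<close>; its total integral is
  0.\<close>

lemma subdiff_primitive_nonneg:
  assumes "X \<in> K" "W \<in> subdiff_I_K X" "0 \<le> m" "m \<le> 1"
  shows "0 \<le> seg_int W 0 m"
proof -
  have "seg_int W m 1 \<le> 0"
    using subdiff_K_le[OF assms(1,2) K_indicator[of m]]
    by (simp add: l2_inner_indicator_atLeast[OF subdiff_L2[OF assms(2)] assms(4)])
  then show ?thesis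
    using subdiff_total[OF assms(1,2)]
      seg_int_add_interval[OF L2_integrable[OF subdiff_L2[OF assms(2)]] assms(3,4)] by simp
qed

text \<open>Testing with the truncations of \<open>X\<close> between \<open>X p\<close> and \<open>X q\<close>, which after
  normalisation approximate the indicator of \<open>(m, 1)\<close>.\<close>

lemma subdiff_primitive_zero:
  assumes X: "X \<in> K" and W: "W \<in> subdiff_I_K X" and m: "m \<in> Omega" "m \<notin> Omega_of X"
  shows "seg_int W 0 m = 0"
proof -
  note WL = subdiff_L2[OF W]
  have m01: "0 < m" "m < 1" using m by (auto simp: Omega_def)
  have bound: "\<bar>seg_int W m 1\<bar> \<le> l2_norm W * sqrt (2 * \<delta>)" if \<delta>: "0 < \<delta>" "\<delta> < m" "\<delta> < 1 - m" for \<delta>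
  proof -
    have sub: "{m-\<delta><..<m+\<delta>} \<subseteq> Omega" using \<delta> by (auto simp: Omega_def)
    have "\<exists>x\<in>{m-\<delta><..<m+\<delta>}. \<exists>y\<in>{m-\<delta><..<m+\<delta>}. X x < X y"
    proof (rule ccontr)
      assume "\<not> ?thesis"
      then have ord: "\<not> X x < X y" if "x \<in> {m-\<delta><..<m+\<delta>}" "y \<in> {m-\<delta><..<m+\<delta>}" for x y
        using that by blast
      have const: "X x = X m" if "m - \<delta> < x" "x < m + \<delta>" for x
        using ord[of x m] ord[of m x] that \<delta>(1) by (simp add: not_less)
      have "{m-\<delta><..<m+\<delta>} \<subseteq> Omega_of X"
        by (rule constant_imp_Omega_of[OF _ _ const]) (use \<delta> in auto)
      moreover have "m \<in> {m-\<delta><..<m+\<delta>}" using \<delta>(1) by simp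
      ultimately have "m \<in> Omega_of X" by blast
      with m(2) show False by simp
    qed
    then obtain x y where xy: "x \<in> {m-\<delta><..<m+\<delta>}" "y \<in> {m-\<delta><..<m+\<delta>}" "X x < X y" by blast
    have xyO: "x \<in> Omega" "y \<in> Omega" using xy sub by blast+
    \<comment> \<open>Widening to include \<open>m\<close> keeps \<open>X p < X q\<close> and places
      the rise of the truncation within distance \<open>\<delta>\<close> of \<open>m\<close> on each
      side.\<close>
    define p where "p = min x m"
    define q where "q = max y m"
    have pq: "p \<le> m" "m \<le> q" "m - \<delta> < p" "q < m + \<delta>" "p \<in> Omega" "q \<in> Omega"
      using xy m sub \<delta>(1) by (auto simp: p_def q_def min_def max_def)
    have "X p \<le> X x" "X y \<le> X q"
      using K_mono[OF X] xyO m by (auto simp: p_def q_def min_def max_def)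
    define l u where "l = X p" and "u = X q"
    have lu: "l < u" using \<open>X p \<le> X x\<close> \<open>X y \<le> X q\<close> xy(3) by (simp add: l_def u_def)
    define c where "c x = max l (min u (X x))" for x
    have cK: "c \<in> K" "(\<lambda>x. X x + (-1) * c x) \<in> K"
      using K_clamp[OF X less_imp_le[OF lu]] by (simp_all add: c_def[abs_def])
    have cL: "c \<in> L2" by (rule K_L2[OF cK(1)])
    \<comment> \<open>Adding or subtracting \<open>c\<close> keeps \<open>X\<close> in the cone, so
      the pairing with \<open>c\<close> is both nonpositive and nonnegative.\<close>
    have c0: "l2_inner W c = 0"
      using subdiff_K_le[OF X W cK(1)] subdiff_cone[OF X W cK(2)] unfolding l2_inner_cmult_right by simp
    define g where "g x = (c x - l) / (u - l)" for x
    have gL: "g \<in> L2" unfolding g_def by (intro L2_divide L2_diff cL L2_const)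
    have g0: "l2_inner W g = 0"
    proof -
      have "l2_inner W g = l2_inner W (\<lambda>x. inverse (u - l) * (c x - l))"
        unfolding g_def[abs_def] by (simp add: divide_inverse_commute)
      also have "\<dots> = inverse (u - l) * (l2_inner W c - l2_inner W (\<lambda>_. l))"
        unfolding l2_inner_cmult_right by (subst l2_inner_diff_right) (auto simp: cL WL)
      also have "\<dots> = 0" using c0 subdiff_total[OF X W] by (simp add: l2_inner_const)
      finally show ?thesis .
    qed
    have g01: "0 \<le> g x" "g x \<le> 1" for x using lu by (auto simp: g_def c_def divide_simps)
    have gp: "g x = 0" if "x \<in> Omega" "x \<le> p" for x
    proof -
      have "X x \<le> l" unfolding l_def using K_mono[OF X] that pq by blast
      then show ?thesis using lu by (simp add: g_def c_def)
    qed
    have gq: "g x = 1" if "x \<in> Omega" "q \<le> x" for x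
    proof -
      have "u \<le> X x" unfolding u_def using K_mono[OF X] that pq by blast
      then show ?thesis using lu by (simp add: g_def c_def)
    qed
    \<comment> \<open>Apart from the null set \<open>{m}\<close> this error is supported in
      \<open>(p, q)\<close> and bounded by 1, so it costs at most the integral of
      \<open>\<bar>W x\<bar>\<close> over an interval of length at most
      \<open>2 * \<delta>\<close>.\<close>
    define h where "h x = indicator {m<..<1} x - g x" for x
    have hL: "h \<in> L2" unfolding h_def[abs_def] by (intro L2_diff gL L2_indicator) simp
    have "seg_int W m 1 = l2_inner W h"
      unfolding h_def[abs_def] seg_int_inner
      by (subst l2_inner_diff_right) (auto simp: g0 gL WL intro: L2_indicator)
    also have "\<bar>l2_inner W h\<bar> \<le> seg_int (\<lambda>x. \<bar>W x\<bar>) p q"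
      unfolding l2_inner_MO seg_int_def
    proof (rule order_trans[OF integral_abs_bound integral_mono_AE])
      show "integrable MO (\<lambda>x. \<bar>W x * h x\<bar>)" using L2_mult_integrable[OF WL hL] by simp
      show "integrable MO (\<lambda>x. indicator {p<..<q} x * \<bar>W x\<bar>)"
        by (intro integrable_indicator_MO L2_integrable L2_abs WL)
      show "AE x in MO. \<bar>W x * h x\<bar> \<le> indicator {p<..<q} x * \<bar>W x\<bar>"
        unfolding AE_MO using AE_lborel_singleton[of m]
      proof (eventually_elim, intro impI)
        fix x assume x: "x \<noteq> m" "x \<in> Omega"
        consider "x \<le> p" | "q \<le> x" | "p < x" "x < q" by linarith
        then show "\<bar>W x * h x\<bar> \<le> indicator {p<..<q} x * \<bar>W x\<bar>"
        proof cases
          case 1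
          then have "h x = 0" using gp[of x] x pq by (simp add: h_def)
          then show ?thesis by simp
        next
          case 2
          then have "h x = 0" using gq[of x] x pq by (simp add: h_def Omega_def)
          then show ?thesis by simp
        next
          case 3
          have "\<bar>h x\<bar> \<le> 1" using g01[of x] by (simp add: h_def indicator_def)
          then show ?thesis using 3 mult_left_mono[of "\<bar>h x\<bar>" 1 "\<bar>W x\<bar>"] by (simp add: abs_mult)
        qed
      qed
    qed
    also have "\<dots> \<le> l2_norm W * sqrt (q - p)"
      by (rule seg_int_abs_le[OF WL]) (use pq in \<open>auto simp: Omega_def\<close>)
    also have "\<dots> \<le> l2_norm W * sqrt (2 * \<delta>)"
      using pq by (intro mult_left_mono real_sqrt_le_mono) (auto simp: l2_norm_nonneg)
    finally show ?thesis .
  qed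
  have "((\<lambda>\<delta>. l2_norm W * sqrt (2 * \<delta>)) \<longlongrightarrow> l2_norm W * sqrt (2 * 0)) (at_right 0)"
    by (intro tendsto_intros)
  moreover have "\<forall>\<^sub>F \<delta> in at_right 0. \<bar>seg_int W m 1\<bar> \<le> l2_norm W * sqrt (2 * \<delta>)"
    unfolding eventually_at_right_field using bound m01
    by (intro exI[of _ "min m (1 - m)"]) auto
  ultimately have "\<bar>seg_int W m 1\<bar> \<le> l2_norm W * sqrt (2 * 0)"
    by (intro tendsto_lowerbound[of _ _ "at_right 0"]) auto
  then show ?thesis
    using subdiff_total[OF X W] seg_int_add_interval[OF L2_integrable[OF WL], of 0 m 1] m01 by simp
qed

section \<open>Existence of the projection and its variational inequality\<close>

lemma AE_MO_dense:
  assumes "AE x in MO. x \<in> G" "0 \<le> a" "a < b" "b \<le> 1"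
  obtains x where "x \<in> G" "a < x" "x < b"
proof -
  have "\<exists>x. x \<in> G \<and> a < x \<and> x < b"
  proof (rule ccontr)
    assume "\<not> ?thesis"
    then have "AE x in lborel. x \<notin> {a<..<b}"
      using assms unfolding AE_MO by (auto elim!: eventually_mono simp: Omega_def)
    then have "{a<..<b} \<in> null_sets lborel"
      by (subst AE_iff_null_sets) auto
    with assms show False by (simp add: null_sets_def)
  qed
  with that show thesis by blast
qed

text \<open>The limit is defined and nondecreasing only on the set \<open>G\<close> of convergence,
  which has full measure. The infimum of the limit values strictly to the right extends it to a
  right-continuous monotone function. The two agree at points of \<open>G\<close> where the
  extension is continuous, and it has only countably many discontinuities.\<close>

lemma mono_AE_limit_in_K_representative:
  assumes Y: "\<And>n. Y n \<in> K" and conv: "AE x in MO. convergent (\<lambda>n. Y n x)"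
  obtains y where "mono_on Omega y" "\<And>x. x \<in> Omega \<Longrightarrow> (y \<longlongrightarrow> y x) (at_right x)"
    "AE x in MO. (\<lambda>n. Y n x) \<longlonglongrightarrow> y x"
proof -
  define G where "G = {x\<in>Omega. convergent (\<lambda>n. Y n x)}"
  define l where "l x = lim (\<lambda>n. Y n x)" for x
  have AEG: "AE x in MO. x \<in> G"
    using conv unfolding AE_MO G_def by eventually_elim simp
  have lim: "(\<lambda>n. Y n x) \<longlonglongrightarrow> l x" if "x \<in> G" for x
    using that by (simp add: G_def l_def convergent_LIMSEQ_iff)
  have lmono: "l x \<le> l z" if "x \<in> G" "z \<in> G" "x \<le> z" for x z
    by (rule LIMSEQ_le[OF lim[OF that(1)] lim[OF that(2)]])
      (use that K_mono[OF Y] in \<open>auto simp: G_def\<close>)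
  define y where "y x = Inf (l ` {g\<in>G. x < g})" for x
  have ne: "\<exists>g\<in>G. x < g \<and> g < z" if "x \<in> Omega" "x < z" for x z
  proof -
    have "0 \<le> x" "x < min z 1" "min z 1 \<le> 1" using that by (auto simp: Omega_def)
    from AE_MO_dense[OF AEG this] show ?thesis by (metis min_less_iff_conj)
  qed
  have ne': "\<exists>g\<in>G. g < x" if "x \<in> Omega" for x
    using AE_MO_dense[OF AEG, of 0 x] that by (auto simp: Omega_def)
  have bdd: "bdd_below (l ` {g\<in>G. x < g})" if "x \<in> Omega" for x
  proof -
    obtain g where "g \<in> G" "g < x" using ne'[OF \<open>x \<in> Omega\<close>] by blast
    then show ?thesis by (intro bdd_belowI2[of _ "l g"]) (auto intro: lmono)
  qed
  have nonempty: "{g\<in>G. x < g} \<noteq> {}" if "x \<in> Omega" for x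
    using ne[of x 2] that by (auto simp: Omega_def)
  have y_le: "y x \<le> l g" if "x \<in> Omega" "g \<in> G" "x < g" for x g
    unfolding y_def by (rule cInf_lower) (use that bdd in auto)
  have y_ge: "l g \<le> y x" if "x \<in> Omega" "g \<in> G" "g \<le> x" for x g
    unfolding y_def by (rule cInf_greatest) (use that nonempty lmono in auto)
  have ymono: "y x \<le> y z" if "x \<in> Omega" "z \<in> Omega" "x \<le> z" for x z
    unfolding y_def by (rule cInf_superset_mono) (use that nonempty bdd in auto)
  show thesis
  proof
    show "mono_on Omega y" by (auto intro!: mono_onI ymono)
    show "(y \<longlongrightarrow> y x) (at_right x)" if x: "x \<in> Omega" for x
    proof (rule order_tendstoI)
      fix a assume "a < y x"
      have "\<forall>\<^sub>F z in at_right x. z < 1" using x by (auto simp: eventually_at_right_field Omega_def)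
      moreover have "\<forall>\<^sub>F z in at_right x. x < z" by (simp add: eventually_at_right_less)
      ultimately show "\<forall>\<^sub>F z in at_right x. a < y z"
      proof eventually_elim
        case (elim z)
        then have "y x \<le> y z" using x by (intro ymono) (auto simp: Omega_def)
        with \<open>a < y x\<close> show ?case by simp
      qed
    next
      fix a assume "y x < a"
      then obtain g where g: "g \<in> G" "x < g" "l g < a"
        unfolding y_def using nonempty[OF x] bdd[OF x] by (auto simp: cInf_less_iff)
      have "\<forall>\<^sub>F z in at_right x. z < g" using g by (auto simp: eventually_at_right_field)
      moreover have "\<forall>\<^sub>F z in at_right x. x < z" by (simp add: eventually_at_right_less)
      ultimately show "\<forall>\<^sub>F z in at_right x. y z < a"
      proof eventually_elim
        case (elim z)
        then have "z \<in> Omega" using x g by (auto simp: Omega_def G_def)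
        then show ?case using y_le[of z g] elim g by simp
      qed
    qed
    have "countable {x\<in>Omega. \<not> isCont y x}"
      by (rule mono_on_ctble_discont_open) (auto simp: Omega_def intro!: mono_onI ymono[unfolded Omega_def])
    then have "AE x in lborel. x \<notin> {x\<in>Omega. \<not> isCont y x}"
      by (intro AE_not_in countable_imp_null_set_lborel)
    then show "AE x in MO. (\<lambda>n. Y n x) \<longlonglongrightarrow> y x"
      using AEG unfolding AE_MO
    proof eventually_elim
      case (elim x)
      show ?case
      proof
        assume x: "x \<in> Omega"
        with elim have G: "x \<in> G" and c: "isCont y x" by auto
        have "y x \<le> l x"
        proof (rule tendsto_upperbound)
          show "(y \<longlongrightarrow> y x) (at_left x)"
            using c by (simp add: isCont_def filterlim_at_split)
          show "\<forall>\<^sub>F z in at_left x. y z \<le> l x"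
            unfolding eventually_at_left_field
            using x G y_le by (intro exI[of _ 0]) (auto simp: Omega_def)
        qed simp
        with y_ge[OF x G] have "y x = l x" by simp
        then show "(\<lambda>n. Y n x) \<longlonglongrightarrow> y x" using lim[OF G] by simp
      qed
    qed
  qed
qed

lemma l2_parallelogram:
  assumes "U \<in> L2" "f \<in> L2" "g \<in> L2"
  shows "(l2_norm (\<lambda>x. f x - g x))\<^sup>2 =
    2 * (l2_norm (\<lambda>x. U x - f x))\<^sup>2 + 2 * (l2_norm (\<lambda>x. U x - g x))\<^sup>2
    - 4 * (l2_norm (\<lambda>x. U x - (1/2 * f x + 1/2 * g x)))\<^sup>2"
proof -
  define a b where "a x = U x - f x" and "b x = U x - g x" for x
  have ab: "a \<in> L2" "b \<in> L2" using assms by (auto simp: a_def[abs_def] b_def[abs_def])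
  have "(\<lambda>x. f x - g x) = (\<lambda>x. b x - a x)" by (auto simp: a_def b_def)
  moreover have "(\<lambda>x. U x - (1/2 * f x + 1/2 * g x)) = (\<lambda>x. 1/2 * (a x + b x))"
    by (auto simp: a_def b_def field_simps)
  moreover have "(l2_norm (\<lambda>x. b x - a x))\<^sup>2 = l2_inner a a + l2_inner b b - 2 * l2_inner a b"
    using ab L2_diff[OF ab(2,1)]
    by (simp add: l2_norm_square l2_inner_diff_left l2_inner_diff_right l2_inner_commute[of b a])
  moreover have "4 * (l2_norm (\<lambda>x. 1/2 * (a x + b x)))\<^sup>2 = l2_inner a a + l2_inner b b + 2 * l2_inner a b"
    using ab L2_add[OF ab]
    unfolding l2_norm_square l2_inner_cmult_left l2_inner_cmult_right
    by (simp add: l2_inner_add_left l2_inner_add_right l2_inner_commute[of b a])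
  ultimately show ?thesis
    unfolding a_def[abs_def, symmetric] b_def[abs_def, symmetric] by (simp add: l2_norm_square)
qed

text \<open>Convexity and the parallelogram identity make a minimising sequence Cauchy. Completeness
  is used pointwise: a subsequence converges almost everywhere to a monotone function, and Fatou's
  lemma bounds its distance to \<open>U\<close>, which also shows that it lies in
  \<open>L2\<close>.\<close>

lemma K_best_approximation:
  assumes U: "U \<in> L2"
  obtains P where "P \<in> K" "\<And>Y. Y \<in> K \<Longrightarrow> l2_norm (\<lambda>m. U m - P m) \<le> l2_norm (\<lambda>m. U m - Y m)"
proof -
  define D where "D Y = (l2_norm (\<lambda>m. U m - Y m))\<^sup>2" for Y
  define d where "d = Inf (D ` K)"
  have D0: "0 \<le> D Y" for Y by (simp add: D_def)
  have bdd: "bdd_below (D ` K)" by (intro bdd_belowI2[of _ 0] D0)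
  have ne: "D ` K \<noteq> {}" using K_const[of 0] by blast
  have dle: "d \<le> D Y" if "Y \<in> K" for Y
    unfolding d_def by (rule cInf_lower) (use that bdd in auto)
  have "\<exists>Y\<in>K. D Y < d + 1 / real (Suc n)" for n
    using cInf_less_iff[OF ne bdd, of "d + 1 / real (Suc n)"] by (auto simp: d_def)
  then obtain Y where Y: "\<And>n. Y n \<in> K" "\<And>n. D (Y n) < d + 1 / real (Suc n)" by metis
  have YL: "Y n \<in> L2" for n using Y K_L2 by blast
  have cauchy: "(l2_norm (\<lambda>x. Y i x - Y j x))\<^sup>2 \<le> 2 / real (Suc i) + 2 / real (Suc j)" for i j
  proof -
    have "(\<lambda>x. 1/2 * Y i x + 1/2 * Y j x) \<in> K" by (intro K_add K_cmult Y) auto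
    from dle[OF this] show ?thesis
      using l2_parallelogram[OF U YL[of i] YL[of j]] Y(2)[of i] Y(2)[of j]
      unfolding D_def by simp
  qed
  have L1: "(LINT x|MO. norm (Y i x - Y j x)) \<le> l2_norm (\<lambda>x. Y i x - Y j x)" for i j
  proof -
    have "seg_int (\<lambda>x. \<bar>Y i x - Y j x\<bar>) 0 1 \<le> l2_norm (\<lambda>x. Y i x - Y j x) * sqrt (1 - 0)"
      by (rule seg_int_abs_le) (auto intro: YL)
    then show ?thesis by (simp add: seg_int_all[symmetric])
  qed
  have "\<exists>N. \<forall>i\<ge>N. \<forall>j\<ge>N. (LINT x|MO. norm (Y i x - Y j x)) < e" if e: "0 < e" for e
  proof -
    obtain N where N: "1 / real (Suc N) < e\<^sup>2 / 4"
      using e nat_approx_posE[of "e\<^sup>2 / 4"] by auto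
    have "(LINT x|MO. norm (Y i x - Y j x)) < e" if "i \<ge> N" "j \<ge> N" for i j
    proof -
      have "1 / real (Suc i) \<le> 1 / real (Suc N)" "1 / real (Suc j) \<le> 1 / real (Suc N)"
        using that by (auto intro!: divide_left_mono)
      then have "(l2_norm (\<lambda>x. Y i x - Y j x))\<^sup>2 < e\<^sup>2" using cauchy[of i j] N by simp
      then have "l2_norm (\<lambda>x. Y i x - Y j x) < e" using e by (simp add: power2_less_imp_less)
      with L1[of i j] show ?thesis by simp
    qed
    then show ?thesis by blast
  qed
  then obtain r where r: "strict_mono r" "AE x in MO. Cauchy (\<lambda>i. Y (r i) x)"
    using cauchy_L1_AE_cauchy_subseq[of MO Y] L2_integrable[OF YL] by blast
  have "AE x in MO. convergent (\<lambda>i. Y (r i) x)"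
    using r(2) by eventually_elim (simp add: Cauchy_convergent_iff)
  then obtain y where y: "mono_on Omega y" "\<And>x. x \<in> Omega \<Longrightarrow> (y \<longlongrightarrow> y x) (at_right x)"
      "AE x in MO. (\<lambda>n. Y (r n) x) \<longlonglongrightarrow> y x"
    using mono_AE_limit_in_K_representative[of "\<lambda>i. Y (r i)"] Y(1) by blast
  have ym: "y \<in> borel_measurable MO" by (rule mono_on_measurable_MO[OF y(1)])
  have Um: "U \<in> borel_measurable MO" using U by (rule L2_measurable)
  have DY: "(\<integral>\<^sup>+x. ennreal ((U x - Y n x)\<^sup>2) \<partial>MO) = ennreal (D (Y n))" for n
    unfolding D_def l2_norm_square l2_inner_MO power2_eq_square[symmetric]
    using L2_diff[OF U YL[of n]] by (intro nn_integral_eq_integral) (auto simp: L2_iff)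
  have "(\<integral>\<^sup>+x. ennreal ((U x - y x)\<^sup>2) \<partial>MO) = (\<integral>\<^sup>+x. liminf (\<lambda>n. ennreal ((U x - Y (r n) x)\<^sup>2)) \<partial>MO)"
  proof (rule nn_integral_cong_AE)
    show "AE x in MO. ennreal ((U x - y x)\<^sup>2) = liminf (\<lambda>n. ennreal ((U x - Y (r n) x)\<^sup>2))"
      using y(3)
    proof eventually_elim
      case (elim x)
      then have "(\<lambda>n. ennreal ((U x - Y (r n) x)\<^sup>2)) \<longlonglongrightarrow> ennreal ((U x - y x)\<^sup>2)"
        by (intro tendsto_intros)
      from lim_imp_Liminf[OF sequentially_bot this] show ?case by (rule sym)
    qed
  qed
  also have "\<dots> \<le> liminf (\<lambda>n. \<integral>\<^sup>+x. ennreal ((U x - Y (r n) x)\<^sup>2) \<partial>MO)"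
    by (rule nn_integral_liminf) (use Um L2_measurable[OF YL] in measurable)
  also have "\<dots> \<le> ennreal d"
  proof -
    have "(\<lambda>n. D (Y (r n))) \<longlonglongrightarrow> d"
    proof (rule tendsto_sandwich)
      show "\<forall>\<^sub>F n in sequentially. d \<le> D (Y (r n))" using dle Y(1) by simp
      have "D (Y (r n)) \<le> d + 1 / real (Suc n)" for n
      proof -
        have "1 / real (Suc (r n)) \<le> 1 / real (Suc n)"
          using seq_suble[OF r(1), of n] by (intro divide_left_mono) auto
        then show ?thesis using Y(2)[of "r n"] by linarith
      qed
      then show "\<forall>\<^sub>F n in sequentially. D (Y (r n)) \<le> d + 1 / real (Suc n)" by simp
      have "(\<lambda>n. 1 / real (Suc n)) \<longlonglongrightarrow> 0" by (rule LIMSEQ_Suc[OF lim_1_over_n])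
      from tendsto_add[OF tendsto_const[of d] this] show "(\<lambda>n. d + 1 / real (Suc n)) \<longlonglongrightarrow> d" by simp
    qed simp
    then have "(\<lambda>n. ennreal (D (Y (r n)))) \<longlonglongrightarrow> ennreal d" by (intro tendsto_intros)
    from lim_imp_Liminf[OF sequentially_bot this] show ?thesis unfolding DY by simp
  qed
  finally have fin: "(\<integral>\<^sup>+x. ennreal ((U x - y x)\<^sup>2) \<partial>MO) \<le> ennreal d" .
  have int: "integrable MO (\<lambda>x. (U x - y x)\<^sup>2)"
    by (rule integrableI_bounded) (use fin Um ym in \<open>auto intro: order_le_less_trans\<close>)
  then have "(\<lambda>x. U x - y x) \<in> L2" using Um ym by (auto simp: L2_iff)
  from L2_diff[OF U this] have "y \<in> L2" by simp
  then have yK: "y \<in> K" using y by (auto intro!: K_I simp: mono_on_def)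
  have "ennreal (D y) \<le> ennreal d"
    using fin int by (simp add: D_def l2_norm_square l2_inner_MO nn_integral_eq_integral flip: power2_eq_square)
  moreover have "0 \<le> d" unfolding d_def by (rule cInf_greatest[OF ne]) (auto simp: D0)
  ultimately have "D y \<le> d" by simp
  show thesis
  proof
    show "y \<in> K" by (rule yK)
    fix Z assume "Z \<in> K"
    with \<open>D y \<le> d\<close> dle[of Z] have "D y \<le> D Z" by simp
    then show "l2_norm (\<lambda>m. U m - y m) \<le> l2_norm (\<lambda>m. U m - Z m)"
      unfolding D_def by (rule power2_le_imp_le) (rule l2_norm_nonneg)
  qed
qed

text \<open>\<open>proj_K\<close> is a choice made by \<open>arg_min_on\<close>, so nothing is known
  of it until a minimiser exists. The variational inequality is the first variation along the
  segments \<open>(1 - e) * P + e * Y\<close>.\<close>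

lemma proj_K_variational:
  assumes U: "U \<in> L2"
  shows "proj_K U \<in> K" "(\<lambda>m. U m - proj_K U m) \<in> subdiff_I_K (proj_K U)"
proof -
  define N where "N Y = l2_norm (\<lambda>m. U m - Y m)" for Y
  define P where "P = proj_K U"
  obtain P' where "P' \<in> K" "\<And>Y. Y \<in> K \<Longrightarrow> N P' \<le> N Y"
    using K_best_approximation[OF U] unfolding N_def by blast
  then have "is_arg_min N (\<lambda>x. x \<in> K) P'" by (auto simp: is_arg_min_def not_less)
  then have "is_arg_min N (\<lambda>x. x \<in> K) P"
    unfolding P_def proj_K_def arg_min_on_def arg_min_def N_def
    by (rule someI[of "is_arg_min (\<lambda>Y. l2_norm (\<lambda>m. U m - Y m)) (\<lambda>x. x \<in> K)"])
  then have PK: "P \<in> K" and min: "\<And>Y. Y \<in> K \<Longrightarrow> N P \<le> N Y"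
    by (auto simp: is_arg_min_def not_less)
  show "proj_K U \<in> K" using PK by (simp add: P_def)
  have PL: "P \<in> L2" using PK by (rule K_L2)
  define w where "w m = U m - P m" for m
  have wL: "w \<in> L2" unfolding w_def[abs_def] by (intro L2_diff U PL)
  have "l2_inner w (\<lambda>m. Y m - P m) \<le> 0" if Y: "Y \<in> K" for Y
  proof -
    define v where "v m = Y m - P m" for m
    have vL: "v \<in> L2" unfolding v_def[abs_def] by (intro L2_diff K_L2 Y PL)
    have ineq: "2 * l2_inner w v \<le> e * l2_inner v v" if e: "0 < e" "e \<le> 1" for e
    proof -
      have "(\<lambda>m. (1 - e) * P m + e * Y m) \<in> K" using e by (intro K_add K_cmult PK Y) auto
      from min[OF this] have "(N P)\<^sup>2 \<le> (N (\<lambda>m. (1 - e) * P m + e * Y m))\<^sup>2"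
        by (simp add: N_def l2_norm_nonneg power_mono)
      also have "N (\<lambda>m. (1 - e) * P m + e * Y m) = l2_norm (\<lambda>m. w m - e * v m)"
        unfolding N_def by (rule arg_cong[of _ _ l2_norm]) (auto simp: w_def v_def algebra_simps)
      also have "(l2_norm (\<lambda>m. w m - e * v m))\<^sup>2 = l2_inner w w - 2 * e * l2_inner w v + e * e * l2_inner v v"
        using wL vL L2_cmult[OF vL, of e] L2_diff[OF wL L2_cmult[OF vL, of e]]
        by (simp add: l2_norm_square l2_inner_diff_left l2_inner_diff_right l2_inner_cmult_left
            l2_inner_cmult_right l2_inner_commute[of v w] algebra_simps)
      also have "(N P)\<^sup>2 = l2_inner w w" by (simp add: N_def l2_norm_square w_def[abs_def])
      finally have "e * (2 * l2_inner w v) \<le> e * (e * l2_inner v v)" by (simp add: algebra_simps)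
      then show ?thesis using e by simp
    qed
    have "((\<lambda>e. e * l2_inner v v) \<longlongrightarrow> 0 * l2_inner v v) (at_right 0)" by (intro tendsto_intros)
    moreover have "\<forall>\<^sub>F e in at_right 0. 2 * l2_inner w v \<le> e * l2_inner v v"
      unfolding eventually_at_right_field using ineq by (intro exI[of _ 1]) auto
    ultimately have "2 * l2_inner w v \<le> 0 * l2_inner v v"
      by (intro tendsto_lowerbound[of _ _ "at_right 0"]) auto
    then show ?thesis by (simp add: v_def[abs_def])
  qed
  then show "(\<lambda>m. U m - proj_K U m) \<in> subdiff_I_K (proj_K U)"
    using wL by (simp add: subdiff_I_K_def P_def w_def[abs_def])
qed

section \<open>The convex envelope as the primitive of the projection\<close>

lemma seg_int_const_on:
  assumes "0 \<le> p" "p \<le> q" "q \<le> 1" "\<And>x. p < x \<Longrightarrow> x < q \<Longrightarrow> f x = c"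
  shows "seg_int f p q = c * (q - p)"
  using seg_int_cong[of p q f "\<lambda>_. c"] seg_int_const[of p q c] assms by simp

lemma seg_int_lower:
  assumes "f \<in> L2" "0 \<le> p" "p \<le> q" "q \<le> 1" "\<And>x. p < x \<Longrightarrow> x < q \<Longrightarrow> c \<le> f x"
  shows "c * (q - p) \<le> seg_int f p q"
  unfolding seg_int_const[OF assms(2-4), symmetric]
  by (rule seg_int_mono) (use assms in \<open>auto intro: L2_integrable\<close>)

lemma seg_int_upper:
  assumes "f \<in> L2" "0 \<le> p" "p \<le> q" "q \<le> 1" "\<And>x. p < x \<Longrightarrow> x < q \<Longrightarrow> f x \<le> c"
  shows "seg_int f p q \<le> c * (q - p)"
  unfolding seg_int_const[OF assms(2-4), symmetric]
  by (rule seg_int_mono) (use assms in \<open>auto intro: L2_integrable\<close>)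

lemma seg_int_convex:
  assumes P: "P \<in> K" and x: "0 \<le> x" "x < z" "z < y" "y \<le> 1"
  shows "seg_int P x z * (y - z) \<le> seg_int P z y * (z - x)"
proof -
  have z: "z \<in> Omega" using x by (auto simp: Omega_def)
  have "seg_int P x z \<le> P z * (z - x)" "P z * (y - z) \<le> seg_int P z y"
    using x z K_mono[OF P] by (auto intro!: seg_int_upper seg_int_lower K_L2[OF P] simp: Omega_def)
  then have "seg_int P x z * (y - z) \<le> (P z * (z - x)) * (y - z)"
    "(P z * (y - z)) * (z - x) \<le> seg_int P z y * (z - x)"
    using x by (auto intro!: mult_right_mono)
  then show ?thesis by (simp add: mult_ac)
qed

lemma seg_int_convex_on:
  assumes P: "P \<in> K"
  shows "convex_on {0..1} (seg_int P 0)"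
proof (rule convex_on_linorderI)
  fix t x y :: real assume *: "0 < t" "t < 1" "x \<in> {0..1}" "y \<in> {0..1}" "x < y"
  define z where "z = (1 - t) *\<^sub>R x + t *\<^sub>R y"
  have zx: "z - x = t * (y - x)" and yz: "y - z = (1 - t) * (y - x)"
    by (simp_all add: z_def algebra_simps)
  have pos: "0 < t * (y - x)" "0 < (1 - t) * (y - x)" using * by auto
  have xz: "x < z" "z < y" using pos unfolding zx[symmetric] yz[symmetric] by simp_all
  have "seg_int P x z * (y - z) \<le> seg_int P z y * (z - x)"
    by (rule seg_int_convex[OF P]) (use xz * in auto)
  then have "seg_int P x z * ((1 - t) * (y - x)) \<le> seg_int P z y * (t * (y - x))"
    unfolding zx yz .
  then have "seg_int P x z * (1 - t) * (y - x) \<le> seg_int P z y * t * (y - x)" by (simp add: mult_ac)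
  then have "seg_int P x z * (1 - t) \<le> seg_int P z y * t" using * by simp
  then have "seg_int P x z \<le> seg_int P x z * t + seg_int P z y * t" by (simp add: right_diff_distrib)
  moreover have eq: "seg_int P 0 z = seg_int P 0 x + seg_int P x z" "seg_int P 0 y = seg_int P 0 z + seg_int P z y"
    by (intro seg_int_add_interval L2_integrable K_L2 P; use xz * in simp)+
  moreover have "(1 - t) * seg_int P 0 x + t * seg_int P 0 y = seg_int P 0 x + seg_int P x z * t + seg_int P z y * t"
    unfolding eq by (simp add: algebra_simps)
  ultimately have "seg_int P 0 z \<le> (1 - t) * seg_int P 0 x + t * seg_int P 0 y" by linarith
  then show "seg_int P 0 ((1 - t) *\<^sub>R x + t *\<^sub>R y) \<le> (1 - t) * seg_int P 0 x + t * seg_int P 0 y"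
    by (simp add: z_def)
qed simp

text \<open>Let A and B be the primitives of \<open>U\<close> and of its projection. The normal cone
  gives B \<le> A, with equality off the constancy set of the projection; B is convex and
  continuous, hence a competitor. Any competitor \<open>g\<close> satisfies \<open>g\<close> \<le> A
  = B at the two ends of a constancy interval, where B is affine in between, so convexity gives
  \<open>g\<close> \<le> B inside as well.\<close>

lemma convex_envelope_eq:
  assumes U: "U \<in> L2" and m: "0 \<le> m" "m \<le> 1"
  shows "convex_envelope (primitive U) m = seg_int (proj_K U) 0 m"
proof -
  define P where "P = proj_K U"
  have PK: "P \<in> K" and W: "(\<lambda>m. U m - P m) \<in> subdiff_I_K P"
    using proj_K_variational[OF U] by (simp_all add: P_def)
  have PL: "P \<in> L2" using K_L2[OF PK] .
  define Z where "Z x = seg_int (\<lambda>m. U m - P m) 0 x" for x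
  have Z: "Z x = primitive U x - seg_int P 0 x" if "x \<le> 1" for x
    unfolding Z_def using that by (simp add: seg_int_diff L2_integrable U PL primitive_seg_int)
  have Z0: "0 \<le> Z x" if "0 \<le> x" "x \<le> 1" for x
    unfolding Z_def using subdiff_primitive_nonneg[OF PK W] that by blast
  have Zz: "Z x = 0" if "0 \<le> x" "x \<le> 1" "x \<notin> Omega_of P" for x
  proof -
    have "x = 0 \<or> x = 1 \<or> x \<in> Omega" using that by (auto simp: Omega_def)
    then consider "x = 0" | "x = 1" | "x \<in> Omega" by blast
    then show ?thesis
      unfolding Z_def using subdiff_total[OF PK W] subdiff_primitive_zero[OF PK W] that by cases auto
  qed
  define S where "S = {g. convex_on {0..1} g \<and> lsc_on {0..1} g \<and> (\<forall>x\<in>{0..1}. g x \<le> primitive U x)}"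
  have mem: "seg_int P 0 \<in> S"
    unfolding S_def
  proof (intro CollectI conjI ballI)
    show "convex_on {0..1} (seg_int P 0)" by (rule seg_int_convex_on[OF PK])
    show "lsc_on {0..1} (seg_int P 0)"
      unfolding lsc_on_def
    proof (intro ballI allI impI)
      fix x c assume "x \<in> {0..1::real}" "c < seg_int P 0 x"
      then show "\<forall>\<^sub>F y in at x within {0..1}. c < seg_int P 0 y"
        using seg_int_continuous_on[OF PL] order_tendstoD(1) unfolding continuous_on_def by blast
    qed
    show "seg_int P 0 x \<le> primitive U x" if "x \<in> {0..1}" for x
      using Z[of x] Z0[of x] that by simp
  qed
  have upper: "g m \<le> seg_int P 0 m" if g: "g \<in> S" for g
  proof (cases "m \<in> Omega_of P")
    case False
    then have "primitive U m = seg_int P 0 m" using Zz[OF m] Z[OF m(2)] by simp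
    moreover have "g m \<le> primitive U m" using g m by (simp add: S_def)
    ultimately show ?thesis by simp
  next
    case True
    then obtain a b where ab: "a < m" "m < b" "{a<..<b} \<subseteq> Omega_of P" "a \<notin> Omega_of P" "b \<notin> Omega_of P"
        "0 \<le> a" "b \<le> 1"
      using open_interval_around[OF open_Omega_of Omega_of_subset] by metis
    obtain c where c: "\<And>x. a < x \<Longrightarrow> x < b \<Longrightarrow> P x = c"
      using Omega_of_imp_constant[OF ab(3)] ab(1,2) by force
    define t where "t = (m - a) / (b - a)"
    have "m - a = t * (b - a)" using ab by (simp add: t_def)
    then have t: "0 \<le> t" "t \<le> 1" "m = (1 - t) * a + t * b"
      using ab by (auto simp: t_def divide_simps) (auto simp: algebra_simps)
    have "g m \<le> (1 - t) * g a + t * g b"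
      using convex_onD[of "{0..1}" g t a b] g t ab by (simp add: S_def)
    also have "\<dots> \<le> (1 - t) * seg_int P 0 a + t * seg_int P 0 b"
    proof (intro add_mono mult_left_mono)
      have "g x \<le> seg_int P 0 x" if "0 \<le> x" "x \<le> 1" "x \<notin> Omega_of P" for x
      proof -
        have "g x \<le> primitive U x" using g that by (simp add: S_def)
        then show ?thesis using Zz[OF that] Z[OF that(2)] by simp
      qed
      then show "g a \<le> seg_int P 0 a" "g b \<le> seg_int P 0 b" using ab by auto
    qed (use t in auto)
    also have "\<dots> = seg_int P 0 m"
    proof -
      have "seg_int P 0 m = seg_int P 0 a + c * (m - a)" "seg_int P 0 b = seg_int P 0 a + c * (b - a)"
        using seg_int_add_interval[OF L2_integrable[OF PL], of 0 a m] seg_int_const_on[of a m P c]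
          seg_int_add_interval[OF L2_integrable[OF PL], of 0 a b] seg_int_const_on[of a b P c] ab c by auto
      moreover have "c * (m - a) = t * (c * (b - a))" using \<open>m - a = t * (b - a)\<close> by simp
      moreover have "(1 - t) * seg_int P 0 a + t * (seg_int P 0 a + c * (b - a)) = seg_int P 0 a + t * (c * (b - a))"
        by (simp add: algebra_simps)
      ultimately show ?thesis by simp
    qed
    finally show ?thesis .
  qed
  show ?thesis
    unfolding convex_envelope_def S_def[symmetric] P_def[symmetric]
  proof (rule cSup_eq_maximum)
    show "seg_int P 0 m \<in> (\<lambda>g. g m) ` S" using mem by blast
  qed (use upper in blast)
qed

text \<open>The integral of \<open>(f x - f y) * (g x - g y)\<close> over the square, done as two
  single integrations: fact \<open>1\<close> integrates in \<open>x\<close> for fixed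
  \<open>y\<close>, and its result is then integrated in \<open>y\<close>.\<close>

lemma Chebyshev_seg_int:
  assumes f: "f \<in> L2" and g: "g \<in> L2" and ab: "0 \<le> a" "a \<le> b" "b \<le> 1"
    and same: "\<And>x y. a < x \<Longrightarrow> x < b \<Longrightarrow> a < y \<Longrightarrow> y < b \<Longrightarrow> 0 \<le> (f x - f y) * (g x - g y)"
  shows "seg_int f a b * seg_int g a b \<le> (b - a) * seg_int (\<lambda>x. f x * g x) a b"
proof -
  define h where "h x = f x * g x" for x
  have fi: "integrable MO f" "integrable MO g" "integrable MO h"
    using L2_integrable[OF f] L2_integrable[OF g] L2_mult_integrable[OF f g] by (simp_all add: h_def[abs_def])
  have fi': "integrable MO (\<lambda>x. c * f x)" "integrable MO (\<lambda>x. c * g x)" "integrable MO (\<lambda>x. c)" for c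
    using fi by (auto simp: emeasure_MO)
  have zero: "seg_int (\<lambda>x. 0) a b = 0" using seg_int_const[OF ab, of 0] by simp
  have 1: "0 \<le> seg_int h a b - g y * seg_int f a b - f y * seg_int g a b + h y * (b - a)" if y: "a < y" "y < b" for y
  proof -
    have "seg_int (\<lambda>x. 0) a b \<le> seg_int (\<lambda>x. ((h x - g y * f x) - f y * g x) + h y) a b"
    proof (rule seg_int_mono)
      fix x assume "a < x" "x < b"
      from same[OF this y] show "0 \<le> ((h x - g y * f x) - f y * g x) + h y"
        by (simp add: h_def algebra_simps)
    qed (use fi fi' in auto)
    also have "seg_int (\<lambda>x. ((h x - g y * f x) - f y * g x) + h y) a b
        = seg_int h a b - g y * seg_int f a b - f y * seg_int g a b + h y * (b - a)"
      using fi fi' ab by (simp add: seg_int_add seg_int_diff seg_int_cmult seg_int_const)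
    finally show ?thesis by (simp add: zero)
  qed
  have "seg_int (\<lambda>x. 0) a b \<le> seg_int (\<lambda>y. ((seg_int h a b - seg_int f a b * g y) - seg_int g a b * f y) + (b - a) * h y) a b"
    by (rule seg_int_mono) (use fi fi' 1 in \<open>auto simp: mult_ac\<close>)
  also have "\<dots> = 2 * ((b - a) * seg_int h a b - seg_int f a b * seg_int g a b)"
    using fi fi' ab by (simp add: seg_int_add seg_int_diff seg_int_cmult seg_int_const)
  finally show ?thesis by (simp add: h_def[abs_def] zero)
qed

text \<open>Equality in Chebyshev's inequality for \<open>f\<close> with itself: the variance
  vanishes, so \<open>f\<close> equals its mean.\<close>

lemma seg_int_AE_const:
  assumes f: "f \<in> L2" and ab: "0 \<le> a" "a < b" "b \<le> 1"
    and eq: "(b - a) * seg_int (\<lambda>x. (f x)\<^sup>2) a b = (seg_int f a b)\<^sup>2"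
  shows "AE x in lborel. a < x \<and> x < b \<longrightarrow> f x = seg_int f a b / (b - a)"
proof -
  define c where "c = seg_int f a b / (b - a)"
  have fi: "integrable MO f" "integrable MO (\<lambda>x. (f x)\<^sup>2)" using L2_integrable[OF f] f by (auto simp: L2_iff)
  have c: "seg_int f a b = c * (b - a)" using ab by (simp add: c_def)
  have "seg_int (\<lambda>x. ((f x)\<^sup>2 - 2 * c * f x) + c\<^sup>2) a b = seg_int (\<lambda>x. (f x)\<^sup>2) a b - 2 * c * seg_int f a b + c\<^sup>2 * (b - a)"
    using fi ab by (simp add: seg_int_add seg_int_diff seg_int_cmult seg_int_const emeasure_MO)
  also have "\<dots> = 0"
  proof -
    have "(b - a) * seg_int (\<lambda>x. (f x)\<^sup>2) a b = (b - a) * (c\<^sup>2 * (b - a))"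
      unfolding eq c by (simp add: power2_eq_square)
    then have "seg_int (\<lambda>x. (f x)\<^sup>2) a b = c\<^sup>2 * (b - a)" using ab by simp
    then show ?thesis unfolding c by (simp add: power2_eq_square)
  qed
  also have "(\<lambda>x. ((f x)\<^sup>2 - 2 * c * f x) + c\<^sup>2) = (\<lambda>x. (f x - c)\<^sup>2)"
    by (auto simp: power2_diff)
  finally have 0: "seg_int (\<lambda>x. (f x - c)\<^sup>2) a b = 0" .
  have cL: "(\<lambda>x. f x - c) \<in> L2" using f by auto
  have int: "integrable MO (\<lambda>x. indicator {a<..<b} x * (f x - c)\<^sup>2)"
    by (rule integrable_indicator_MO) (use cL in \<open>simp add: L2_iff\<close>)
  have "AE x in MO. indicator {a<..<b} x * (f x - c)\<^sup>2 = 0"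
    using 0 integral_nonneg_eq_0_iff_AE[OF int] by (simp add: seg_int_def)
  then show ?thesis
    unfolding AE_MO c_def[symmetric]
  proof eventually_elim
    case (elim x)
    then show ?case using ab by (auto simp: Omega_def indicator_def)
  qed
qed

lemma K_AE_const:
  assumes X: "X \<in> K" and ab: "0 \<le> a" "b \<le> 1"
    and c: "AE x in lborel. a < x \<and> x < b \<longrightarrow> X x = c" and x: "a < x" "x < b"
  shows "X x = c"
proof -
  have AEc: "AE x in MO. x \<in> {x. a < x \<and> x < b \<longrightarrow> X x = c}"
    using c unfolding AE_MO by eventually_elim simp
  obtain y where y: "a < y" "y < x" "X y = c"
    using AE_MO_dense[OF AEc, of a x] ab x by auto
  obtain z where z: "x < z" "z < b" "X z = c"
    using AE_MO_dense[OF AEc, of x b] ab x by auto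
  have "x \<in> Omega" "y \<in> Omega" "z \<in> Omega" using y z ab x by (auto simp: Omega_def)
  then have "X y \<le> X x" "X x \<le> X z"
    using K_mono[OF X, of y x] K_mono[OF X, of x z] y z by auto
  with y z show ?thesis by simp
qed

section \<open>Admissible modifications of nondecreasing functions\<close>

lemma K_flatten:
  assumes X: "X \<in> K"
    and k: "\<And>x. x \<in> Omega \<Longrightarrow> x < a \<Longrightarrow> X x \<le> k" "\<And>x. x \<in> Omega \<Longrightarrow> b \<le> x \<Longrightarrow> k \<le> X x"
  shows "(\<lambda>x. if a \<le> x \<and> x < b then k else X x) \<in> K"
proof (rule K_I)
  let ?Y = "\<lambda>x. if a \<le> x \<and> x < b then k else X x"
  show mono: "?Y x \<le> ?Y y" if "x \<in> Omega" "y \<in> Omega" "x \<le> y" for x y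
    using that k K_mono[OF X that] by auto
  have "?Y \<in> borel_measurable MO"
    by (rule mono_on_measurable_MO) (use mono in \<open>blast intro: mono_onI\<close>)
  then show "?Y \<in> L2"
    by (rule L2_bound[of _ "\<lambda>x. \<bar>k\<bar> + \<bar>X x\<bar>"]) (auto intro!: L2_add L2_abs K_L2[OF X])
  show "(?Y \<longlongrightarrow> ?Y x) (at_right x)" if x: "x \<in> Omega" for x
  proof -
    consider "x < a" | "a \<le> x" "x < b" | "a \<le> x" "b \<le> x" by linarith
    then show ?thesis
    proof cases
      case 1
      show ?thesis by (rule tendsto_at_right_cong[of x a _ X]) (use 1 K_right[OF X x] in auto)
    next
      case 2
      show ?thesis by (rule tendsto_at_right_cong[of x b _ "\<lambda>_. k"]) (use 2 in auto)
    next
      case 3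
      show ?thesis by (rule tendsto_at_right_cong[of x "x + 1" _ X]) (use 3 K_right[OF X x] in auto)
    qed
  qed
qed

text \<open>If \<open>a = 0\<close> or \<open>b = 1\<close>, the value \<open>Y a\<close> or
  \<open>Y b\<close> is arbitrary, but then no point of \<Omega> falls into that branch.\<close>

lemma K_truncate:
  assumes Y: "Y \<in> K" and ab: "0 \<le> a" "a < b" "b \<le> 1"
  shows "(\<lambda>x. if x < a then Y a else if x < b then Y x else Y b) \<in> K"
proof (rule K_I)
  let ?E = "\<lambda>x. if x < a then Y a else if x < b then Y x else Y b"
  show mono: "?E x \<le> ?E y" if xy: "x \<in> Omega" "y \<in> Omega" "x \<le> y" for x y
  proof -
    have a: "a \<in> Omega" if "x < a" using that xy ab by (auto simp: Omega_def)
    have b: "b \<in> Omega" if "b \<le> y" using that xy ab by (auto simp: Omega_def)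
    show ?thesis using K_mono[OF Y] xy ab a b by auto
  qed
  have "?E \<in> borel_measurable MO"
    by (rule mono_on_measurable_MO) (use mono in \<open>blast intro: mono_onI\<close>)
  then show "?E \<in> L2"
    by (rule L2_bound[of _ "\<lambda>x. (\<bar>Y a\<bar> + \<bar>Y b\<bar>) + \<bar>Y x\<bar>"]) (auto intro!: L2_add L2_abs K_L2[OF Y])
  show "(?E \<longlongrightarrow> ?E x) (at_right x)" if x: "x \<in> Omega" for x
  proof -
    consider "x < a" | "a \<le> x" "x < b" | "b \<le> x" by linarith
    then show ?thesis
    proof cases
      case 1
      show ?thesis by (rule tendsto_at_right_cong[of x a _ "\<lambda>_. Y a"]) (use 1 in auto)
    next
      case 2
      show ?thesis by (rule tendsto_at_right_cong[of x b _ Y]) (use 2 K_right[OF Y x] in auto)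
    next
      case 3
      show ?thesis by (rule tendsto_at_right_cong[of x "x + 1" _ "\<lambda>_. Y b"]) (use 3 ab in auto)
    qed
  qed
qed

section \<open>The alignment force\<close>

context
  fixes \<phi> :: "real \<Rightarrow> real"
  assumes protocol: "protocol \<phi>"
begin

lemma Phi_integrable:
  assumes "X \<in> L2"
  shows "integrable MO (\<lambda>\<omega>. Phi \<phi> (c - X \<omega>))"
proof (rule Bochner_Integration.integrable_bound)
  show "integrable MO (\<lambda>\<omega>. Phi \<phi> 1 + \<phi> 1 * \<bar>c - X \<omega>\<bar>)"
    by (intro L2_integrable L2_add L2_cmult L2_abs L2_diff assms L2_const)
  have [measurable]: "X \<in> borel_measurable MO" by (rule L2_measurable[OF assms])
  note [measurable] = Phi_measurable[OF protocol]
  show "(\<lambda>\<omega>. Phi \<phi> (c - X \<omega>)) \<in> borel_measurable MO" by measurable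
  show "AE \<omega> in MO. norm (Phi \<phi> (c - X \<omega>)) \<le> norm (Phi \<phi> 1 + \<phi> 1 * \<bar>c - X \<omega>\<bar>)"
  proof (rule AE_I2)
    fix \<omega>
    show "norm (Phi \<phi> (c - X \<omega>)) \<le> norm (Phi \<phi> 1 + \<phi> 1 * \<bar>c - X \<omega>\<bar>)"
      using Phi_linear_growth[OF protocol, of "c - X \<omega>"] unfolding real_norm_def by linarith
  qed
qed

lemma alignment_diff:
  assumes "X \<in> L2"
  shows "alignment \<phi> X y - alignment \<phi> X x = (\<integral>\<omega>. Phi \<phi> (X y - X \<omega>) - Phi \<phi> (X x - X \<omega>) \<partial>MO)"
  by (simp add: alignment_MO Phi_integrable[OF assms])

lemma alignment_mono:
  assumes "X \<in> L2" "X x \<le> X y"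
  shows "alignment \<phi> X x \<le> alignment \<phi> X y"
  unfolding alignment_MO
  by (rule integral_mono) (auto intro!: Phi_integrable assms Phi_mono[OF protocol])

lemma alignment_upper:
  assumes "X \<in> L2" "X x \<le> X y"
  shows "alignment \<phi> X y - alignment \<phi> X x \<le> 2 * Phi \<phi> (X y - X x)"
proof -
  have "alignment \<phi> X y - alignment \<phi> X x \<le> (\<integral>\<omega>. 2 * Phi \<phi> (X y - X x) \<partial>MO)"
    unfolding alignment_diff[OF assms(1)]
    by (rule integral_mono)
      (auto intro!: Phi_integrable assms Phi_increment[OF protocol] simp: emeasure_MO)
  then show ?thesis by (simp add: prob_MO)
qed

text \<open>All mass pulls the two particles together. The mass in \<open>(q, p)\<close> lies
  between them and contributes at least \<open>Phi \<phi> (X y - X x)\<close> per unit, the rest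
  something nonnegative.\<close>

lemma alignment_lower:
  assumes X: "X \<in> K" and *: "x \<in> Omega" "y \<in> Omega" "x \<le> q" "q \<le> p" "p \<le> y"
  shows "(p - q) * Phi \<phi> (X y - X x) \<le> alignment \<phi> X y - alignment \<phi> X x"
proof -
  have XL: "X \<in> L2" by (rule K_L2[OF X])
  have "(p - q) * Phi \<phi> (X y - X x) = seg_int (\<lambda>_. Phi \<phi> (X y - X x)) q p"
    using seg_int_const[of q p "Phi \<phi> (X y - X x)"] * by (auto simp: Omega_def)
  also have "\<dots> \<le> (\<integral>\<omega>. Phi \<phi> (X y - X \<omega>) - Phi \<phi> (X x - X \<omega>) \<partial>MO)"
    unfolding seg_int_def
  proof (rule integral_mono)
    show "integrable MO (\<lambda>\<omega>. indicator {q<..<p} \<omega> * Phi \<phi> (X y - X x))"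
      by (rule integrable_indicator_MO) (simp add: emeasure_MO)
    show "integrable MO (\<lambda>\<omega>. Phi \<phi> (X y - X \<omega>) - Phi \<phi> (X x - X \<omega>))"
      by (intro Bochner_Integration.integrable_diff Phi_integrable XL)
    fix \<omega> assume "\<omega> \<in> space MO"
    then have \<omega>: "\<omega> \<in> Omega" by simp
    have "X x \<le> X y" using K_mono[OF X] * by auto
    then have "0 \<le> Phi \<phi> (X y - X \<omega>) - Phi \<phi> (X x - X \<omega>)"
      using Phi_mono[OF protocol, of "X x - X \<omega>" "X y - X \<omega>"] by simp
    moreover have "Phi \<phi> (X y - X x) \<le> Phi \<phi> (X y - X \<omega>) - Phi \<phi> (X x - X \<omega>)" if "q < \<omega>" "\<omega> < p"
      by (rule Phi_increment_between[OF protocol]) (use K_mono[OF X] * \<omega> that in auto)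
    ultimately show "indicator {q<..<p} \<omega> * Phi \<phi> (X y - X x) \<le> Phi \<phi> (X y - X \<omega>) - Phi \<phi> (X x - X \<omega>)"
      by (auto simp: indicator_def)
  qed
  also have "\<dots> = alignment \<phi> X y - alignment \<phi> X x" by (rule alignment_diff[OF XL, symmetric])
  finally show ?thesis .
qed

lemma alignment_L2:
  assumes X: "X \<in> K"
  shows "alignment \<phi> X \<in> L2"
proof (rule L2_bound)
  have XL: "X \<in> L2" by (rule K_L2[OF X])
  show "alignment \<phi> X \<in> borel_measurable MO"
    by (rule mono_on_measurable_MO) (auto intro!: mono_onI alignment_mono XL K_mono[OF X])
  show "(\<lambda>x. (Phi \<phi> 1 + \<phi> 1 * (\<integral>\<omega>. \<bar>X \<omega>\<bar> \<partial>MO)) + \<phi> 1 * \<bar>X x\<bar>) \<in> L2"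
    by (intro L2_add L2_cmult L2_abs XL L2_const)
  fix x
  have "\<bar>alignment \<phi> X x\<bar> \<le> (\<integral>\<omega>. \<bar>Phi \<phi> (X x - X \<omega>)\<bar> \<partial>MO)"
    unfolding alignment_MO by (rule integral_abs_bound)
  also have "\<dots> \<le> (\<integral>\<omega>. (Phi \<phi> 1 + \<phi> 1 * \<bar>X x\<bar>) + \<phi> 1 * \<bar>X \<omega>\<bar> \<partial>MO)"
  proof (rule integral_mono)
    show "integrable MO (\<lambda>\<omega>. \<bar>Phi \<phi> (X x - X \<omega>)\<bar>)" by (intro integrable_abs Phi_integrable XL)
    show "integrable MO (\<lambda>\<omega>. (Phi \<phi> 1 + \<phi> 1 * \<bar>X x\<bar>) + \<phi> 1 * \<bar>X \<omega>\<bar>)"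
      by (intro L2_integrable L2_add L2_cmult L2_abs XL L2_const)
    fix \<omega>
    have "\<phi> 1 * \<bar>X x - X \<omega>\<bar> \<le> \<phi> 1 * (\<bar>X x\<bar> + \<bar>X \<omega>\<bar>)"
      using phi_nonneg[OF protocol, of 1] by (intro mult_left_mono) auto
    then show "\<bar>Phi \<phi> (X x - X \<omega>)\<bar> \<le> (Phi \<phi> 1 + \<phi> 1 * \<bar>X x\<bar>) + \<phi> 1 * \<bar>X \<omega>\<bar>"
      using Phi_linear_growth[OF protocol, of "X x - X \<omega>"] by (simp add: algebra_simps)
  qed
  also have "\<dots> = (Phi \<phi> 1 + \<phi> 1 * (\<integral>\<omega>. \<bar>X \<omega>\<bar> \<partial>MO)) + \<phi> 1 * \<bar>X x\<bar>"
    using L2_integrable[OF XL] by (simp add: prob_MO emeasure_MO)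
  finally show "\<bar>alignment \<phi> X x\<bar> \<le> \<bar>(Phi \<phi> 1 + \<phi> 1 * (\<integral>\<omega>. \<bar>X \<omega>\<bar> \<partial>MO)) + \<phi> 1 * \<bar>X x\<bar>\<bar>"
    by linarith
qed

end

section \<open>Lagrangian solutions\<close>

locale lagrangian =
  fixes \<phi> Xbar Vbar :: "real \<Rightarrow> real" and X :: "real \<Rightarrow> real \<Rightarrow> real"
  assumes protocol: "protocol \<phi>"
    and Xbar_K: "Xbar \<in> K"
    and Vbar_H: "Vbar \<in> H_of Xbar"
    and solution: "lagrangian_solution \<phi> Xbar Vbar X"
begin

definition \<Psi> :: "real \<Rightarrow> real" where "\<Psi> = natural_velocity \<phi> Xbar Vbar"
definition P :: "real \<Rightarrow> real" where "P = proj_K \<Psi>"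
definition F :: "real \<Rightarrow> real \<Rightarrow> real" where "F t = alignment \<phi> (X t)"

lemma X_K: "0 \<le> t \<Longrightarrow> X t \<in> K"
  and X_0: "m \<in> Omega \<Longrightarrow> X 0 m = Xbar m"
  using solution by (auto simp: lagrangian_solution_def)

lemma X_L2: "0 \<le> t \<Longrightarrow> X t \<in> L2"
  by (rule K_L2[OF X_K])

lemma X_mono: "0 \<le> t \<Longrightarrow> x \<in> Omega \<Longrightarrow> y \<in> Omega \<Longrightarrow> x \<le> y \<Longrightarrow> X t x \<le> X t y"
  by (rule K_mono[OF X_K])

lemma Psi_L2: "\<Psi> \<in> L2"
proof -
  have "Vbar \<in> L2" using Vbar_H by (simp add: H_of_def)
  then have "(\<lambda>m. Vbar m + alignment \<phi> Xbar m) \<in> L2"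
    by (intro L2_add alignment_L2[OF protocol Xbar_K])
  then show ?thesis by (simp add: \<Psi>_def natural_velocity_def[abs_def])
qed

lemma P_K: "P \<in> K" and P_subdiff: "(\<lambda>m. \<Psi> m - P m) \<in> subdiff_I_K P"
  using proj_K_variational[OF Psi_L2] by (simp_all add: P_def)

lemma P_L2: "P \<in> L2"
  by (rule K_L2[OF P_K])

lemma P_mono: "x \<in> Omega \<Longrightarrow> y \<in> Omega \<Longrightarrow> x \<le> y \<Longrightarrow> P x \<le> P y"
  by (rule K_mono[OF P_K])

lemma F_L2: "0 \<le> t \<Longrightarrow> F t \<in> L2"
  unfolding F_def by (rule alignment_L2[OF protocol X_K])

definition good :: "real \<Rightarrow> bool" where
  "good t \<longleftrightarrow> 0 < t \<and> (\<exists>V. has_L2_derivative X V t \<and> (\<lambda>m. \<Psi> m - F t m - V m) \<in> subdiff_I_K (X t))"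

definition V :: "real \<Rightarrow> real \<Rightarrow> real" where
  "V t = (SOME V. has_L2_derivative X V t \<and> (\<lambda>m. \<Psi> m - F t m - V m) \<in> subdiff_I_K (X t))"

definition W :: "real \<Rightarrow> real \<Rightarrow> real" where
  "W t m = \<Psi> m - F t m - V t m"

lemma AE_good: "AE t in lborel. 0 < t \<longrightarrow> good t"
proof -
  have "AE t in lborel. 0 < t \<longrightarrow> (\<exists>V. has_L2_derivative X V t \<and>
      (\<lambda>m. natural_velocity \<phi> Xbar Vbar m - alignment \<phi> (X t) m - V m) \<in> subdiff_I_K (X t))"
    using solution by (simp add: lagrangian_solution_def)
  then show ?thesis by eventually_elim (simp add: good_def \<Psi>_def F_def)
qed

lemma good_pos: "good t \<Longrightarrow> 0 < t"
  by (simp add: good_def)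

lemma good_derivative: "good t \<Longrightarrow> has_L2_derivative X (V t) t"
  and good_subdiff: "good t \<Longrightarrow> W t \<in> subdiff_I_K (X t)"
proof -
  assume "good t"
  then have "\<exists>V. has_L2_derivative X V t \<and> (\<lambda>m. \<Psi> m - F t m - V m) \<in> subdiff_I_K (X t)"
    by (simp add: good_def)
  from someI_ex[OF this] have "has_L2_derivative X (V t) t \<and> (\<lambda>m. \<Psi> m - F t m - V t m) \<in> subdiff_I_K (X t)"
    unfolding V_def[symmetric] .
  then show "has_L2_derivative X (V t) t" "W t \<in> subdiff_I_K (X t)"
    by (simp_all add: W_def[abs_def])
qed

lemma V_L2: "good t \<Longrightarrow> V t \<in> L2"
  using good_derivative by (simp add: has_L2_derivative_def)

lemma W_L2: "good t \<Longrightarrow> W t \<in> L2"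
  using good_subdiff by (rule subdiff_L2)

section \<open>Time derivatives and absolute continuity of linear and quadratic functionals\<close>

lemma inner_has_derivative:
  assumes t: "good t" and g: "g \<in> L2"
  shows "((\<lambda>s. l2_inner (X s) g) has_real_derivative l2_inner (V t) g) (at t)"
proof -
  have t0: "0 < t" using good_pos[OF t] .
  have VL: "V t \<in> L2" using V_L2[OF t] .
  define E where "E h = l2_norm (\<lambda>m. (X (t + h) m - X t m) / h - V t m)" for h
  have E: "(E \<longlongrightarrow> 0) (at 0)"
    using good_derivative[OF t] unfolding has_L2_derivative_def E_def by simp
  have ev: "\<forall>\<^sub>F h in at (0::real). norm ((l2_inner (X (t + h)) g - l2_inner (X t) g) / h - l2_inner (V t) g) \<le> E h * l2_norm g"
  proof -
    have "\<forall>\<^sub>F h in at (0::real). - t < h" using t0 by (intro order_tendstoD) (auto intro: tendsto_ident_at)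
    then show ?thesis
    proof eventually_elim
      case (elim h)
      have L: "X (t + h) \<in> L2" "X t \<in> L2" using X_L2 elim t0 by auto
      have "(l2_inner (X (t + h)) g - l2_inner (X t) g) / h - l2_inner (V t) g
          = l2_inner (\<lambda>m. (X (t + h) m - X t m) / h - V t m) g"
        using L VL g by (simp add: l2_inner_diff_left l2_inner_divide_left L2_diff L2_divide)
      also have "\<bar>\<dots>\<bar> \<le> E h * l2_norm g"
        unfolding E_def by (intro Cauchy_Schwarz_L2 L2_diff L2_divide g L VL)
      finally show ?case by simp
    qed
  qed
  have "((\<lambda>h. E h * l2_norm g) \<longlongrightarrow> 0 * l2_norm g) (at 0)" by (intro tendsto_intros E)
  then have "((\<lambda>h. E h * l2_norm g) \<longlongrightarrow> 0) (at 0)" by simp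
  then have "((\<lambda>h. (l2_inner (X (t + h)) g - l2_inner (X t) g) / h - l2_inner (V t) g) \<longlongrightarrow> 0) (at 0)"
    by (rule Lim_null_comparison[OF ev])
  then have "((\<lambda>h. (l2_inner (X (t + h)) g - l2_inner (X t) g) / h) \<longlongrightarrow> l2_inner (V t) g) (at 0)"
    by (simp add: LIM_zero_iff)
  then show ?thesis unfolding DERIV_def .
qed

lemma seg_int_has_derivative: "good t \<Longrightarrow>
    ((\<lambda>s. seg_int (X s) p q) has_real_derivative seg_int (V t) p q) (at t)"
  unfolding seg_int_inner by (rule inner_has_derivative) (auto intro: L2_indicator)

lemma X_increment:
  obtains g where "\<And>T. 0 \<le> T \<Longrightarrow> set_integrable lborel {0..T} g"
    "\<And>s t. 0 \<le> s \<Longrightarrow> s \<le> t \<Longrightarrow> l2_norm (\<lambda>m. X t m - X s m) \<le> (LINT r:{s..t}|lborel. g r)"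
  using solution unfolding lagrangian_solution_def abs_cont_curve_def by blast

lemma dominated_inner:
  assumes h: "h \<in> L2"
  shows "dominated (\<lambda>t. l2_inner (X t) h)"
proof (rule dominatedI)
  fix T :: real assume T: "0 \<le> T"
  obtain g where g: "\<And>T. 0 \<le> T \<Longrightarrow> set_integrable lborel {0..T} g"
    "\<And>s t. 0 \<le> s \<Longrightarrow> s \<le> t \<Longrightarrow> l2_norm (\<lambda>m. X t m - X s m) \<le> (LINT r:{s..t}|lborel. g r)"
    using X_increment by blast
  have "\<bar>l2_inner (X t) h - l2_inner (X s) h\<bar> \<le> (LINT r:{s..t}|lborel. l2_norm h * g r)"
    if st: "0 \<le> s" "s \<le> t" for s t
  proof -
    have L: "X t \<in> L2" "X s \<in> L2" using X_L2 st by auto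
    have "\<bar>l2_inner (X t) h - l2_inner (X s) h\<bar> = \<bar>l2_inner (\<lambda>m. X t m - X s m) h\<bar>"
      using L h by (simp add: l2_inner_diff_left)
    also have "\<dots> \<le> l2_norm (\<lambda>m. X t m - X s m) * l2_norm h"
      using L h by (intro Cauchy_Schwarz_L2) auto
    also have "\<dots> \<le> l2_norm h * (LINT r:{s..t}|lborel. g r)"
      using mult_left_mono[OF g(2)[OF st] l2_norm_nonneg[of h]] by (simp add: mult.commute)
    finally show ?thesis by simp
  qed
  then show "\<exists>g. set_integrable lborel {0..T} g \<and> (\<forall>s t. 0 \<le> s \<and> s \<le> t \<and> t \<le> T \<longrightarrow>
      \<bar>l2_inner (X t) h - l2_inner (X s) h\<bar> \<le> (LINT r:{s..t}|lborel. g r))"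
    using g(1)[OF T] by (intro exI[of _ "\<lambda>r. l2_norm h * g r"]) auto
qed

lemma dominated_seg_int: "dominated (\<lambda>t. seg_int (X t) p q)"
  unfolding seg_int_inner by (rule dominated_inner) (auto intro: L2_indicator)

lemma dominated_seg_int_square: "dominated (\<lambda>t. seg_int (\<lambda>m. (X t m)\<^sup>2) p q)"
proof (rule dominatedI)
  fix T :: real assume T: "0 \<le> T"
  obtain g where g: "\<And>T. 0 \<le> T \<Longrightarrow> set_integrable lborel {0..T} g"
    "\<And>s t. 0 \<le> s \<Longrightarrow> s \<le> t \<Longrightarrow> l2_norm (\<lambda>m. X t m - X s m) \<le> (LINT r:{s..t}|lborel. g r)"
    using X_increment by blast
  \<comment> \<open>\<open>g\<close> may change sign, so the integral over \<open>[0, t]\<close> is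
    bounded uniformly in \<open>t\<close> by that of its absolute value over
    \<open>[0, T]\<close>.\<close>
  define M where "M = l2_norm (X 0) + (LINT r:{0..T}|lborel. \<bar>g r\<bar>)"
  have XM: "l2_norm (X t) \<le> M" if t: "0 \<le> t" "t \<le> T" for t
  proof -
    have "X t = (\<lambda>m. X 0 m + (X t m - X 0 m))" by auto
    then have "l2_norm (X t) \<le> l2_norm (X 0) + l2_norm (\<lambda>m. X t m - X 0 m)"
      using l2_norm_triangle[of "X 0" "\<lambda>m. X t m - X 0 m"] X_L2 t by (metis L2_diff order_refl)
    also have "l2_norm (\<lambda>m. X t m - X 0 m) \<le> (LINT r:{0..t}|lborel. g r)" using g(2)[of 0 t] t by simp
    also have "\<dots> \<le> (LINT r:{0..T}|lborel. \<bar>g r\<bar>)"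
      unfolding set_lebesgue_integral_def
    proof (rule integral_mono)
      show "integrable lborel (\<lambda>r. indicator {0..t} r *\<^sub>R g r)"
        using g(1)[of t] t by (simp add: set_integrable_def)
      show "integrable lborel (\<lambda>r. indicator {0..T} r *\<^sub>R \<bar>g r\<bar>)"
        using set_integrable_abs[OF g(1)[OF T]] by (simp add: set_integrable_def)
    qed (use t in \<open>auto simp: indicator_def\<close>)
    finally show ?thesis by (simp add: M_def)
  qed
  have "\<bar>seg_int (\<lambda>m. (X t m)\<^sup>2) p q - seg_int (\<lambda>m. (X s m)\<^sup>2) p q\<bar> \<le> (LINT r:{s..t}|lborel. (2 * M) * g r)"
    if st: "0 \<le> s" "s \<le> t" "t \<le> T" for s t
  proof -
    have L: "X t \<in> L2" "X s \<in> L2" using X_L2 st by auto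
    define u where "u m = indicator {p<..<q} m * (X t m + X s m)" for m
    have uL: "u \<in> L2" unfolding u_def[abs_def] by (intro L2_indicator_mult L2_add L) simp
    have int: "integrable MO (\<lambda>m. (X t m)\<^sup>2)" "integrable MO (\<lambda>m. (X s m)\<^sup>2)"
      using L by (auto simp: L2_iff)
    have "seg_int (\<lambda>m. (X t m)\<^sup>2) p q - seg_int (\<lambda>m. (X s m)\<^sup>2) p q = seg_int (\<lambda>m. (X t m)\<^sup>2 - (X s m)\<^sup>2) p q"
      using int by (simp add: seg_int_diff)
    also have "\<dots> = l2_inner u (\<lambda>m. X t m - X s m)"
      unfolding seg_int_def l2_inner_MO u_def
      by (rule Bochner_Integration.integral_cong) (auto simp: power2_eq_square algebra_simps)
    also have "\<bar>\<dots>\<bar> \<le> l2_norm u * l2_norm (\<lambda>m. X t m - X s m)"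
      using uL L by (intro Cauchy_Schwarz_L2) auto
    also have "\<dots> \<le> (2 * M) * (LINT r:{s..t}|lborel. g r)"
    proof (rule mult_mono)
      have "l2_norm u \<le> l2_norm (\<lambda>m. X t m + X s m)"
        unfolding u_def[abs_def] using L by (intro l2_norm_indicator_le) auto
      also have "\<dots> \<le> l2_norm (X t) + l2_norm (X s)" by (rule l2_norm_triangle[OF L])
      also have "\<dots> \<le> 2 * M" using XM[of t] XM[of s] st by simp
      finally show "l2_norm u \<le> 2 * M" .
      have "0 \<le> M" using XM[of 0] T l2_norm_nonneg[of "X 0"] by simp
      then show "0 \<le> 2 * M" by simp
    qed (use g(2)[of s t] st in \<open>auto simp: l2_norm_nonneg\<close>)
    finally show ?thesis by simp
  qed
  then show "\<exists>g. set_integrable lborel {0..T} g \<and> (\<forall>s t. 0 \<le> s \<and> s \<le> t \<and> t \<le> T \<longrightarrow>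
      \<bar>seg_int (\<lambda>m. (X t m)\<^sup>2) p q - seg_int (\<lambda>m. (X s m)\<^sup>2) p q\<bar> \<le> (LINT r:{s..t}|lborel. g r))"
    using g(1)[OF T] by (intro exI[of _ "\<lambda>r. (2 * M) * g r"]) auto
qed

text \<open>With the quotients \<open>D h\<close>, the difference quotient of the squares is
  \<open>2 * X t m * D h m + h * (D h m)\<^sup>2\<close>. The first term is covered by the linear
  case; the second vanishes with \<open>h\<close>, because \<open>D h\<close> stays bounded in
  \<open>L2\<close>.\<close>

lemma seg_int_square_has_derivative:
  assumes t: "good t"
  shows "((\<lambda>s. seg_int (\<lambda>m. (X s m)\<^sup>2) p q) has_real_derivative 2 * seg_int (\<lambda>m. X t m * V t m) p q) (at t)"
proof -
  have t0: "0 < t" using good_pos[OF t] .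
  have VL: "V t \<in> L2" and XL: "X t \<in> L2" using V_L2[OF t] X_L2 t0 by auto
  define I where "I = (indicator {p<..<q} :: real \<Rightarrow> real)"
  define D where "D h m = (X (t + h) m - X t m) / h" for h m
  define g where "g m = I m * X t m" for m
  have gL: "g \<in> L2" unfolding g_def[abs_def] I_def by (intro L2_indicator_mult XL) simp
  have lim1: "((\<lambda>h. (l2_inner (X (t + h)) g - l2_inner (X t) g) / h) \<longlongrightarrow> l2_inner (V t) g) (at 0)"
    using inner_has_derivative[OF t gL] unfolding DERIV_def .
  define N where "N h = (\<integral>m. I m * (D h m)\<^sup>2 \<partial>MO)" for h
  define E where "E h = l2_norm (\<lambda>m. D h m - V t m)" for h
  have E: "(E \<longlongrightarrow> 0) (at 0)"
    using good_derivative[OF t] unfolding has_L2_derivative_def E_def D_def by simp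
  have posev: "\<forall>\<^sub>F h in at (0::real). - t < h \<and> h \<noteq> 0"
  proof -
    have "\<forall>\<^sub>F h in at (0::real). - t < h" using t0 by (intro order_tendstoD) (auto intro: tendsto_ident_at)
    moreover have "\<forall>\<^sub>F h in at (0::real). h \<noteq> 0" by (auto simp: eventually_at_filter)
    ultimately show ?thesis by eventually_elim simp
  qed
  have Nb: "\<forall>\<^sub>F h in at (0::real). norm (h * N h) \<le> \<bar>h\<bar> * (l2_norm (V t) + E h)\<^sup>2"
    using posev
  proof eventually_elim
    case (elim h)
    have L: "X (t + h) \<in> L2" using X_L2 elim by auto
    then have DL: "D h \<in> L2" unfolding D_def[abs_def] by (intro L2_divide L2_diff XL)
    have "N h \<le> (\<integral>m. D h m * D h m \<partial>MO)"
      unfolding N_def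
    proof (rule integral_mono)
      show "integrable MO (\<lambda>m. I m * (D h m)\<^sup>2)"
        unfolding I_def by (rule integrable_indicator_MO) (use DL in \<open>simp add: L2_iff\<close>)
      show "integrable MO (\<lambda>m. D h m * D h m)" by (rule L2_mult_integrable[OF DL DL])
    qed (auto simp: I_def indicator_def power2_eq_square)
    also have "\<dots> = (l2_norm (D h))\<^sup>2" by (simp add: l2_norm_square l2_inner_MO)
    also have "\<dots> \<le> (l2_norm (V t) + E h)\<^sup>2"
    proof (rule power_mono)
      have "D h = (\<lambda>m. V t m + (D h m - V t m))" by auto
      then show "l2_norm (D h) \<le> l2_norm (V t) + E h"
        unfolding E_def using l2_norm_triangle[of "V t" "\<lambda>m. D h m - V t m"] VL DL by (metis L2_diff)
    qed (rule l2_norm_nonneg)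
    finally have "N h \<le> (l2_norm (V t) + E h)\<^sup>2" .
    moreover have "0 \<le> N h" unfolding N_def by (rule integral_nonneg_AE) (auto simp: I_def indicator_def)
    ultimately show ?case by (simp add: abs_mult mult_left_mono)
  qed
  have "((\<lambda>h. \<bar>h\<bar> * (l2_norm (V t) + E h)\<^sup>2) \<longlongrightarrow> \<bar>0\<bar> * (l2_norm (V t) + 0)\<^sup>2) (at 0)"
    by (intro tendsto_intros E)
  then have "((\<lambda>h. \<bar>h\<bar> * (l2_norm (V t) + E h)\<^sup>2) \<longlongrightarrow> 0) (at 0)" by simp
  then have lim2: "((\<lambda>h. h * N h) \<longlongrightarrow> 0) (at 0)"
    by (rule Lim_null_comparison[OF Nb])
  have "((\<lambda>h. 2 * ((l2_inner (X (t + h)) g - l2_inner (X t) g) / h) + h * N h) \<longlongrightarrow> 2 * l2_inner (V t) g + 0) (at 0)"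
    by (intro tendsto_add tendsto_mult tendsto_const lim1 lim2)
  moreover have "\<forall>\<^sub>F h in at (0::real). 2 * ((l2_inner (X (t + h)) g - l2_inner (X t) g) / h) + h * N h =
      (seg_int (\<lambda>m. (X (t + h) m)\<^sup>2) p q - seg_int (\<lambda>m. (X t m)\<^sup>2) p q) / h"
    using posev
  proof eventually_elim
    case (elim h)
    have L: "X (t + h) \<in> L2" using X_L2 elim by auto
    then have DL: "D h \<in> L2" unfolding D_def[abs_def] by (intro L2_divide L2_diff XL)
    have int: "integrable MO (\<lambda>m. I m * (D h m)\<^sup>2)"
      unfolding I_def by (rule integrable_indicator_MO) (use DL in \<open>simp add: L2_iff\<close>)
    have int2: "integrable MO (\<lambda>m. X (t + h) m * g m)" "integrable MO (\<lambda>m. X t m * g m)"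
      using L XL gL by (auto intro!: L2_mult_integrable)
    have int3: "integrable MO (\<lambda>m. (X (t + h) m)\<^sup>2)" "integrable MO (\<lambda>m. (X t m)\<^sup>2)"
      using L XL by (auto simp: L2_iff)
    have "seg_int (\<lambda>m. (X (t + h) m)\<^sup>2) p q - seg_int (\<lambda>m. (X t m)\<^sup>2) p q
        = seg_int (\<lambda>m. (X (t + h) m)\<^sup>2 - (X t m)\<^sup>2) p q"
      using int3 by (simp add: seg_int_diff)
    also have "\<dots> = (\<integral>m. (2 * (X (t + h) m * g m) - 2 * (X t m * g m)) + h\<^sup>2 * (I m * (D h m)\<^sup>2) \<partial>MO)"
      unfolding seg_int_def
    proof (rule Bochner_Integration.integral_cong[OF refl])
      fix m
      have "h * D h m = X (t + h) m - X t m" using elim by (simp add: D_def)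
      then have "h\<^sup>2 * (D h m)\<^sup>2 = (X (t + h) m - X t m)\<^sup>2" by (metis power_mult_distrib)
      then have "h\<^sup>2 * (I m * (D h m)\<^sup>2) = I m * (X (t + h) m - X t m)\<^sup>2" by (metis mult.left_commute)
      then show "indicat_real {p<..<q} m * ((X (t + h) m)\<^sup>2 - (X t m)\<^sup>2) =
          (2 * (X (t + h) m * g m) - 2 * (X t m * g m)) + h\<^sup>2 * (I m * (D h m)\<^sup>2)"
        by (simp add: g_def I_def power2_eq_square algebra_simps)
    qed
    also have "\<dots> = (2 * l2_inner (X (t + h)) g - 2 * l2_inner (X t) g) + h\<^sup>2 * N h"
      unfolding l2_inner_MO N_def using int int2 by simp
    finally show ?case using elim by (simp add: field_simps power2_eq_square)
  qed
  ultimately have "((\<lambda>h. (seg_int (\<lambda>m. (X (t + h) m)\<^sup>2) p q - seg_int (\<lambda>m. (X t m)\<^sup>2) p q) / h)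
      \<longlongrightarrow> 2 * l2_inner (V t) g + 0) (at 0)"
    by (rule Lim_transform_eventually)
  moreover have "l2_inner (V t) g = seg_int (\<lambda>m. X t m * V t m) p q"
    unfolding seg_int_def l2_inner_MO g_def I_def by (simp add: mult_ac)
  ultimately show ?thesis unfolding DERIV_def by simp
qed

end

lemma seg_int_indicator_atLeast:
  assumes f: "f \<in> L2" and *: "0 \<le> a" "a \<le> m" "m \<le> b" "b \<le> 1"
  shows "seg_int (\<lambda>x. f x * indicator {m..} x) a b = seg_int f m b"
proof -
  have int: "integrable MO (\<lambda>x. f x * indicator {m..} x)"
    by (rule L2_mult_integrable[OF f L2_indicator]) simp
  have "seg_int (\<lambda>x. f x * indicator {m..} x) a m = seg_int (\<lambda>_. 0) a m"
    by (rule seg_int_cong) auto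
  also have "\<dots> = 0" using * by (simp add: seg_int_const)
  finally have "seg_int (\<lambda>x. f x * indicator {m..} x) a m = 0" .
  moreover have "seg_int (\<lambda>x. f x * indicator {m..} x) m b = seg_int f m b"
    by (rule seg_int_cong) auto
  ultimately show ?thesis using seg_int_add_interval[OF int *(2,3)] by simp
qed

lemma seg_int_eq_diff:
  assumes "f \<in> L2" "0 \<le> p" "p \<le> q"
  shows "seg_int f p q = seg_int f 0 q - seg_int f 0 p"
  using seg_int_add_interval[OF L2_integrable[OF assms(1)] assms(2,3)] by simp

section \<open>Momentum transfer inside a cluster\<close>

context lagrangian
begin

definition A :: "real \<Rightarrow> real" where "A m = seg_int \<Psi> 0 m"
definition B :: "real \<Rightarrow> real" where "B m = seg_int P 0 m"
text \<open>The momentum which the particles to the left of \<open>m\<close> transfer to those on the right by sticking.\<close>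

definition Z :: "real \<Rightarrow> real \<Rightarrow> real" where "Z t m = seg_int (W t) 0 m"

lemma seg_int_Psi: "0 \<le> p \<Longrightarrow> p \<le> q \<Longrightarrow> seg_int \<Psi> p q = A q - A p"
  unfolding A_def by (rule seg_int_eq_diff[OF Psi_L2])

lemma seg_int_P: "0 \<le> p \<Longrightarrow> p \<le> q \<Longrightarrow> seg_int P p q = B q - B p"
  unfolding B_def by (rule seg_int_eq_diff[OF P_L2])

lemma A_minus_B: "A m - B m = seg_int (\<lambda>x. \<Psi> x - P x) 0 m"
  by (simp add: A_def B_def seg_int_diff L2_integrable Psi_L2 P_L2)

lemma B_le_A: "0 \<le> m \<Longrightarrow> m \<le> 1 \<Longrightarrow> B m \<le> A m"
  using subdiff_primitive_nonneg[OF P_K P_subdiff, of m] A_minus_B[of m] by simp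

lemma contact:
  assumes "0 \<le> m" "m \<le> 1" "m \<notin> Omega_of P"
  shows "A m = B m"
proof -
  have "m = 0 \<or> m = 1 \<or> m \<in> Omega" using assms by (auto simp: Omega_def)
  then have "A m - B m = 0"
    unfolding A_minus_B
    using subdiff_total[OF P_K P_subdiff] subdiff_primitive_zero[OF P_K P_subdiff, of m] assms(3) by auto
  then show ?thesis by simp
qed

lemma B_convex:
  "0 \<le> x \<Longrightarrow> x < z \<Longrightarrow> z < y \<Longrightarrow> y \<le> 1 \<Longrightarrow> (B z - B x) * (y - z) \<le> (B y - B z) * (z - x)"
  using seg_int_convex[OF P_K, of x z y] by (simp add: seg_int_P)

lemma Z_nonneg: "good t \<Longrightarrow> 0 \<le> m \<Longrightarrow> m \<le> 1 \<Longrightarrow> 0 \<le> Z t m"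
  unfolding Z_def using subdiff_primitive_nonneg[OF X_K good_subdiff, of t m] good_pos[of t] by simp

lemma Z_zero:
  assumes t: "good t" and "0 \<le> m" "m \<le> 1" "m \<notin> Omega_of (X t)"
  shows "Z t m = 0"
proof -
  note sub = X_K[OF less_imp_le[OF good_pos[OF t]]] good_subdiff[OF t]
  have "m = 0 \<or> m = 1 \<or> m \<in> Omega" using assms by (auto simp: Omega_def)
  then show ?thesis
    unfolding Z_def using subdiff_total[OF sub] subdiff_primitive_zero[OF sub, of m] assms(4) by auto
qed

lemma seg_int_W: "good t \<Longrightarrow> 0 \<le> p \<Longrightarrow> p \<le> q \<Longrightarrow> seg_int (W t) p q = Z t q - Z t p"
  unfolding Z_def by (rule seg_int_eq_diff[OF W_L2])

lemma seg_int_V: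
  assumes t: "good t"
  shows "seg_int (V t) p q = seg_int \<Psi> p q - seg_int (F t) p q - seg_int (W t) p q"
proof -
  have L: "V t \<in> L2" "F t \<in> L2" using V_L2[OF t] F_L2 good_pos[OF t] by auto
  have "W t = (\<lambda>m. (\<Psi> m - F t m) - V t m)" by (auto simp: W_def)
  then have "seg_int (W t) p q = seg_int \<Psi> p q - seg_int (F t) p q - seg_int (V t) p q"
    using L Psi_L2 by (simp add: seg_int_diff L2_integrable L2_diff)
  then show ?thesis by simp
qed

lemma F_const_on:
  assumes "\<And>x. a < x \<Longrightarrow> x < b \<Longrightarrow> X t x = c"
  obtains k where "\<And>x. a < x \<Longrightarrow> x < b \<Longrightarrow> F t x = k"
  by (rule that[of "\<integral>\<omega>. Phi \<phi> (c - X t \<omega>) \<partial>MO"]) (simp add: F_def alignment_MO assms)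

text \<open>The momentum condition which keeps the interval \<open>(a, b)\<close> stuck together.\<close>

definition sticking :: "real \<Rightarrow> real \<Rightarrow> bool" where
  "sticking a b \<longleftrightarrow> (\<forall>Y\<in>K. (b - a) * seg_int (\<lambda>x. \<Psi> x * Y x) a b \<le> seg_int \<Psi> a b * seg_int Y a b)"

context
  fixes r a b :: real
  assumes r: "good r"
    and ab: "0 \<le> a" "a < b" "b \<le> 1"
    and const: "{a<..<b} \<subseteq> Omega_of (X r)" and ends: "a \<notin> Omega_of (X r)" "b \<notin> Omega_of (X r)"
begin

text \<open>At a differentiability time \<open>V\<close> is also the limit of the backward quotients, which are
  nonincreasing on \<open>(a, b)\<close> since \<open>X r\<close> is constant there.\<close>

lemma component_V:
  assumes Y: "Y \<in> K"
  shows "(b - a) * seg_int (\<lambda>x. V r x * Y x) a b \<le> seg_int (V r) a b * seg_int Y a b"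
proof -
  have r0: "0 < r" using good_pos[OF r] .
  have YL: "Y \<in> L2" by (rule K_L2[OF Y])
  obtain c where c: "\<And>x. a < x \<Longrightarrow> x < b \<Longrightarrow> X r x = c"
    using Omega_of_imp_constant[OF const ab(2)] by metis
  define k where "k = seg_int Y a b / (b - a)"
  define G where "G x = indicator {a<..<b} x * (Y x - k)" for x
  have GL: "G \<in> L2" unfolding G_def[abs_def] by (intro L2_indicator_mult L2_diff YL L2_const) simp
  have inner_G: "l2_inner f G = seg_int (\<lambda>x. f x * Y x) a b - k * seg_int f a b" if f: "f \<in> L2" for f
  proof -
    have "l2_inner f G = seg_int (\<lambda>x. f x * Y x - k * f x) a b"
      unfolding l2_inner_MO seg_int_def G_def
      by (rule Bochner_Integration.integral_cong) (auto simp: algebra_simps)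
    also have "\<dots> = seg_int (\<lambda>x. f x * Y x) a b - k * seg_int f a b"
      using L2_integrable[OF f] L2_mult_integrable[OF f YL] by (simp add: seg_int_diff seg_int_cmult)
    finally show ?thesis .
  qed
  have "l2_inner (X r) G = 0"
  proof -
    have "seg_int (\<lambda>x. X r x * Y x) a b = seg_int (\<lambda>x. c * Y x) a b" by (rule seg_int_cong) (simp add: c)
    moreover have "seg_int (X r) a b = c * (b - a)" using ab c by (intro seg_int_const_on) auto
    ultimately show ?thesis using inner_G[OF X_L2, of r] r0 ab by (simp add: seg_int_cmult k_def)
  qed
  moreover have nn: "0 \<le> l2_inner (X s) G" if s: "0 \<le> s" for s
  proof -
    have XL: "X s \<in> L2" by (rule X_L2[OF s])
    have "seg_int (X s) a b * seg_int Y a b \<le> (b - a) * seg_int (\<lambda>x. X s x * Y x) a b"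
    proof (rule Chebyshev_seg_int[OF XL YL])
      fix x y assume *: "a < x" "x < b" "a < y" "y < b"
      then have O: "x \<in> Omega" "y \<in> Omega" using ab by (auto simp: Omega_def)
      show "0 \<le> (X s x - X s y) * (Y x - Y y)"
        using X_mono[OF s O] X_mono[OF s O(2,1)] K_mono[OF Y O] K_mono[OF Y O(2,1)]
        by (cases "x \<le> y") (auto intro: mult_nonpos_nonpos mult_nonneg_nonneg)
    qed (use ab in auto)
    then show ?thesis unfolding inner_G[OF XL] k_def using ab by (simp add: field_simps)
  qed
  ultimately have "\<forall>\<^sub>F h in at_left 0. (l2_inner (X (r + h)) G - l2_inner (X r) G) / h \<le> 0"
    unfolding eventually_at_left_field
    by (intro exI[of _ "-r"]) (use r0 in \<open>auto simp: divide_nonneg_neg\<close>)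
  moreover have "((\<lambda>h. (l2_inner (X (r + h)) G - l2_inner (X r) G) / h) \<longlongrightarrow> l2_inner (V r) G) (at_left 0)"
    using inner_has_derivative[OF r GL] unfolding DERIV_def by (rule filterlim_mono) (auto simp: at_le)
  ultimately have "l2_inner (V r) G \<le> 0"
    by (intro tendsto_upperbound[of _ _ "at_left 0"]) auto
  then have "seg_int (\<lambda>x. V r x * Y x) a b \<le> k * seg_int (V r) a b" by (simp add: inner_G V_L2[OF r])
  then show ?thesis unfolding k_def using ab by (simp add: field_simps)
qed

text \<open>Freezing \<open>Y\<close> outside \<open>(a, b)\<close> localises the normal cone
  inequality: \<open>Z r\<close> vanishes at both ends, so constants contribute nothing on either
  side.\<close>

lemma component_W:
  assumes Y: "Y \<in> K"
  shows "seg_int (\<lambda>x. W r x * Y x) a b \<le> 0"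
proof -
  define E where "E x = (if x < a then Y a else if x < b then Y x else Y b)" for x
  have EK: "E \<in> K" unfolding E_def[abs_def] by (rule K_truncate[OF Y ab])
  have WL: "W r \<in> L2" by (rule W_L2[OF r])
  have int: "integrable MO (\<lambda>x. W r x * E x)" by (rule L2_mult_integrable[OF WL K_L2[OF EK]])
  have XrK: "X r \<in> K" using X_K good_pos[OF r] by simp
  have "l2_inner (W r) E = seg_int (\<lambda>x. W r x * E x) 0 1"
    by (simp add: l2_inner_MO seg_int_all)
  also have "\<dots> = seg_int (\<lambda>x. W r x * E x) 0 a + seg_int (\<lambda>x. W r x * E x) a b + seg_int (\<lambda>x. W r x * E x) b 1"
    using seg_int_add_interval[OF int, of 0 a 1] seg_int_add_interval[OF int, of a b 1] ab by simp
  also have "seg_int (\<lambda>x. W r x * E x) 0 a = seg_int (\<lambda>x. Y a * W r x) 0 a"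
    by (rule seg_int_cong) (simp add: E_def)
  also have "\<dots> = 0" using Z_zero[OF r _ _ ends(1)] ab by (simp add: seg_int_cmult Z_def)
  also have "seg_int (\<lambda>x. W r x * E x) b 1 = seg_int (\<lambda>x. Y b * W r x) b 1"
    by (rule seg_int_cong) (use ab in \<open>simp add: E_def\<close>)
  also have "\<dots> = 0"
    using seg_int_W[OF r, of b 1] Z_zero[OF r _ _ ends(2)] subdiff_total[OF XrK good_subdiff[OF r]] ab
    by (simp add: seg_int_cmult Z_def)
  also have "seg_int (\<lambda>x. W r x * E x) a b = seg_int (\<lambda>x. W r x * Y x) a b"
    by (rule seg_int_cong) (simp add: E_def)
  finally show ?thesis using subdiff_K_le[OF XrK good_subdiff[OF r] EK] by simp
qed

text \<open>On the cluster \<open>F r\<close> is constant, so there \<Psi> is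
  \<open>V r + W r\<close> plus a constant, and constants give equality. The \<open>W\<close> term
  is kept, because for a step function \<open>Y\<close> it equals minus the transferred
  momentum.\<close>

lemma component_Psi:
  assumes Y: "Y \<in> K"
  shows "(b - a) * (seg_int (\<lambda>x. \<Psi> x * Y x) a b - seg_int (\<lambda>x. W r x * Y x) a b) \<le> seg_int \<Psi> a b * seg_int Y a b"
proof -
  have YL: "Y \<in> L2" by (rule K_L2[OF Y])
  obtain c where c: "\<And>x. a < x \<Longrightarrow> x < b \<Longrightarrow> X r x = c"
    using Omega_of_imp_constant[OF const ab(2)] by metis
  obtain k where k: "\<And>x. a < x \<Longrightarrow> x < b \<Longrightarrow> F r x = k"
    using F_const_on[OF c] by metis
  note int = L2_mult_integrable[OF V_L2[OF r] YL] L2_mult_integrable[OF W_L2[OF r] YL] L2_integrable[OF YL]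
  have "seg_int (\<lambda>x. \<Psi> x * Y x) a b = seg_int (\<lambda>x. (V r x * Y x + W r x * Y x) + k * Y x) a b"
  proof (rule seg_int_cong)
    fix x assume "a < x" "x < b"
    then show "\<Psi> x * Y x = (V r x * Y x + W r x * Y x) + k * Y x"
      using k[of x] by (simp add: W_def algebra_simps)
  qed
  also have "\<dots> = seg_int (\<lambda>x. V r x * Y x) a b + seg_int (\<lambda>x. W r x * Y x) a b + k * seg_int Y a b"
    using int by (simp add: seg_int_add seg_int_cmult)
  finally have 1: "seg_int (\<lambda>x. \<Psi> x * Y x) a b - seg_int (\<lambda>x. W r x * Y x) a b
      = seg_int (\<lambda>x. V r x * Y x) a b + k * seg_int Y a b" by simp
  have "seg_int (F r) a b = k * (b - a)" using ab k by (intro seg_int_const_on) auto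
  moreover have "seg_int (W r) a b = 0"
    using seg_int_W[OF r, of a b] Z_zero[OF r _ _ ends(1)] Z_zero[OF r _ _ ends(2)] ab by simp
  ultimately have 2: "seg_int \<Psi> a b = seg_int (V r) a b + k * (b - a)" using seg_int_V[OF r, of a b] by simp
  show ?thesis unfolding 1 2 using component_V[OF Y] by (simp add: algebra_simps)
qed

lemma component_sticking: "sticking a b"
  unfolding sticking_def
proof
  fix Y assume Y: "Y \<in> K"
  have "(b - a) * seg_int (\<lambda>x. W r x * Y x) a b \<le> 0"
    using component_W[OF Y] ab by (simp add: mult_nonneg_nonpos)
  then show "(b - a) * seg_int (\<lambda>x. \<Psi> x * Y x) a b \<le> seg_int \<Psi> a b * seg_int Y a b"
    using component_Psi[OF Y] by (simp add: right_diff_distrib)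
qed

text \<open>Obtained by testing with the step at \<open>m\<close>. Divided by \<open>b - a\<close>,
  the inequality says that \<open>A m - Z r m\<close> lies on or above the chord of \<open>A\<close>
  over \<open>(a, b)\<close>.\<close>

lemma component_chord:
  assumes m: "a < m" "m < b"
  shows "(b - a) * (A b - A m + Z r m) \<le> (A b - A a) * (b - m)"
proof -
  have "seg_int (indicator {m..}) a b = seg_int (\<lambda>x. 1 * indicator {m..} x) a b" by simp
  also have "\<dots> = seg_int (\<lambda>_. 1) m b" by (rule seg_int_indicator_atLeast) (use m ab in auto)
  also have "\<dots> = b - m" using m ab by (simp add: seg_int_const)
  finally have 1: "seg_int (indicator {m..}) a b = b - m" .
  have 2: "seg_int (\<lambda>x. \<Psi> x * indicator {m..} x) a b = A b - A m"
    using seg_int_indicator_atLeast[OF Psi_L2, of a m b] seg_int_Psi[of m b] m ab by simp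
  have "seg_int (\<lambda>x. W r x * indicator {m..} x) a b = Z r b - Z r m"
    using seg_int_indicator_atLeast[OF W_L2[OF r], of a m b] seg_int_W[OF r, of m b] m ab by simp
  then have 3: "seg_int (\<lambda>x. W r x * indicator {m..} x) a b = - Z r m"
    using Z_zero[OF r _ _ ends(2)] ab by simp
  show ?thesis
    using component_Psi[OF K_indicator[of m]] unfolding 1 2 3 using seg_int_Psi[of a b] ab by simp
qed

end

text \<open>On a cluster, \<open>A m - Z t m\<close> is at least the chord of \<open>A\<close>,
  which is at least the chord of \<open>B\<close>, which is at least \<open>B m\<close> by
  convexity. Off the clusters \<open>Z\<close> vanishes.\<close>

lemma Z_le:
  assumes t: "good t" and m: "0 \<le> m" "m \<le> 1"
  shows "Z t m \<le> A m - B m"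
proof (cases "m \<in> Omega_of (X t)")
  case False
  then show ?thesis using Z_zero[OF t m] B_le_A[OF m] by simp
next
  case True
  obtain a b where ab: "a < m" "m < b" "{a<..<b} \<subseteq> Omega_of (X t)" "a \<notin> Omega_of (X t)"
      "b \<notin> Omega_of (X t)" "0 \<le> a" "b \<le> 1"
    using open_interval_around[OF open_Omega_of Omega_of_subset True] by metis
  have chord: "(b - a) * (A b - A m + Z t m) \<le> (A b - A a) * (b - m)"
    by (rule component_chord[OF t]) (use ab in auto)
  have conv: "(B m - B a) * (b - m) \<le> (B b - B m) * (m - a)"
    by (rule B_convex) (use ab in auto)
  have "(b - m) * B a \<le> (b - m) * A a" "(m - a) * B b \<le> (m - a) * A b"
    using ab by (auto intro!: mult_left_mono B_le_A)
  with chord conv have "(b - a) * Z t m \<le> (b - a) * (A m - B m)"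
    by (simp add: algebra_simps)
  then show ?thesis using ab by simp
qed

text \<open>\<Psi> can be replaced by \<open>P\<close> although only \<open>q\<close> is a contact
  point: the momentum entering at \<open>p\<close> is at most \<open>A p - B p\<close>, which is
  exactly how much the two primitives differ there.\<close>

lemma flux_upper:
  assumes "good t" "0 \<le> p" "p \<le> q" "q \<le> 1" "A q = B q"
  shows "seg_int (V t) p q \<le> seg_int P p q - seg_int (F t) p q"
  using seg_int_V[OF assms(1), of p q] seg_int_W[OF assms(1-3)] seg_int_Psi[OF assms(2,3)] seg_int_P[OF assms(2,3)]
    Z_le[OF assms(1), of p] Z_nonneg[OF assms(1), of q] assms by simp

lemma flux_lower:
  assumes "good t" "0 \<le> p" "p \<le> q" "q \<le> 1" "A p = B p"
  shows "seg_int P p q - seg_int (F t) p q \<le> seg_int (V t) p q"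
  using seg_int_V[OF assms(1), of p q] seg_int_W[OF assms(1-3)] seg_int_Psi[OF assms(2,3)] seg_int_P[OF assms(2,3)]
    Z_le[OF assms(1), of q] Z_nonneg[OF assms(1), of p] assms by simp

text \<open>\<open>J\<close> is a multiple of the variance of \<open>X t\<close> on
  \<open>(a, b)\<close>: nonnegative, and zero only if \<open>X t\<close> is constant there. None of
  the three terms of the velocity increases it: \<Psi> by \<open>sticking\<close>, \<open>F\<close>
  because it is monotone in the position, and \<open>W\<close> because moving \<open>X\<close> to
  its mean on \<open>(a, b)\<close> stays in \<open>K\<close>.\<close>

lemma sticky:
  assumes Q: "sticking a b" and ab: "0 \<le> a" "a < b" "b \<le> 1" and st: "0 \<le> s" "s \<le> t"
    and const: "{a<..<b} \<subseteq> Omega_of (X s)"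
  shows "{a<..<b} \<subseteq> Omega_of (X t)"
proof -
  define J where "J t = (b - a) * seg_int (\<lambda>m. (X t m)\<^sup>2) a b - (seg_int (X t) a b)\<^sup>2" for t
  have Jdom: "dominated J"
    unfolding J_def[abs_def]
    by (intro dominated_diff dominated_cmult dominated_square dominated_seg_int dominated_seg_int_square)
  have J': "\<exists>f'\<le>0. (J has_real_derivative f') (at r)" if r: "good r" for r
  proof -
    have r0: "0 \<le> r" using good_pos[OF r] by simp
    have XK: "X r \<in> K" and XL: "X r \<in> L2" using X_K[OF r0] K_L2 by auto
    have FL: "F r \<in> L2" and WL: "W r \<in> L2"
      using F_L2[OF r0] W_L2[OF r] by auto
    have inner: "x \<in> Omega" if "a < x" "x < b" for x using that ab by (auto simp: Omega_def)
    define k where "k = seg_int (X r) a b / (b - a)"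
    have k: "seg_int (X r) a b = k * (b - a)" using ab by (simp add: k_def)
    have Psi: "(b - a) * seg_int (\<lambda>x. \<Psi> x * X r x) a b \<le> seg_int \<Psi> a b * seg_int (X r) a b"
      using Q XK by (simp add: sticking_def)
    have Fcheb: "seg_int (F r) a b * seg_int (X r) a b \<le> (b - a) * seg_int (\<lambda>x. F r x * X r x) a b"
    proof (rule Chebyshev_seg_int[OF FL XL])
      fix x y assume "a < x" "x < b" "a < y" "y < b"
      show "0 \<le> (F r x - F r y) * (X r x - X r y)"
        unfolding F_def using alignment_mono[OF protocol XL, of x y] alignment_mono[OF protocol XL, of y x]
        by (cases "X r x \<le> X r y") (auto intro: mult_nonpos_nonpos mult_nonneg_nonneg)
    qed (use ab in auto)
    \<comment> \<open>The mean \<open>k\<close> lies between the values of \<open>X r\<close> on the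
      two sides, so replacing \<open>X r\<close> by \<open>k\<close> on \<open>[a, b)\<close> keeps
      it nondecreasing and the difference \<open>E\<close> is an admissible direction.\<close>
    have Wneg: "seg_int (W r) a b * seg_int (X r) a b \<le> (b - a) * seg_int (\<lambda>x. W r x * X r x) a b"
    proof -
      have lo: "X r x \<le> k" if x: "x \<in> Omega" "x < a" for x
      proof -
        have "X r x * (b - a) \<le> seg_int (X r) a b"
          by (rule seg_int_lower[OF XL]) (use ab x inner in \<open>auto intro!: K_mono[OF XK]\<close>)
        then show ?thesis unfolding k using ab by simp
      qed
      have hi: "k \<le> X r x" if x: "x \<in> Omega" "b \<le> x" for x
      proof -
        have "seg_int (X r) a b \<le> X r x * (b - a)"
          by (rule seg_int_upper[OF XL]) (use ab x inner in \<open>auto intro!: K_mono[OF XK]\<close>)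
        then show ?thesis unfolding k using ab by simp
      qed
      define E where "E x = (if a \<le> x \<and> x < b then k else X r x) - X r x" for x
      have flat: "(\<lambda>x. if a \<le> x \<and> x < b then k else X r x) \<in> K"
        by (rule K_flatten[OF XK lo hi])
      then have EL: "E \<in> L2" unfolding E_def[abs_def] by (intro L2_diff XL K_L2)
      have "(\<lambda>x. X r x + E x) \<in> K" using flat by (simp add: E_def)
      from subdiff_cone[OF XK good_subdiff[OF r] this] have "l2_inner (W r) E \<le> 0" .
      also have "l2_inner (W r) E = seg_int (\<lambda>x. W r x * E x) 0 a + seg_int (\<lambda>x. W r x * E x) a b + seg_int (\<lambda>x. W r x * E x) b 1"
        using seg_int_add_interval[OF L2_mult_integrable[OF WL EL], of 0 a 1]
          seg_int_add_interval[OF L2_mult_integrable[OF WL EL], of a b 1] ab by (simp add: l2_inner_MO seg_int_all)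
      also have "seg_int (\<lambda>x. W r x * E x) 0 a = seg_int (\<lambda>_. 0) 0 a" by (rule seg_int_cong) (simp add: E_def)
      also have "seg_int (\<lambda>x. W r x * E x) b 1 = seg_int (\<lambda>_. 0) b 1" by (rule seg_int_cong) (simp add: E_def)
      also have "seg_int (\<lambda>x. W r x * E x) a b = seg_int (\<lambda>x. k * W r x - W r x * X r x) a b"
        by (rule seg_int_cong) (simp add: E_def algebra_simps)
      also have "\<dots> = k * seg_int (W r) a b - seg_int (\<lambda>x. W r x * X r x) a b"
        using L2_integrable[OF WL] L2_mult_integrable[OF WL XL] by (simp add: seg_int_diff seg_int_cmult)
      finally have "k * seg_int (W r) a b \<le> seg_int (\<lambda>x. W r x * X r x) a b"
        using ab by (simp add: seg_int_const)
      then show ?thesis unfolding k using ab by (simp add: mult.commute mult_left_mono mult.left_commute)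
    qed
    have "((\<lambda>t. (b - a) * seg_int (\<lambda>m. (X t m)\<^sup>2) a b - (seg_int (X t) a b)\<^sup>2) has_real_derivative
        (b - a) * (2 * seg_int (\<lambda>m. X r m * V r m) a b) - 2 * seg_int (X r) a b * seg_int (V r) a b) (at r)"
      by (auto intro!: derivative_eq_intros seg_int_square_has_derivative[OF r] seg_int_has_derivative[OF r])
    moreover have "(b - a) * seg_int (\<lambda>m. X r m * V r m) a b \<le> seg_int (X r) a b * seg_int (V r) a b"
    proof -
      have "seg_int (\<lambda>m. X r m * V r m) a b = seg_int (\<lambda>m. (\<Psi> m * X r m - F r m * X r m) - W r m * X r m) a b"
        by (rule seg_int_cong) (simp add: W_def algebra_simps)
      also have "\<dots> = seg_int (\<lambda>x. \<Psi> x * X r x) a b - seg_int (\<lambda>x. F r x * X r x) a b - seg_int (\<lambda>x. W r x * X r x) a b"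
        using L2_mult_integrable[OF Psi_L2 XL] L2_mult_integrable[OF FL XL] L2_mult_integrable[OF WL XL]
        by (simp add: seg_int_diff)
      finally have eq: "seg_int (\<lambda>m. X r m * V r m) a b = seg_int (\<lambda>x. \<Psi> x * X r x) a b
          - seg_int (\<lambda>x. F r x * X r x) a b - seg_int (\<lambda>x. W r x * X r x) a b" .
      show ?thesis
        unfolding eq seg_int_V[OF r, of a b] using Psi Fcheb Wneg by (simp add: algebra_simps)
    qed
    ultimately show ?thesis unfolding J_def[abs_def] by (intro exI conjI) auto
  qed
  have "J t - J s \<le> 0 * (t - s)"
    by (rule dominated_increment_le[OF Jdom st])
      (use AE_good in \<open>eventually_elim, use J' st in auto\<close>)
  moreover have "J s = 0"
  proof -
    obtain c where c: "\<And>x. a < x \<Longrightarrow> x < b \<Longrightarrow> X s x = c"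
      using Omega_of_imp_constant[OF const ab(2)] by metis
    have "seg_int (X s) a b = c * (b - a)" using ab c by (intro seg_int_const_on) auto
    moreover have "seg_int (\<lambda>m. (X s m)\<^sup>2) a b = c\<^sup>2 * (b - a)" using ab c by (intro seg_int_const_on) auto
    ultimately show ?thesis by (simp add: J_def power2_eq_square)
  qed
  moreover have t0: "0 \<le> t" using st by simp
  have "0 \<le> J t"
  proof -
    have "seg_int (X t) a b * seg_int (X t) a b \<le> (b - a) * seg_int (\<lambda>x. X t x * X t x) a b"
      by (rule Chebyshev_seg_int) (use X_L2[OF t0] ab in auto)
    then show ?thesis by (simp add: J_def power2_eq_square)
  qed
  ultimately have "(b - a) * seg_int (\<lambda>m. (X t m)\<^sup>2) a b = (seg_int (X t) a b)\<^sup>2" by (simp add: J_def)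
  from seg_int_AE_const[OF X_L2[OF t0] ab this]
  have "\<And>x. a < x \<Longrightarrow> x < b \<Longrightarrow> X t x = seg_int (X t) a b / (b - a)"
    using K_AE_const[OF X_K[OF t0] ab(1,3)] by blast
  then show ?thesis by (rule constant_imp_Omega_of[OF ab(1,3)])
qed

lemma sticky_good:
  assumes s: "good s" and "s \<le> t"
  shows "Omega_of (X s) \<subseteq> Omega_of (X t)"
proof
  fix m assume "m \<in> Omega_of (X s)"
  then obtain a b where ab: "a < m" "m < b" "{a<..<b} \<subseteq> Omega_of (X s)" "a \<notin> Omega_of (X s)"
      "b \<notin> Omega_of (X s)" "0 \<le> a" "b \<le> 1"
    using open_interval_around[OF open_Omega_of Omega_of_subset] by metis
  then have "sticking a b" by (intro component_sticking[OF s]) auto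
  from sticky[OF this _ _ _ _ assms(2) ab(3)] have "{a<..<b} \<subseteq> Omega_of (X t)"
    using ab good_pos[OF s] by auto
  then show "m \<in> Omega_of (X t)" using ab by auto
qed

text \<open>Both parts of the natural velocity are constant on an initial cluster:
  \<open>Vbar\<close> by \<open>H_of\<close>, and the alignment part because it depends on the
  position only.\<close>

lemma Psi_const_initial:
  assumes ab: "0 \<le> a" "a < b" "b \<le> 1" and const: "{a<..<b} \<subseteq> Omega_of Xbar"
  obtains k where "AE x in lborel. a < x \<and> x < b \<longrightarrow> \<Psi> x = k"
proof -
  obtain c where c: "\<And>x. a < x \<Longrightarrow> x < b \<Longrightarrow> Xbar x = c"
    using Omega_of_imp_constant[OF const ab(2)] by metis
  obtain v where "AE m in lborel. m \<in> {a<..<b} \<longrightarrow> Vbar m = v"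
    using Vbar_H const is_interval_oo[of a b] unfolding H_of_def by blast
  then have "AE x in lborel. a < x \<and> x < b \<longrightarrow> \<Psi> x = v + (\<integral>\<omega>. Phi \<phi> (c - Xbar \<omega>) \<partial>MO)"
    by eventually_elim (simp add: \<Psi>_def natural_velocity_def alignment_MO c)
  then show thesis by (rule that)
qed

lemma Psi_const_sticking:
  assumes ab: "0 \<le> a" "a < b" "b \<le> 1" and k: "AE x in lborel. a < x \<and> x < b \<longrightarrow> \<Psi> x = k"
  shows "sticking a b"
  unfolding sticking_def
proof
  fix Y assume "Y \<in> K"
  then have YL: "Y \<in> L2" by (rule K_L2)
  have m: "\<Psi> \<in> borel_measurable MO" "Y \<in> borel_measurable MO" using Psi_L2 YL by (auto simp: L2_iff)
  have "seg_int (\<lambda>x. \<Psi> x * Y x) a b = seg_int (\<lambda>x. k * Y x) a b"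
    by (rule seg_int_cong_AE) (use m k in \<open>auto elim!: eventually_mono\<close>)
  moreover have "seg_int \<Psi> a b = seg_int (\<lambda>_. k) a b"
    by (rule seg_int_cong_AE) (use m k in auto)
  ultimately show "(b - a) * seg_int (\<lambda>x. \<Psi> x * Y x) a b \<le> seg_int \<Psi> a b * seg_int Y a b"
    using ab by (simp add: seg_int_cmult seg_int_const)
qed

lemma Omega_of_X0: "Omega_of (X 0) = Omega_of Xbar"
  by (rule Omega_of_cong) (rule X_0)

text \<open>Time 0 is not a \<open>good\<close> time and has no backward quotients; here
  \<open>sticking\<close> comes from \<Psi> being constant.\<close>

lemma sticky_initial:
  assumes "0 \<le> t"
  shows "Omega_of Xbar \<subseteq> Omega_of (X t)"
proof
  fix m assume "m \<in> Omega_of Xbar"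
  then obtain a b where ab: "a < m" "m < b" "{a<..<b} \<subseteq> Omega_of Xbar" "0 \<le> a" "b \<le> 1"
    using open_interval_around[OF open_Omega_of Omega_of_subset] by metis
  then obtain k where "AE x in lborel. a < x \<and> x < b \<longrightarrow> \<Psi> x = k"
    using Psi_const_initial[of a b] by auto
  then have "sticking a b" using ab by (intro Psi_const_sticking) auto
  from sticky[OF this _ _ _ _ assms] have "{a<..<b} \<subseteq> Omega_of (X t)"
    using ab by (auto simp: Omega_of_X0)
  then show "m \<in> Omega_of (X t)" using ab by auto
qed

end

section \<open>Gaps between mean positions\<close>

definition mean :: "(real \<Rightarrow> real) \<Rightarrow> real \<Rightarrow> real \<Rightarrow> real" where
  "mean f p q = seg_int f p q / (q - p)"

lemma mean_lower:
  assumes "f \<in> L2" "0 \<le> p" "p < q" "q \<le> 1" "\<And>x. p < x \<Longrightarrow> x < q \<Longrightarrow> c \<le> f x"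
  shows "c \<le> mean f p q"
  unfolding mean_def using seg_int_lower[of f p q c] assms by (simp add: pos_le_divide_eq)

lemma mean_upper:
  assumes "f \<in> L2" "0 \<le> p" "p < q" "q \<le> 1" "\<And>x. p < x \<Longrightarrow> x < q \<Longrightarrow> f x \<le> c"
  shows "mean f p q \<le> c"
  unfolding mean_def using seg_int_upper[of f p q c] assms by (simp add: pos_divide_le_eq)

lemma mean_diff_cmult:
  assumes "f \<in> L2" "g \<in> L2"
  shows "mean (\<lambda>x. f x - k * g x) p q = mean f p q - k * mean g p q"
  unfolding mean_def using assms
  by (simp add: seg_int_diff seg_int_cmult L2_integrable L2_cmult diff_divide_distrib)

text \<open>A pointwise bound that is affine in the difference survives independent averaging over
  the two intervals. Bounds in terms of \<Phi> are therefore first replaced by lines: tangents from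
  above, chords from below.\<close>

lemma mean_gap_le:
  assumes f: "f \<in> L2" and g: "g \<in> L2" and *: "0 \<le> p" "p < b" "b' < q" "q \<le> 1" "b \<le> b'"
    and le: "\<And>x y. p < x \<Longrightarrow> x < b \<Longrightarrow> b' < y \<Longrightarrow> y < q \<Longrightarrow> f y - f x \<le> c + k * (g y - g x)"
  shows "mean f b' q - mean f p b \<le> c + k * (mean g b' q - mean g p b)"
proof -
  define h where "h x = f x - k * g x" for x
  have h: "h \<in> L2" unfolding h_def[abs_def] using f g by (intro L2_diff L2_cmult)
  have "mean h b' q - c \<le> mean h p b"
  proof (rule mean_lower[OF h])
    fix x assume x: "p < x" "x < b"
    have "mean h b' q \<le> c + h x"
      by (rule mean_upper[OF h]) (use le[OF x] * in \<open>auto simp: h_def algebra_simps\<close>)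
    then show "mean h b' q - c \<le> h x" by simp
  qed (use * in auto)
  then show ?thesis
    unfolding h_def[abs_def] mean_diff_cmult[OF f g] by (simp add: algebra_simps)
qed

lemma K_mean_le:
  assumes X: "X \<in> K" and "0 \<le> p" "p < b" "b \<le> 1" "y \<in> Omega" "b \<le> y"
  shows "mean X p b \<le> X y"
  by (rule mean_upper[OF K_L2[OF X]]) (use assms in \<open>auto intro!: K_mono[OF X] simp: Omega_def\<close>)

lemma K_mean_ge:
  assumes X: "X \<in> K" and "0 \<le> b" "b < q" "q \<le> 1" "y \<in> Omega" "y \<le> b"
  shows "X y \<le> mean X b q"
  by (rule mean_lower[OF K_L2[OF X]]) (use assms in \<open>auto intro!: K_mono[OF X] simp: Omega_def\<close>)

lemma K_mean_less_upper:
  assumes X: "X \<in> K" and *: "0 \<le> p" "p < x" "x < b" "b \<le> 1" and c: "\<And>z. p < z \<Longrightarrow> z < b \<Longrightarrow> X z \<le> c"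
    and x: "X x < c"
  shows "mean X p b < c"
proof -
  have "seg_int X p b = seg_int X p x + seg_int X x b"
    by (rule seg_int_add_interval) (use * in \<open>auto intro: L2_integrable K_L2[OF X]\<close>)
  also have "seg_int X p x \<le> X x * (x - p)"
    by (rule seg_int_upper[OF K_L2[OF X]]) (use * in \<open>auto intro!: K_mono[OF X] simp: Omega_def\<close>)
  also have "seg_int X x b \<le> c * (b - x)"
    by (rule seg_int_upper[OF K_L2[OF X]]) (use * c in auto)
  also have "X x * (x - p) + c * (b - x) < c * (x - p) + c * (b - x)"
    using x * by simp
  also have "\<dots> = c * (b - p)" by (simp add: algebra_simps)
  finally show ?thesis unfolding mean_def using * by (simp add: pos_divide_less_eq)
qed

lemma K_mean_greater_lower:
  assumes X: "X \<in> K" and *: "0 \<le> b" "b < x" "x < q" "q \<le> 1" and c: "\<And>z. b < z \<Longrightarrow> z < q \<Longrightarrow> c \<le> X z"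
    and x: "c < X x"
  shows "c < mean X b q"
proof -
  have "c * (q - b) = c * (x - b) + c * (q - x)" by (simp add: algebra_simps)
  also have "\<dots> < c * (x - b) + X x * (q - x)" using x * by simp
  also have "c * (x - b) \<le> seg_int X b x"
    by (rule seg_int_lower[OF K_L2[OF X]]) (use * c in auto)
  also have "X x * (q - x) \<le> seg_int X x q"
    by (rule seg_int_lower[OF K_L2[OF X]]) (use * in \<open>auto intro!: K_mono[OF X] simp: Omega_def\<close>)
  also have "seg_int X b x + seg_int X x q = seg_int X b q"
    by (rule seg_int_add_interval[symmetric]) (use * in \<open>auto intro: L2_integrable K_L2[OF X]\<close>)
  finally show ?thesis unfolding mean_def using * by (simp add: pos_less_divide_eq)
qed

text \<open>Right-continuity at \<open>p\<close> turns the strict inequality at a single point into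
  one on a set of positive measure.\<close>

lemma K_mean_less_left:
  assumes X: "X \<in> K" and pb: "p \<in> Omega" "b \<in> Omega" "X p < X b"
  shows "mean X p b < X b"
proof -
  have "p < b" using K_mono[OF X pb(2,1)] pb(3) by (meson not_less)
  have "\<forall>\<^sub>F x in at_right p. X x < X b" by (rule order_tendstoD(2)[OF K_right[OF X pb(1)] pb(3)])
  moreover have "\<forall>\<^sub>F x in at_right p. x < b" using \<open>p < b\<close> by (auto simp: eventually_at_right_field)
  moreover have "\<forall>\<^sub>F x in at_right p. p < x" by (simp add: eventually_at_right_less)
  ultimately have "\<forall>\<^sub>F x in at_right p. X x < X b \<and> x < b \<and> p < x" by eventually_elim simp
  then obtain x where "X x < X b" "x < b" "p < x"
    using eventually_happens[of _ "at_right p"] by force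
  then show ?thesis
    by (intro K_mean_less_upper[OF X, of p x b]) (use pb in \<open>auto intro!: K_mono[OF X] simp: Omega_def\<close>)
qed

text \<open>\<open>X b\<close> separates the two means, and a point of \<open>(p, q)\<close> where
  \<open>X\<close> differs from \<open>X b\<close> makes the comparison strict on its own
  side.\<close>

lemma K_mean_less:
  assumes X: "X \<in> K" and *: "0 \<le> p" "p < b" "b < q" "q \<le> 1" and nc: "\<not> {p<..<q} \<subseteq> Omega_of X"
  shows "mean X p b < mean X b q"
proof -
  have b: "b \<in> Omega" using * by (auto simp: Omega_def)
  have le: "mean X p b \<le> X b" "X b \<le> mean X b q"
    using K_mean_le[OF X _ _ _ b] K_mean_ge[OF X _ _ _ b] * by auto
  have "\<exists>x. p < x \<and> x < q \<and> X x \<noteq> X b"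
    using nc constant_imp_Omega_of[of p q X "X b"] * by auto
  then obtain x where x: "p < x" "x < q" "X x \<noteq> X b" by blast
  have xO: "x \<in> Omega" using x * by (auto simp: Omega_def)
  show ?thesis
  proof (cases "x < b")
    case True
    have "mean X p b < X b"
      by (rule K_mean_less_upper[OF X, of p x b])
        (use True x * K_mono[OF X xO b] in \<open>auto intro!: K_mono[OF X] simp: Omega_def\<close>)
    with le show ?thesis by simp
  next
    case False
    with x have "b < x" by (cases "x = b") auto
    then have "X b < mean X b q"
      by (intro K_mean_greater_lower[OF X, of b x q])
        (use x * K_mono[OF X b xO] in \<open>auto intro!: K_mono[OF X] simp: Omega_def\<close>)
    with le show ?thesis by simp
  qed
qed

lemma interval_subset_Omega:
  assumes "a < b" "{a<..<b} \<subseteq> Omega"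
  shows "0 \<le> a" "b \<le> 1"
proof -
  show "0 \<le> a"
  proof (rule ccontr)
    assume "\<not> 0 \<le> a"
    then have "a < min b 0" using assms(1) by simp
    then obtain x where "a < x" "x < min b 0" using dense by blast
    with assms(2) show False by (auto simp: Omega_def)
  qed
  show "b \<le> 1"
  proof (rule ccontr)
    assume "\<not> b \<le> 1"
    then have "max a 1 < b" using assms(1) by simp
    then obtain x where "max a 1 < x" "x < b" using dense by blast
    with assms(2) show False by (auto simp: Omega_def)
  qed
qed

section \<open>Evolution of the gaps\<close>

context lagrangian
begin

text \<open>Used with \<open>b \<le> b'\<close>. Means are differentiable in time where values need
  not be, and the gap lies between the difference of the values at the inner ends \<open>b\<close>,
  \<open>b'\<close> and that at the outer ends \<open>p\<close>, \<open>q\<close>, as far as these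
  lie in \<Omega>.\<close>

definition gap :: "real \<Rightarrow> real \<Rightarrow> real \<Rightarrow> real \<Rightarrow> real \<Rightarrow> real" where
  "gap p b b' q t = mean (X t) b' q - mean (X t) p b"

definition gap_speed :: "real \<Rightarrow> real \<Rightarrow> real \<Rightarrow> real \<Rightarrow> real \<Rightarrow> real" where
  "gap_speed p b b' q t = mean (V t) b' q - mean (V t) p b"

lemma dominated_gap: "dominated (gap p b b' q)"
proof -
  have "gap p b b' q = (\<lambda>t. inverse (q - b') * seg_int (X t) b' q - inverse (b - p) * seg_int (X t) p b)"
    by (auto simp: gap_def mean_def field_simps)
  then show ?thesis by (simp only: dominated_diff dominated_cmult dominated_seg_int)
qed

lemma gap_has_derivative: "good t \<Longrightarrow> (gap p b b' q has_real_derivative gap_speed p b b' q t) (at t)"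
  unfolding gap_def[abs_def] gap_speed_def mean_def
  by (intro DERIV_diff DERIV_cdivide seg_int_has_derivative)

lemma gap_increment_le:
  assumes "0 \<le> s" "s \<le> t" "\<And>r. good r \<Longrightarrow> s < r \<Longrightarrow> r < t \<Longrightarrow> gap_speed p b b' q r \<le> \<kappa>"
  shows "gap p b b' q t - gap p b b' q s \<le> \<kappa> * (t - s)"
proof (rule dominated_increment_le[OF dominated_gap assms(1,2)])
  show "AE r in lborel. s < r \<and> r < t \<longrightarrow> (\<exists>f'\<le>\<kappa>. (gap p b b' q has_real_derivative f') (at r))"
    using AE_good
  proof eventually_elim
    case (elim r)
    show ?case
    proof
      assume *: "s < r \<and> r < t"
      with elim assms(1) have "good r" by simp
      with assms(3)[OF this] gap_has_derivative[OF this] *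
      show "\<exists>f'\<le>\<kappa>. (gap p b b' q has_real_derivative f') (at r)" by blast
    qed
  qed
qed

lemma gap_barrier:
  assumes "0 \<le> s" "s \<le> t"
    "\<And>r. good r \<Longrightarrow> s < r \<Longrightarrow> r < t \<Longrightarrow> gap p b b' q r \<le> d \<Longrightarrow> \<kappa> \<le> gap_speed p b b' q r"
  shows "gap p b b' q s + \<kappa> * (t - s) \<le> gap p b b' q t \<or>
    (\<exists>r\<in>{s..t}. d \<le> gap p b b' q r \<and> d + \<kappa> * (t - r) \<le> gap p b b' q t)"
proof (rule dominated_barrier[OF dominated_gap assms(1,2)])
  show "AE r in lborel. s < r \<and> r < t \<and> gap p b b' q r \<le> d \<longrightarrow>
      (\<exists>f'\<ge>\<kappa>. (gap p b b' q has_real_derivative f') (at r))"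
    using AE_good
  proof eventually_elim
    case (elim r)
    show ?case
    proof
      assume *: "s < r \<and> r < t \<and> gap p b b' q r \<le> d"
      with elim assms(1) have "good r" by simp
      with assms(3)[OF this] gap_has_derivative[OF this] *
      show "\<exists>f'\<ge>\<kappa>. (gap p b b' q has_real_derivative f') (at r)" by blast
    qed
  qed
qed

lemma gap_le:
  assumes "0 \<le> t" "0 \<le> p" "p < b" "b' < q" "q \<le> 1" "b \<le> b'"
    "x \<in> Omega" "y \<in> Omega" "x \<le> p" "q \<le> y"
  shows "gap p b b' q t \<le> X t y - X t x"
  using K_mean_le[OF X_K, of t b' q y] K_mean_ge[OF X_K, of t p b x] assms by (simp add: gap_def)

lemma gap_ge:
  assumes "0 \<le> t" "0 \<le> p" "p < b" "b' < q" "q \<le> 1" "b \<le> b'"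
    "x \<in> Omega" "y \<in> Omega" "b \<le> x" "y \<le> b'"
  shows "X t y - X t x \<le> gap p b b' q t"
  using K_mean_le[OF X_K, of t p b x] K_mean_ge[OF X_K, of t b' q y] assms by (simp add: gap_def)

lemma gap_nonneg:
  assumes "0 \<le> t" "0 \<le> p" "p < b" "b' < q" "q \<le> 1" "b \<le> b'"
  shows "0 \<le> gap p b b' q t"
  using gap_ge[OF assms, of b b] assms by (auto simp: Omega_def)

lemma gap_upper:
  assumes "0 \<le> t" "0 \<le> p" "p < b" "b' < q" "q \<le> 1" "b \<le> b'"
    "\<And>x y. p < x \<Longrightarrow> x < b \<Longrightarrow> b' < y \<Longrightarrow> y < q \<Longrightarrow> X t y - X t x \<le> c"
  shows "gap p b b' q t \<le> c"
  using mean_gap_le[OF X_L2 L2_const, of t p b b' q c 0 0] assms by (simp add: gap_def)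

lemma F_mono: "0 \<le> t \<Longrightarrow> x \<in> Omega \<Longrightarrow> y \<in> Omega \<Longrightarrow> x \<le> y \<Longrightarrow> F t x \<le> F t y"
  unfolding F_def by (rule alignment_mono[OF protocol X_L2 X_mono])

lemma F_gap_lower:
  assumes "0 \<le> t" "0 \<le> p" "p < b" "b' < q" "q \<le> 1" "b \<le> b'"
    "\<And>x y. p < x \<Longrightarrow> x < b \<Longrightarrow> b' < y \<Longrightarrow> y < q \<Longrightarrow> c \<le> F t y - F t x"
  shows "c \<le> mean (F t) b' q - mean (F t) p b"
proof -
  have "mean (\<lambda>x. - F t x) b' q - mean (\<lambda>x. - F t x) p b \<le> - c + 0 * (mean (\<lambda>_. 0) b' q - mean (\<lambda>_. 0) p b)"
    by (rule mean_gap_le) (use assms F_L2[of t] L2_cmult[of "F t" "-1"] in \<open>auto simp: algebra_simps\<close>)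
  moreover have "mean (\<lambda>x. - F t x) u v = - mean (F t) u v" for u v
    unfolding mean_def using seg_int_cmult[of "-1" "F t" u v] by simp
  ultimately show ?thesis by simp
qed

lemma F_gap_nonneg:
  assumes "0 \<le> t" "0 \<le> p" "p < b" "b' < q" "q \<le> 1" "b \<le> b'"
  shows "0 \<le> mean (F t) b' q - mean (F t) p b"
  by (rule F_gap_lower[OF assms]) (use assms F_mono[of t] in \<open>auto simp: Omega_def\<close>)

text \<open>By concavity \<open>2 \<Phi>\<close> lies below its tangent line at \<open>d\<close>, which commutes with averaging.\<close>

lemma F_gap_upper:
  assumes *: "0 \<le> t" "0 \<le> p" "p < b" "b' < q" "q \<le> 1" "b \<le> b'" and d: "0 < d" "gap p b b' q t \<le> d"
  shows "mean (F t) b' q - mean (F t) p b \<le> 2 * Phi \<phi> d"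
proof -
  have "mean (F t) b' q - mean (F t) p b \<le> (2 * Phi \<phi> d - 2 * \<phi> d * d) + (2 * \<phi> d) * (mean (X t) b' q - mean (X t) p b)"
  proof (rule mean_gap_le)
    fix x y assume xy: "p < x" "x < b" "b' < y" "y < q"
    have "X t x \<le> X t y" using X_mono[of t x y] xy * by (auto simp: Omega_def)
    then have "F t y - F t x \<le> 2 * Phi \<phi> (X t y - X t x)" "Phi \<phi> (X t y - X t x) \<le> Phi \<phi> d + \<phi> d * (X t y - X t x - d)"
      unfolding F_def using alignment_upper[OF protocol X_L2[OF *(1)]] Phi_tangent[OF protocol d(1)] by auto
    then show "F t y - F t x \<le> (2 * Phi \<phi> d - 2 * \<phi> d * d) + 2 * \<phi> d * (X t y - X t x)"
      by (simp add: algebra_simps)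
  qed (use * F_L2 X_L2 in auto)
  also have "\<dots> = 2 * Phi \<phi> d + 2 * (\<phi> d * (gap p b b' q t - d))" by (simp add: gap_def algebra_simps)
  also have "\<phi> d * (gap p b b' q t - d) \<le> 0"
    using d phi_nonneg[OF protocol, of d] by (simp add: mult_nonneg_nonpos)
  finally show ?thesis by simp
qed

text \<open>The mass in \<open>(b, b')\<close> attracts both groups. Up to \<open>\<sigma>\<close>
  the function \<Phi> lies above its chord from 0, of slope
  \<open>Phi \<phi> \<sigma> / \<sigma>\<close>, and this linear bound can be averaged.\<close>

lemma F_gap_lower_gap:
  assumes *: "0 \<le> t" "0 \<le> p" "p < b" "b' < q" "q \<le> 1" "b \<le> b'" and s: "0 < \<sigma>"
    and bd: "\<And>x y. p < x \<Longrightarrow> x < b \<Longrightarrow> b' < y \<Longrightarrow> y < q \<Longrightarrow> X t y - X t x \<le> \<sigma>"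
  shows "(b' - b) * Phi \<phi> \<sigma> / \<sigma> * gap p b b' q t \<le> mean (F t) b' q - mean (F t) p b"
proof -
  define k where "k = (b' - b) * Phi \<phi> \<sigma> / \<sigma>"
  have "mean (\<lambda>x. k * X t x) b' q - mean (\<lambda>x. k * X t x) p b \<le> 0 + 1 * (mean (F t) b' q - mean (F t) p b)"
  proof (rule mean_gap_le)
    fix x y assume xy: "p < x" "x < b" "b' < y" "y < q"
    have O: "x \<in> Omega" "y \<in> Omega" using xy * by (auto simp: Omega_def)
    have "X t x \<le> X t y" using X_mono[OF *(1) O] xy * by auto
    moreover have "Phi \<phi> \<sigma> / \<sigma> * u \<le> Phi \<phi> u" if "0 \<le> u" "u \<le> \<sigma>" for u
      using Phi_star[OF protocol, of u \<sigma>] Phi_zero[OF protocol] that s by (cases "u = 0") (auto simp: field_simps)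
    ultimately have "Phi \<phi> \<sigma> / \<sigma> * (X t y - X t x) \<le> Phi \<phi> (X t y - X t x)" using bd[OF xy] by simp
    then have "(b' - b) * (Phi \<phi> \<sigma> / \<sigma> * (X t y - X t x)) \<le> (b' - b) * Phi \<phi> (X t y - X t x)"
      using * by (intro mult_left_mono) auto
    also have "\<dots> \<le> F t y - F t x"
      unfolding F_def by (rule alignment_lower[OF protocol X_K[OF *(1)] O]) (use xy * in auto)
    finally show "k * X t y - k * X t x \<le> 0 + 1 * (F t y - F t x)"
      by (simp add: k_def algebra_simps diff_divide_distrib)
  qed (use * F_L2 X_L2 in auto)
  moreover have "mean (\<lambda>x. k * X t x) u v = k * mean (X t) u v" for u v
    unfolding mean_def by (simp add: seg_int_cmult)
  ultimately show ?thesis by (simp add: k_def[symmetric] gap_def right_diff_distrib)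
qed

text \<open>The contact point \<open>b\<close> between the groups lets no momentum through, so
  sticking cannot drive them towards each other.\<close>

lemma gap_speed_lower:
  assumes t: "good t" and *: "0 \<le> p" "p < b" "b < q" "q \<le> 1" and c: "A b = B b"
  shows "(mean P b q - mean P p b) - (mean (F t) b q - mean (F t) p b) \<le> gap_speed p b b q t"
proof -
  have "(seg_int P b q - seg_int (F t) b q) / (q - b) \<le> seg_int (V t) b q / (q - b)"
    using flux_lower[OF t, of b q] * c by (intro divide_right_mono) auto
  moreover have "seg_int (V t) p b / (b - p) \<le> (seg_int P p b - seg_int (F t) p b) / (b - p)"
    using flux_upper[OF t, of p b] * c by (intro divide_right_mono) auto
  ultimately show ?thesis by (simp add: gap_speed_def mean_def diff_divide_distrib)
qed

text \<open>Contact at the outer ends instead: no momentum is lost there, and what passes through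
  the inner ends is at most \<open>A - B\<close>, hence absorbed when \<Psi> is replaced by
  \<open>P\<close>.\<close>

lemma gap_speed_upper:
  assumes t: "good t" and *: "0 \<le> p" "p < b" "b' < q" "q \<le> 1" "b \<le> b'" and c: "A p = B p" "A q = B q"
  shows "gap_speed p b b' q t \<le> (mean P b' q - mean P p b) - (mean (F t) b' q - mean (F t) p b)"
proof -
  have "seg_int (V t) b' q / (q - b') \<le> (seg_int P b' q - seg_int (F t) b' q) / (q - b')"
    using flux_upper[OF t, of b' q] * c by (intro divide_right_mono) auto
  moreover have "(seg_int P p b - seg_int (F t) p b) / (b - p) \<le> seg_int (V t) p b / (b - p)"
    using flux_lower[OF t, of p b] * c by (intro divide_right_mono) auto
  ultimately show ?thesis by (simp add: gap_speed_def mean_def diff_divide_distrib)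
qed

text \<open>While the gap is at most \<open>d\<close>, alignment closes it at a speed of at most
  \<open>2 * Phi \<phi> d \<le> \<delta> / 2\<close>, which is half of the opening speed guaranteed
  by \<open>P\<close>. So the gap grows at rate at least \<open>\<delta> / 2\<close> until it
  reaches \<open>d\<close>, and does not fall below \<open>d\<close> again.\<close>

lemma gap_separation:
  assumes *: "0 \<le> p" "p < b" "b < q" "q \<le> 1" and c: "A b = B b"
    and \<delta>: "\<delta> \<le> mean P b q - mean P p b" and d: "0 < d" "2 * Phi \<phi> d \<le> \<delta> / 2" and st: "0 \<le> s" "s \<le> t"
  shows "min (gap p b b q s + \<delta> / 2 * (t - s)) d \<le> gap p b b q t"
proof -
  have dn: "0 \<le> \<delta> / 2" using d Phi_nonneg[OF protocol, of d] by simp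
  have "gap p b b q s + \<delta> / 2 * (t - s) \<le> gap p b b q t \<or>
    (\<exists>r\<in>{s..t}. d \<le> gap p b b q r \<and> d + \<delta> / 2 * (t - r) \<le> gap p b b q t)"
  proof (rule gap_barrier[OF st])
    fix r assume r: "good r" "s < r" "r < t" "gap p b b q r \<le> d"
    then show "\<delta> / 2 \<le> gap_speed p b b q r"
      using gap_speed_lower[OF r(1) * c] F_gap_upper[of r p b b q d] * d \<delta> st by simp
  qed
  then show ?thesis
  proof
    assume "\<exists>r\<in>{s..t}. d \<le> gap p b b q r \<and> d + \<delta> / 2 * (t - r) \<le> gap p b b q t"
    then obtain r where "r \<le> t" "d + \<delta> / 2 * (t - r) \<le> gap p b b q t" by auto
    moreover have "0 \<le> \<delta> / 2 * (t - r)" using dn \<open>r \<le> t\<close> by (intro mult_nonneg_nonneg) auto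
    ultimately show ?thesis by simp
  qed simp
qed

text \<open>One step of the discretised Osgood argument: \<open>P\<close> never closes the gap, and
  while the gap is at most \<open>\<sigma>\<close> alignment closes it at a speed of at most
  \<open>2 * Phi \<phi> \<sigma>\<close>.\<close>

lemma gap_osgood_step:
  assumes *: "0 \<le> p" "p < b" "b < q" "q \<le> 1" and c: "A b = B b"
    and \<sigma>: "0 < \<sigma>" "\<sigma> \<le> gap p b b q s" and st: "0 \<le> s" "s \<le> t"
  shows "\<sigma> - 2 * Phi \<phi> \<sigma> * (t - s) \<le> gap p b b q t"
proof -
  have pn: "0 \<le> 2 * Phi \<phi> \<sigma>" using Phi_nonneg[OF protocol, of \<sigma>] \<sigma> by simp
  have conv: "0 \<le> mean P b q - mean P p b"
    using K_mean_le[OF P_K, of p b b] K_mean_ge[OF P_K, of b q b] * by (simp add: Omega_def)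
  have "gap p b b q s + (- 2 * Phi \<phi> \<sigma>) * (t - s) \<le> gap p b b q t \<or>
    (\<exists>r\<in>{s..t}. \<sigma> \<le> gap p b b q r \<and> \<sigma> + (- 2 * Phi \<phi> \<sigma>) * (t - r) \<le> gap p b b q t)"
  proof (rule gap_barrier[OF st])
    fix r assume r: "good r" "s < r" "r < t" "gap p b b q r \<le> \<sigma>"
    then show "- 2 * Phi \<phi> \<sigma> \<le> gap_speed p b b q r"
      using gap_speed_lower[OF r(1) * c] F_gap_upper[of r p b b q \<sigma>] * \<sigma> conv st by simp
  qed
  then show ?thesis
  proof
    assume "\<exists>r\<in>{s..t}. \<sigma> \<le> gap p b b q r \<and> \<sigma> + (- 2 * Phi \<phi> \<sigma>) * (t - r) \<le> gap p b b q t"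
    then obtain r where r: "r \<in> {s..t}" "\<sigma> + (- 2 * Phi \<phi> \<sigma>) * (t - r) \<le> gap p b b q t" by auto
    moreover have "2 * Phi \<phi> \<sigma> * (t - r) \<le> 2 * Phi \<phi> \<sigma> * (t - s)" using pn r by (intro mult_left_mono) auto
    ultimately show ?thesis by simp
  qed (use \<sigma> in simp)
qed

text \<open>Suppose \<open>P\<close> is not locally constant at \<open>z\<close>. Then
  \<open>z\<close> is a contact point, and as \<open>B\<close> stays below the affine function
  \<open>A\<close> the mean of \<open>P\<close> is at least \<open>k\<close> to the left of
  \<open>z\<close> and at most \<open>k\<close> to the right. But these means are strictly
  increasing.\<close>

lemma Psi_const_imp_P_const:
  assumes ab: "0 \<le> a" "a < b" "b \<le> 1" and k: "AE x in lborel. a < x \<and> x < b \<longrightarrow> \<Psi> x = k"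
  shows "{a<..<b} \<subseteq> Omega_of P"
proof
  fix z assume z: "z \<in> {a<..<b}"
  show "z \<in> Omega_of P"
  proof (rule ccontr)
    assume nz: "z \<notin> Omega_of P"
    then have c: "A z = B z" using contact[of z] z ab by simp
    have Alin: "seg_int \<Psi> p q = k * (q - p)" if "a \<le> p" "p \<le> q" "q \<le> b" for p q
    proof -
      have "AE x in lborel. p < x \<and> x < q \<longrightarrow> \<Psi> x = k" using k by eventually_elim (use that in simp)
      then have "seg_int \<Psi> p q = seg_int (\<lambda>_. k) p q"
        by (intro seg_int_cong_AE L2_measurable[OF Psi_L2] L2_measurable[OF L2_const])
      then show ?thesis using that ab by (simp add: seg_int_const)
    qed
    have "A z - A a = k * (z - a)" "A b - A z = k * (b - z)"
      using Alin[of a z] Alin[of z b] seg_int_Psi[of a z] seg_int_Psi[of z b] z ab by auto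
    then have "k * (z - a) \<le> B z - B a" "B b - B z \<le> k * (b - z)"
      using B_le_A[of a] B_le_A[of b] c ab by auto
    then have "k * (z - a) \<le> seg_int P a z" "seg_int P z b \<le> k * (b - z)"
      using seg_int_P[of a z] seg_int_P[of z b] z ab by auto
    then have "k \<le> mean P a z" "mean P z b \<le> k"
      unfolding mean_def using z by (simp_all add: pos_divide_le_eq pos_le_divide_eq)
    moreover have "mean P a z < mean P z b"
      by (rule K_mean_less[OF P_K]) (use z ab nz in auto)
    ultimately show False by simp
  qed
qed

lemma initial_const_imp_P_const:
  assumes "a < b" "{a<..<b} \<subseteq> Omega_of Xbar"
  shows "{a<..<b} \<subseteq> Omega_of P"
proof -
  have ab: "0 \<le> a" "b \<le> 1"
    using interval_subset_Omega[OF assms(1)] assms(2) Omega_of_subset by blast+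
  obtain k where "AE x in lborel. a < x \<and> x < b \<longrightarrow> \<Psi> x = k"
    using Psi_const_initial[OF ab(1) assms(1) ab(2) assms(2)] by blast
  then show ?thesis by (rule Psi_const_imp_P_const[OF ab(1) assms(1) ab(2)])
qed

lemma not_Omega_of_P_left:
  assumes "x \<in> Omega" "\<And>c. c \<in> Omega \<Longrightarrow> c < x \<Longrightarrow> P c < P x"
  shows "x \<notin> Omega_of P"
proof
  assume "x \<in> Omega_of P"
  then obtain a b where ab: "a < x" "x < b" "{a<..<b} \<subseteq> Omega_of P" "0 \<le> a" "b \<le> 1"
    using open_interval_around[OF open_Omega_of Omega_of_subset] by metis
  obtain c where c: "\<And>y. a < y \<Longrightarrow> y < b \<Longrightarrow> P y = c"
    using Omega_of_imp_constant[OF ab(3)] ab(1,2) by force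
  have "P ((a + x) / 2) < P x" by (rule assms(2)) (use ab assms(1) in \<open>auto simp: Omega_def\<close>)
  with c[of "(a + x) / 2"] c[of x] ab show False by simp
qed

text \<open>If \<open>P\<close> is not constant on \<open>(m', m'')\<close>, a contact point inside separates the two parts. Otherwise
  \<open>P\<close> jumps at \<open>m''\<close>, which is itself a contact point, and the right part is shrunk to \<open>m''\<close>.\<close>

lemma separation:
  assumes m: "m' \<in> Omega" "m'' \<in> Omega" "P m' < P m''"
  obtains g \<delta> d where "0 \<le> g" "Xbar m' < Xbar m'' \<Longrightarrow> 0 < g" "0 < \<delta>" "0 < d"
    "\<And>t. 0 \<le> t \<Longrightarrow> min (g + \<delta> * t) d \<le> X t m'' - X t m'"
proof -
  have less: "m' < m''" using P_mono[OF m(2,1)] m(3) by (meson not_less)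
  have m01: "0 < m'" "m'' < 1" using m by (auto simp: Omega_def)
  show thesis
  proof (cases "{m'<..<m''} \<subseteq> Omega_of P")
    case False
    then obtain b where "b \<in> {m'<..<m''}" "b \<notin> Omega_of P" by blast
    then have b: "m' < b" "b < m''" "b \<notin> Omega_of P" by simp_all
    have c: "A b = B b" by (rule contact) (use b m01 in auto)
    define \<delta> where "\<delta> = mean P b m'' - mean P m' b"
    have \<delta>: "0 < \<delta>"
      unfolding \<delta>_def using K_mean_less[OF P_K, of m' b m''] b m01 False by simp
    obtain d where d: "0 < d" "Phi \<phi> d \<le> \<delta> / 4" using Phi_small[OF protocol, of "\<delta> / 4"] \<delta> by auto
    have "\<not> {m'<..<m''} \<subseteq> Omega_of (X 0)"
      using initial_const_imp_P_const[OF less] False by (auto simp: Omega_of_X0)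
    then have g: "0 < gap m' b b m'' 0"
      unfolding gap_def using K_mean_less[OF X_K, of 0 m' b m''] b m01 by simp
    show thesis
    proof (rule that[of "gap m' b b m'' 0" "\<delta> / 2" d])
      fix t :: real assume t: "0 \<le> t"
      have "min (gap m' b b m'' 0 + \<delta> / 2 * (t - 0)) d \<le> gap m' b b m'' t"
        by (rule gap_separation) (use b m01 c d t in \<open>auto simp: \<delta>_def\<close>)
      also have "\<dots> \<le> X t m'' - X t m'"
        by (rule gap_le) (use b m01 t m in auto)
      finally show "min (gap m' b b m'' 0 + \<delta> / 2 * t) d \<le> X t m'' - X t m'" by simp
    qed (use g \<delta> d in auto)
  next
    case True
    obtain \<alpha> where \<alpha>: "\<And>x. x \<in> Omega \<Longrightarrow> m' \<le> x \<Longrightarrow> x < m'' \<Longrightarrow> P x = \<alpha>"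
      using Omega_of_imp_constant_right[OF P_K True less] by metis
    have Pm: "P m' = \<alpha>" using \<alpha>[of m'] m less by simp
    have "m'' \<notin> Omega_of P"
    proof (rule not_Omega_of_P_left[OF m(2)])
      fix c assume "c \<in> Omega" "c < m''"
      then have "P c \<le> \<alpha>" using \<alpha>[of c] P_mono[of c m'] m(1) Pm by (cases "m' \<le> c") auto
      then show "P c < P m''" using m(3) Pm by simp
    qed
    then have c: "A m'' = B m''" by (intro contact) (use m01 less in auto)
    define \<delta> where "\<delta> = P m'' - \<alpha>"
    have \<delta>: "0 < \<delta>" using m(3) Pm by (simp add: \<delta>_def)
    obtain d where d: "0 < d" "Phi \<phi> d \<le> \<delta> / 4" using Phi_small[OF protocol, of "\<delta> / 4"] \<delta> by auto
    \<comment> \<open>The value at \<open>m''\<close> is taken, not a mean over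
      \<open>(m'', q)\<close>, so that \<open>g\<close> does not depend on \<open>q\<close> and
      survives the limit in \<open>q\<close>. It may be 0 if
      \<open>Xbar m' = Xbar m''\<close>.\<close>
    define g where "g = X 0 m'' - mean (X 0) m' m''"
    have g0: "0 \<le> g"
      unfolding g_def using K_mean_le[OF X_K, of 0 m' m'' m''] m less m01 by simp
    have gpos: "0 < g" if "Xbar m' < Xbar m''"
      unfolding g_def using K_mean_less_left[OF X_K, of 0 m' m''] that m by (simp add: X_0)
    have bound: "min (g + \<delta> / 2 * t) d \<le> X t q - X t m'" if t: "0 \<le> t" and q: "m'' < q" "q < 1" for t q
    proof -
      have "mean P m' m'' \<le> \<alpha>"
        by (rule mean_upper[OF P_L2]) (use \<alpha> m less in \<open>auto simp: Omega_def\<close>)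
      moreover have "P m'' \<le> mean P m'' q" using K_mean_ge[OF P_K, of m'' q m''] q m01 less m(2) by simp
      ultimately have *: "\<delta> \<le> mean P m'' q - mean P m' m''" by (simp add: \<delta>_def)
      have "min (gap m' m'' m'' q 0 + \<delta> / 2 * (t - 0)) d \<le> gap m' m'' m'' q t"
        by (rule gap_separation) (use less q m01 c d t * in auto)
      also have "\<dots> \<le> X t q - X t m'"
        by (rule gap_le) (use less q m01 t m in \<open>auto simp: Omega_def\<close>)
      finally have "min (gap m' m'' m'' q 0 + \<delta> / 2 * t) d \<le> X t q - X t m'" by simp
      moreover have "g \<le> gap m' m'' m'' q 0"
        unfolding g_def gap_def using K_mean_ge[OF X_K, of 0 m'' q m''] q m01 less m(2) by simp
      ultimately show ?thesis by (auto simp: min_def split: if_splits)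
    qed
    show thesis
    proof (rule that[of g "\<delta> / 2" d])
      fix t :: real assume t: "0 \<le> t"
      have "((\<lambda>q. X t q - X t m') \<longlongrightarrow> X t m'' - X t m') (at_right m'')"
        by (intro tendsto_intros K_right[OF X_K[OF t] m(2)])
      moreover have "\<forall>\<^sub>F q in at_right m''. min (g + \<delta> / 2 * t) d \<le> X t q - X t m'"
        unfolding eventually_at_right_field using bound[OF t] m01 by blast
      ultimately show "min (g + \<delta> / 2 * t) d \<le> X t m'' - X t m'"
        by (intro tendsto_lowerbound[of _ _ "at_right m''"]) auto
    qed (use g0 gpos \<delta> d in auto)
  qed
qed

text \<open>For \<open>t > 0\<close> particles with different values of \<open>P\<close> are a
  positive distance apart. At \<open>t = 0\<close> that bound may be void, and the constancy of
  \<Psi> on initial clusters takes its place.\<close>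

lemma Omega_of_X_subset_P:
  assumes "0 \<le> t"
  shows "Omega_of (X t) \<subseteq> Omega_of P"
proof
  fix m assume "m \<in> Omega_of (X t)"
  then obtain a b where ab: "a < m" "m < b" "{a<..<b} \<subseteq> Omega_of (X t)" "0 \<le> a" "b \<le> 1"
    using open_interval_around[OF open_Omega_of Omega_of_subset] by metis
  have "{a<..<b} \<subseteq> Omega_of P"
  proof (cases "t = 0")
    case True
    then show ?thesis using initial_const_imp_P_const[of a b] ab by (simp add: Omega_of_X0)
  next
    case False
    obtain c where c: "\<And>x. a < x \<Longrightarrow> x < b \<Longrightarrow> X t x = c"
      using Omega_of_imp_constant[OF ab(3)] ab(1,2) by force
    have nless: "\<not> P x < P y" if xy: "a < x" "x < b" "a < y" "y < b" for x y
    proof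
      assume less: "P x < P y"
      have O: "x \<in> Omega" "y \<in> Omega" using xy ab by (auto simp: Omega_def)
      obtain g \<delta> d where s: "0 \<le> g" "0 < \<delta>" "0 < d" "\<And>t. 0 \<le> t \<Longrightarrow> min (g + \<delta> * t) d \<le> X t y - X t x"
        using separation[OF O less] by metis
      have "0 < min (g + \<delta> * t) d" using s assms False by (simp add: add_nonneg_pos)
      with s(4)[OF assms] c[of x] c[of y] xy show False by simp
    qed
    have "P x = P m" if "a < x" "x < b" for x
      using nless[of x m] nless[of m x] that ab by simp
    from constant_imp_Omega_of[OF ab(4,5) this] show ?thesis .
  qed
  then show "m \<in> Omega_of P" using ab by auto
qed

section \<open>The sets \<open>Sigma_minus\<close> and \<open>Sigma_plus\<close> in terms of
  \<open>A\<close>, \<open>B\<close> and \<open>P\<close>\<close>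

lemma envelope_eq: "0 \<le> m \<Longrightarrow> m \<le> 1 \<Longrightarrow> convex_envelope (primitive \<Psi>) m = B m"
  unfolding B_def P_def by (rule convex_envelope_eq[OF Psi_L2])

lemma primitive_eq: "m \<le> 1 \<Longrightarrow> primitive \<Psi> m = A m"
  unfolding A_def by (rule primitive_seg_int)

lemma Sigma_minus_iff: "m \<in> Sigma_minus \<Psi> \<longleftrightarrow> m \<in> Omega \<and> B m < A m"
  by (auto simp: Sigma_minus_def envelope_eq primitive_eq Omega_def)

lemma Sigma_minus_subset_P: "Sigma_minus \<Psi> \<subseteq> Omega_of P"
  using contact by (auto simp: Sigma_minus_iff Omega_def) (metis less_irrefl less_imp_le)

lemma B_affine:
  assumes ab: "0 \<le> a" "a < b" "b \<le> 1" and c: "\<And>x. a < x \<Longrightarrow> x < b \<Longrightarrow> P x = c" and m: "a \<le> m" "m \<le> b"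
  shows "B m = B a + c * (m - a)"
proof -
  have "seg_int P a m = c * (m - a)" by (rule seg_int_const_on) (use assms in auto)
  then show ?thesis using seg_int_P[of a m] ab m by simp
qed

text \<open>\<open>B\<close> is affine just to the right of \<open>m\<close> exactly if
  \<open>P\<close> is constant there: an affine \<open>B\<close> gives \<open>P\<close> equal means
  over two adjacent intervals, which a nonconstant monotone function cannot have.\<close>

lemma Sigma_plus_iff:
  assumes m: "m \<in> Omega"
  shows "m \<in> Sigma_plus \<Psi> \<longleftrightarrow> (\<forall>x\<in>Omega. m < x \<longrightarrow> P m < P x)"
proof
  assume S: "m \<in> Sigma_plus \<Psi>"
  show "\<forall>x\<in>Omega. m < x \<longrightarrow> P m < P x"
  proof (intro ballI impI, rule ccontr)
    fix x assume x: "x \<in> Omega" "m < x" "\<not> P m < P x"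
    have c: "P y = P m" if "m < y" "y < x" for y
    proof -
      have "y \<in> Omega" using m x that by (auto simp: Omega_def)
      then show ?thesis using P_mono[of m y] P_mono[of y x] m x that by auto
    qed
    have "affine_on {m..<x} (convex_envelope (primitive \<Psi>))"
      unfolding affine_on_def
    proof (intro exI ballI)
      fix y assume y: "y \<in> {m..<x}"
      then have "convex_envelope (primitive \<Psi>) y = B y" using m x by (intro envelope_eq) (auto simp: Omega_def)
      also have "\<dots> = B m + P m * (y - m)"
        by (rule B_affine[of m x]) (use c m x y in \<open>auto simp: Omega_def\<close>)
      finally show "convex_envelope (primitive \<Psi>) y = P m * y + (B m - P m * m)" by (simp add: algebra_simps)
    qed
    with S x show False by (auto simp: Sigma_plus_def Omega_def)
  qed
next
  assume less: "\<forall>x\<in>Omega. m < x \<longrightarrow> P m < P x"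
  show "m \<in> Sigma_plus \<Psi>"
    unfolding Sigma_plus_def
  proof (intro CollectI conjI allI impI notI)
    show "m \<in> {0..<1}" using m by (auto simp: Omega_def)
    fix m' assume m': "m < m' \<and> m' \<le> 1" and "affine_on {m..<m'} (convex_envelope (primitive \<Psi>))"
    then obtain u v where uv: "\<And>x. x \<in> {m..<m'} \<Longrightarrow> convex_envelope (primitive \<Psi>) x = u * x + v"
      by (auto simp: affine_on_def)
    have Buv: "B x = u * x + v" if "m \<le> x" "x < m'" for x
      using uv[of x] envelope_eq[of x] that m m' by (simp add: Omega_def)
    \<comment> \<open>The interval of affinity excludes \<open>m'\<close>, so \<open>q\<close> has
      to stay strictly below it.\<close>
    define q b where "q = (m + m') / 2" and "b = (m + q) / 2"
    have *: "0 \<le> m" "m < b" "b < q" "q < m'" "q \<le> 1" using m m' by (auto simp: q_def b_def Omega_def)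
    have "mean P m b = u" "mean P b q = u"
      unfolding mean_def using * seg_int_P[of m b] seg_int_P[of b q] Buv[of m] Buv[of b] Buv[of q]
      by (auto simp: divide_simps) (auto simp: algebra_simps)
    then have "{m<..<q} \<subseteq> Omega_of P" using K_mean_less[OF P_K, of m b q] * by auto
    moreover have "m < q" using * by simp
    ultimately obtain c where c: "\<And>x. x \<in> Omega \<Longrightarrow> m \<le> x \<Longrightarrow> x < q \<Longrightarrow> P x = c"
      using Omega_of_imp_constant_right[OF P_K] by metis
    have "b \<in> Omega" using * by (auto simp: Omega_def)
    then have "P m < P b" using less * by blast
    with c[OF m] c[OF \<open>b \<in> Omega\<close>] * show False by simp
  qed
qed

end

section \<open>Formation and absence of clusters\<close>

context lagrangian
begin

lemma cluster_atE:
  assumes "cluster_at_time X t C"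
  obtains a b where "a < b" "{a<..<b} \<in> components (Omega_of (X t))" "C = {a..<b} \<inter> Omega"
    "{a<..<b} \<subseteq> Omega_of (X t)" "a \<notin> Omega_of (X t)" "b \<notin> Omega_of (X t)" "0 \<le> a" "b \<le> 1"
proof -
  obtain a b where ab: "{a<..<b} \<in> components (Omega_of (X t))" "C = {a..<b} \<inter> Omega"
    using assms by (auto simp: cluster_at_time_def)
  have "{a<..<b} \<noteq> {}" using in_components_nonempty[OF ab(1)] .
  then have less: "a < b" by simp
  have *: "{a<..<b} \<subseteq> Omega_of (X t) \<and> a \<notin> Omega_of (X t) \<and> b \<notin> Omega_of (X t)"
    using components_interval_iff[OF open_Omega_of less] ab(1) by blast
  then have "0 \<le> a" "b \<le> 1"
    using interval_subset_Omega[OF less] Omega_of_subset by blast+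
  with ab less * show thesis by (intro that) auto
qed

lemma cluster_at_timeI:
  assumes "a < b" "{a<..<b} \<subseteq> Omega_of (X t)" "a \<notin> Omega_of (X t)" "b \<notin> Omega_of (X t)"
  shows "cluster_at_time X t ({a..<b} \<inter> Omega)"
  using components_interval_iff[OF open_Omega_of assms(1)] assms unfolding cluster_at_time_def by blast

lemma Sigma_plus_no_finite_cluster:
  assumes m: "m \<in> Omega" "m \<in> Sigma_plus \<Psi>" and C: "finite_time_cluster X C" "m \<in> C"
  shows False
proof -
  obtain t where t: "0 \<le> t" "cluster_at_time X t C" using C by (auto simp: finite_time_cluster_def)
  obtain a b where ab: "a < b" "C = {a..<b} \<inter> Omega" "{a<..<b} \<subseteq> Omega_of (X t)" "0 \<le> a" "b \<le> 1"
    using cluster_atE[OF t(2)] by metis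
  have "{a<..<b} \<subseteq> Omega_of P" using ab(3) Omega_of_X_subset_P[OF t(1)] by blast
  then obtain c where c: "\<And>x. x \<in> Omega \<Longrightarrow> a \<le> x \<Longrightarrow> x < b \<Longrightarrow> P x = c"
    using Omega_of_imp_constant_right[OF P_K _ ab(1)] by metis
  define x where "x = (m + b) / 2"
  have x: "m < x" "x < b" "x \<in> Omega" "a \<le> x" using C(2) ab m by (auto simp: x_def Omega_def)
  have "P m < P x" using m x Sigma_plus_iff[OF m(1)] by blast
  with c[of m] c[of x] x C(2) ab m show False by simp
qed

lemma SUP_SUP_upper:
  fixes f :: "real \<Rightarrow> real \<Rightarrow> ennreal"
  assumes "x \<in> I" "y \<in> I"
  shows "f x y \<le> (SUP u\<in>I. SUP v\<in>I. f u v)"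
  by (rule SUP_upper2[OF assms(1)], rule SUP_upper[OF assms(2)])

lemma Sigma_plus_no_infinite_cluster:
  assumes m: "m \<in> Omega" "m \<in> Sigma_plus \<Psi>" and I: "infinite_time_cluster_at X m I"
  shows False
proof -
  obtain a b where ab: "I = {a..<b} \<inter> Omega" and mI: "m \<in> I"
    and lim: "((\<lambda>t. SUP \<omega>1\<in>I. SUP \<omega>2\<in>I. ennreal \<bar>X t \<omega>1 - X t \<omega>2\<bar>) \<longlongrightarrow> 0) at_top"
    using I by (auto simp: infinite_time_cluster_at_def infinite_time_cluster_def)
  \<comment> \<open>Because \<open>I\<close> is half-open, it contains a point to the right of
    \<open>m\<close>; \<open>b\<close> may exceed 1, hence the minimum.\<close>
  define x where "x = (m + min b 1) / 2"
  have x: "m < x" "x \<in> Omega" "x \<in> I" using mI ab m by (auto simp: x_def Omega_def min_def)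
  have "P m < P x" using m x Sigma_plus_iff[OF m(1)] by blast
  then obtain g \<delta> d where s: "0 \<le> g" "0 < \<delta>" "0 < d" "\<And>t. 0 \<le> t \<Longrightarrow> min (g + \<delta> * t) d \<le> X t x - X t m"
    using separation[OF m(1) x(2)] by metis
  \<comment> \<open>A lower bound for the distance from time 1 on, even when
    \<open>g = 0\<close>.\<close>
  define c where "c = min \<delta> d"
  have c: "0 < c" using s by (simp add: c_def)
  have "\<forall>\<^sub>F t in at_top. (SUP \<omega>1\<in>I. SUP \<omega>2\<in>I. ennreal \<bar>X t \<omega>1 - X t \<omega>2\<bar>) < ennreal c"
    by (rule order_tendstoD(2)[OF lim]) (use c in simp)
  moreover have "\<forall>\<^sub>F t in at_top. (1::real) \<le> t" by (rule eventually_ge_at_top)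
  ultimately have ev: "\<forall>\<^sub>F t in at_top. (SUP \<omega>1\<in>I. SUP \<omega>2\<in>I. ennreal \<bar>X t \<omega>1 - X t \<omega>2\<bar>) < ennreal c \<and> 1 \<le> t"
    by (rule eventually_conj)
  obtain t where t: "(SUP \<omega>1\<in>I. SUP \<omega>2\<in>I. ennreal \<bar>X t \<omega>1 - X t \<omega>2\<bar>) < ennreal c" "1 \<le> t"
    using eventually_happens'[OF trivial_limit_at_top_linorder ev] by blast
  have "\<delta> * 1 \<le> \<delta> * t" using s t by (intro mult_left_mono) auto
  then have "c \<le> min (g + \<delta> * t) d" using s(1) by (simp add: c_def)
  also have "\<dots> \<le> X t x - X t m" using s(4)[of t] t by simp
  finally have "ennreal c \<le> ennreal \<bar>X t x - X t m\<bar>" by (simp add: ennreal_leI)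
  also have "\<dots> \<le> (SUP \<omega>1\<in>I. SUP \<omega>2\<in>I. ennreal \<bar>X t \<omega>1 - X t \<omega>2\<bar>)"
    by (rule SUP_SUP_upper[OF x(3) mI])
  finally show False using t(1) by simp
qed

text \<open>As long as \<open>m\<close> is outside all clusters no momentum passes through it, and the excess of the
  mean velocity on the left makes the gap decrease at a uniform rate.\<close>

lemma Sigma_minus_cluster:
  assumes m: "m \<in> Sigma_minus \<Psi>"
  obtains T where "0 \<le> T" "\<And>t. T \<le> t \<Longrightarrow> \<exists>C. cluster_at_time X t C \<and> m \<in> C"
proof -
  have mO: "m \<in> Omega" and BA: "B m < A m" using m by (auto simp: Sigma_minus_iff)
  have "m \<in> Omega_of P" using m Sigma_minus_subset_P by blast
  then obtain a b where ab: "a < m" "m < b" "{a<..<b} \<subseteq> Omega_of P" "a \<notin> Omega_of P" "b \<notin> Omega_of P"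
      "0 \<le> a" "b \<le> 1"
    using open_interval_around[OF open_Omega_of Omega_of_subset] by metis
  have c: "A a = B a" "A b = B b" using contact[of a] contact[of b] ab by auto
  obtain k where k: "\<And>x. a < x \<Longrightarrow> x < b \<Longrightarrow> P x = k"
    using Omega_of_imp_constant[OF ab(3)] ab(1,2) by force
  have Blin: "B m = B a + k * (m - a)" "B b = B a + k * (b - a)"
    using B_affine[of a b k m] B_affine[of a b k b] k ab by auto
  \<comment> \<open>\<open>A\<close> and \<open>B\<close> agree at \<open>a\<close> and
    \<open>b\<close>, and \<open>B\<close> is affine between them, so \<open>B\<close> is the chord
    of \<open>A\<close>. As \<open>A\<close> lies strictly above it at \<open>m\<close>, the mean of
    \<Psi> is larger on the left.\<close>
  define \<delta> where "\<delta> = mean \<Psi> a m - mean \<Psi> m b"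
  have \<delta>: "0 < \<delta>"
  proof -
    have "k * (m - a) < seg_int \<Psi> a m" using seg_int_Psi[of a m] ab c BA Blin by simp
    then have "k < mean \<Psi> a m" unfolding mean_def using ab by (simp add: pos_less_divide_eq)
    moreover have "seg_int \<Psi> m b < k * (b - m)"
      using seg_int_Psi[of m b] ab c BA Blin by (simp add: algebra_simps)
    then have "mean \<Psi> m b < k" unfolding mean_def using ab by (simp add: pos_divide_less_eq)
    ultimately show ?thesis by (simp add: \<delta>_def)
  qed
  have "\<exists>r. good r \<and> m \<in> Omega_of (X r)"
  proof (rule ccontr)
    assume no: "\<not> (\<exists>r. good r \<and> m \<in> Omega_of (X r))"
    have speed: "gap_speed a m m b r \<le> - \<delta>" if r: "good r" for r
    proof -
      have Zm: "Z r m = 0" using Z_zero[OF r, of m] no r ab by auto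
      have W: "seg_int (W r) a m \<le> 0" "0 \<le> seg_int (W r) m b"
        using seg_int_W[OF r, of a m] seg_int_W[OF r, of m b] Zm Z_nonneg[OF r, of a] Z_nonneg[OF r, of b] ab by auto
      have F: "0 \<le> mean (F r) m b - mean (F r) a m"
        by (rule F_gap_nonneg) (use good_pos[OF r] ab in auto)
      have "mean (V r) m b \<le> mean \<Psi> m b - mean (F r) m b"
        unfolding mean_def diff_divide_distrib[symmetric]
        using seg_int_V[OF r, of m b] W ab by (intro divide_right_mono) auto
      moreover have "mean \<Psi> a m - mean (F r) a m \<le> mean (V r) a m"
        unfolding mean_def diff_divide_distrib[symmetric]
        using seg_int_V[OF r, of a m] W ab by (intro divide_right_mono) auto
      ultimately show ?thesis using F by (simp add: gap_speed_def \<delta>_def)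
    qed
    \<comment> \<open>By this time the gap would have dropped to at most \<open>- \<delta>\<close>,
      which is impossible for a nondecreasing \<open>X T\<close>.\<close>
    define T where "T = gap a m m b 0 / \<delta> + 1"
    have "0 \<le> gap a m m b 0" by (rule gap_nonneg) (use ab in auto)
    then have T: "0 \<le> T" using \<delta> by (simp add: T_def)
    have "gap a m m b T - gap a m m b 0 \<le> - \<delta> * (T - 0)"
      by (rule gap_increment_le) (use T speed in auto)
    moreover have "\<delta> * T = gap a m m b 0 + \<delta>" using \<delta> by (simp add: T_def field_simps)
    moreover have "0 \<le> gap a m m b T" by (rule gap_nonneg) (use T ab in auto)
    ultimately show False using \<delta> by simp
  qed
  then obtain r where r: "good r" "m \<in> Omega_of (X r)" by blast
  show thesis
  proof (rule that)
    show "0 \<le> r" using good_pos[OF r(1)] by simp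
    fix t assume "r \<le> t"
    then have "m \<in> Omega_of (X t)" using sticky_good[OF r(1)] r(2) by blast
    then obtain p q where pq: "p < m" "m < q" "{p<..<q} \<subseteq> Omega_of (X t)" "p \<notin> Omega_of (X t)" "q \<notin> Omega_of (X t)"
      using open_interval_around[OF open_Omega_of Omega_of_subset] by metis
    then have "cluster_at_time X t ({p..<q} \<inter> Omega)" by (intro cluster_at_timeI) auto
    moreover have "m \<in> {p..<q} \<inter> Omega" using pq mO by simp
    ultimately show "\<exists>C. cluster_at_time X t C \<and> m \<in> C" by blast
  qed
qed

text \<open>A cluster around \<open>m\<close> means that the gap across \<open>m\<close> has closed.
  The gap is positive initially, and sticking cannot close it across a contact point, so alignment
  has to do it alone. Halving the scale 2^-k takes at least a fixed multiple of 2^-k / \<Phi>(2^-k),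
  and these times have infinite sum.\<close>

lemma Osgood_barrier:
  assumes recip: "reciprocal_integral \<phi> = \<infinity>"
    and m: "m \<in> Omega" "A m = B m" "m \<notin> Omega_of Xbar" and t: "0 \<le> t"
  shows "m \<notin> Omega_of (X t)"
proof
  assume "m \<in> Omega_of (X t)"
  then obtain p q where pq: "p < m" "m < q" "{p<..<q} \<subseteq> Omega_of (X t)" "0 \<le> p" "q \<le> 1"
    using open_interval_around[OF open_Omega_of Omega_of_subset] by metis
  define D where "D = gap p m m q"
  obtain c where c: "\<And>x. p < x \<Longrightarrow> x < q \<Longrightarrow> X t x = c"
    using Omega_of_imp_constant[OF pq(3)] pq(1,2) by force
  have "mean (X t) m q \<le> c" "c \<le> mean (X t) p m"
    using c pq by (auto intro!: mean_upper mean_lower X_L2 t)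
  then have Dt: "D t \<le> 0" by (simp add: D_def gap_def)
  have D0: "0 < D 0"
    unfolding D_def gap_def
    using K_mean_less[OF X_K, of 0 p m q] m(3) pq by (auto simp: Omega_of_X0 subset_iff)
  have step: "\<sigma> - 2 * Phi \<phi> \<sigma> * (t - s) \<le> D t" if "0 < \<sigma>" "\<sigma> \<le> D s" "0 \<le> s" "s \<le> t" for \<sigma> s t
    unfolding D_def by (rule gap_osgood_step) (use that pq m(2) in \<open>auto simp: D_def\<close>)
  show False
  proof (cases "AE x in lborel. \<phi> x = 0")
    case True
    \<comment> \<open>The dyadic criterion assumes that \<Phi> is positive. Here \<Phi> vanishes,
      and one step of size \<open>D 0\<close> shows that the gap does not shrink.\<close>
    have "\<not> 0 < Phi \<phi> (D 0)" using Phi_pos_iff[OF protocol D0] True by simp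
    then have "Phi \<phi> (D 0) = 0" using Phi_nonneg[OF protocol, of "D 0"] D0 by simp
    with step[of "D 0" 0 t] D0 Dt t show False by simp
  next
    case False
    then have pos: "0 < Phi \<phi> x" if "0 < x" for x using Phi_pos_iff[OF protocol that] by simp
    obtain k0 where k0: "(1/2) ^ k0 < D 0" using D0 real_arch_pow_inv[of "D 0" "1/2"] by auto
    define \<sigma> where "\<sigma> k = (1/2::real) ^ (k + k0)" for k
    have \<sigma>: "0 < \<sigma> k" "\<sigma> (Suc k) = \<sigma> k / 2" for k by (simp_all add: \<sigma>_def)
    \<comment> \<open>Chosen so that the loss \<open>2 * Phi \<phi> (\<sigma> k) * h k\<close> is
      half of \<open>\<sigma> k\<close>, which leads exactly to the next scale.\<close>
    define h where "h k = \<sigma> k / (4 * Phi \<phi> (\<sigma> k))" for k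
    have h0: "0 \<le> h k" for k using \<sigma>(1)[of k] pos[OF \<sigma>(1)[of k]] by (simp add: h_def)
    have "\<not> summable (\<lambda>k. (1/2) ^ k / Phi \<phi> ((1/2) ^ k))"
      using reciprocal_integral_finite_iff[OF protocol pos] recip by simp
    then have "\<not> summable (\<lambda>k. (1/4) * ((1/2) ^ (k + k0) / Phi \<phi> ((1/2) ^ (k + k0))))"
      by (subst summable_cmult_iff) (use summable_iff_shift[of "\<lambda>k. (1/2) ^ k / Phi \<phi> ((1/2) ^ k)" k0] in simp)
    moreover have "(\<lambda>k. (1/4) * ((1/2) ^ (k + k0) / Phi \<phi> ((1/2) ^ (k + k0)))) = h"
      by (simp add: h_def[abs_def] \<sigma>_def)
    ultimately have "\<not> summable h" by simp
    then obtain n where n: "t < (\<Sum>j<n. h j)"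
      using summableI_nonneg_bounded[of h t] h0 by (meson not_less)
    have "\<sigma> k \<le> D s" if "0 \<le> s" "s \<le> (\<Sum>j<k. h j)" for k s
      using that
    proof (induction k arbitrary: s)
      case 0
      then have "s = 0" by simp
      then show ?case using k0 by (simp add: \<sigma>_def)
    next
      case (Suc k)
      \<comment> \<open>The induction hypothesis covers the time up to \<open>u\<close>; the
        remaining time is at most \<open>h k\<close>.\<close>
      define u where "u = min s (\<Sum>j<k. h j)"
      have u: "0 \<le> u" "u \<le> s" "u \<le> (\<Sum>j<k. h j)" "s - u \<le> h k"
        using Suc.prems h0[of k] by (auto simp: u_def min_def intro: sum_nonneg h0)
      have "2 * Phi \<phi> (\<sigma> k) * (s - u) \<le> 2 * Phi \<phi> (\<sigma> k) * h k"
        using u pos[OF \<sigma>(1)[of k]] by (intro mult_left_mono) auto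
      also have "\<dots> = \<sigma> k / 2" using pos[OF \<sigma>(1)[of k]] by (simp add: h_def field_simps)
      finally have "\<sigma> (Suc k) \<le> \<sigma> k - 2 * Phi \<phi> (\<sigma> k) * (s - u)" by (simp add: \<sigma>(2))
      also have "\<dots> \<le> D s" by (rule step) (use Suc.IH[of u] u \<sigma>(1) in auto)
      finally show ?case .
    qed
    from this[of t n] n t \<sigma>(1)[of n] Dt show False by simp
  qed
qed

text \<open>A cluster not contained in \<open>Sigma_minus\<close> has a contact point
  \<open>m0\<close> inside, which by the Osgood barrier belonged to an initial cluster
  \<open>(p, q)\<close>. There \<open>A - B\<close> is affine and nonnegative and vanishes at the
  interior point \<open>m0\<close>, hence on all of \<open>[p, q]\<close>. So \<open>p\<close> and
  \<open>q\<close>, if in \<Omega>, are contact points outside the initial clusters and remain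
  barriers. The alternative \<open>m = m_minus\<close> occurs because a cluster contains its left
  endpoint while \<open>Sigma_minus\<close> is open.\<close>

lemma finite_cluster_cases:
  assumes recip: "reciprocal_integral \<phi> = \<infinity>"
    and C: "finite_time_cluster X C" "m \<in> C"
  shows "(m \<in> Sigma_zero \<Psi> \<and> initial_cluster X C) \<or>
    (\<exists>m_minus m_plus. {m_minus<..<m_plus} \<in> components (Sigma_minus \<Psi>) \<and>
       (m \<in> Sigma_minus \<Psi> \<or> m = m_minus) \<and> C \<subseteq> {m_minus..<m_plus})"
proof -
  obtain t where t: "0 \<le> t" "cluster_at_time X t C" using C by (auto simp: finite_time_cluster_def)
  obtain a b where ab: "a < b" "C = {a..<b} \<inter> Omega" "{a<..<b} \<subseteq> Omega_of (X t)"
      "a \<notin> Omega_of (X t)" "b \<notin> Omega_of (X t)" "0 \<le> a" "b \<le> 1"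
    using cluster_atE[OF t(2)] by metis
  have inner: "x \<in> Omega" if "a < x" "x < b" for x using that ab by (auto simp: Omega_def)
  show ?thesis
  proof (cases "{a<..<b} \<subseteq> Sigma_minus \<Psi>")
    case True
    have op: "open (Sigma_minus \<Psi>)"
    proof -
      have "continuous_on {0..1} (\<lambda>m. A m - B m)"
        unfolding A_def[abs_def] B_def[abs_def]
        by (intro continuous_on_diff seg_int_continuous_on Psi_L2 P_L2)
      then have "continuous_on Omega (\<lambda>m. A m - B m)"
        by (rule continuous_on_subset) (auto simp: Omega_def)
      then have "open (Omega \<inter> (\<lambda>m. A m - B m) -` {0<..})"
        by (intro continuous_open_preimage) (auto simp: Omega_def)
      also have "Omega \<inter> (\<lambda>m. A m - B m) -` {0<..} = Sigma_minus \<Psi>"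
        by (auto simp: Sigma_minus_iff)
      finally show ?thesis .
    qed
    define z where "z = (a + b) / 2"
    have z: "a < z" "z < b" using ab by (auto simp: z_def)
    then have "z \<in> Sigma_minus \<Psi>" using True by auto
    then obtain p q where pq: "p < z" "z < q" "{p<..<q} \<subseteq> Sigma_minus \<Psi>" "p \<notin> Sigma_minus \<Psi>" "q \<notin> Sigma_minus \<Psi>"
      using open_interval_around[OF op] by (metis Sigma_minus_iff subsetI)
    have "p \<le> a"
    proof (rule ccontr)
      assume "\<not> p \<le> a"
      then have "p \<in> {a<..<b}" using pq z by simp
      with True pq show False by blast
    qed
    moreover have "b \<le> q"
    proof (rule ccontr)
      assume "\<not> b \<le> q"
      then have "q \<in> {a<..<b}" using pq z by simp
      with True pq show False by blast
    qed
    ultimately have "C \<subseteq> {p..<q}" using ab by auto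
    moreover have "{p<..<q} \<in> components (Sigma_minus \<Psi>)"
      using components_interval_iff[OF op, of p q] pq by auto
    moreover have "m \<in> Sigma_minus \<Psi> \<or> m = p"
    proof -
      have "m \<in> {p..<q}" using \<open>C \<subseteq> {p..<q}\<close> C by blast
      then show ?thesis using pq(3) by (cases "m = p") auto
    qed
    ultimately show ?thesis by blast
  next
    case False
    then obtain m0 where "m0 \<in> {a<..<b}" "m0 \<notin> Sigma_minus \<Psi>" by blast
    then have m0: "a < m0" "m0 < b" "m0 \<notin> Sigma_minus \<Psi>" by simp_all
    have m0O: "m0 \<in> Omega" using inner m0 by simp
    have contact_of: "A x = B x" if "x \<in> Omega" "x \<notin> Sigma_minus \<Psi>" for x
      using that B_le_A[of x] by (auto simp: Sigma_minus_iff Omega_def not_less)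
    have c0: "A m0 = B m0" using contact_of m0O m0 by blast
    have "m0 \<in> Omega_of Xbar"
      using Osgood_barrier[OF recip m0O c0 _ t(1)] m0 ab by (auto simp: subset_iff)
    then obtain p q where pq: "p < m0" "m0 < q" "{p<..<q} \<subseteq> Omega_of Xbar" "p \<notin> Omega_of Xbar" "q \<notin> Omega_of Xbar"
        "0 \<le> p" "q \<le> 1"
      using open_interval_around[OF open_Omega_of Omega_of_subset] by metis
    have less: "p < q" using pq by simp
    obtain k where k: "AE x in lborel. p < x \<and> x < q \<longrightarrow> \<Psi> x = k"
      using Psi_const_initial[OF pq(6) less pq(7,3)] by metis
    have Pc: "{p<..<q} \<subseteq> Omega_of P" by (rule initial_const_imp_P_const[OF less pq(3)])
    obtain l where l: "\<And>x. p < x \<Longrightarrow> x < q \<Longrightarrow> P x = l"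
      using Omega_of_imp_constant[OF Pc less] by metis
    have Alin: "A x = A p + k * (x - p)" if x: "p \<le> x" "x \<le> q" for x
    proof -
      have "AE y in lborel. p < y \<and> y < x \<longrightarrow> \<Psi> y = k" using k by eventually_elim (use x in simp)
      then have "seg_int \<Psi> p x = seg_int (\<lambda>_. k) p x"
        by (intro seg_int_cong_AE L2_measurable[OF Psi_L2] L2_measurable[OF L2_const])
      then show ?thesis using seg_int_Psi[of p x] x pq by (simp add: seg_int_const)
    qed
    have Blin: "B x = B p + l * (x - p)" if x: "p \<le> x" "x \<le> q" for x
      using B_affine[OF pq(6) less pq(7) l x] .
    have AB: "A x = B x" if x: "p \<le> x" "x \<le> q" for x
    proof -
      have lin: "A x - B x = (A p - B p) + (k - l) * (x - p)" if "p \<le> x" "x \<le> q" for x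
        using Alin[OF that] Blin[OF that] by (simp add: algebra_simps)
      have p0: "0 \<le> A p - B p" using B_le_A[of p] pq by simp
      have q0: "0 \<le> (A p - B p) + (k - l) * (q - p)" using lin[of q] B_le_A[of q] pq by simp
      have mid: "(A p - B p) + (k - l) * (m0 - p) = 0" using lin[of m0] c0 pq by simp
      have "k - l = 0"
      proof (rule ccontr)
        assume "k - l \<noteq> 0"
        then consider "0 < k - l" | "k - l < 0" by linarith
        then show False
        proof cases
          case 1
          then have "0 < (k - l) * (m0 - p)" using pq by simp
          with p0 mid show False by simp
        next
          case 2
          then have "(k - l) * (q - p) < (k - l) * (m0 - p)" using pq by (intro mult_strict_left_mono_neg) auto
          with q0 mid show False by simp
        qed
      qed
      with mid lin[OF x] show ?thesis by simp
    qed
    have outside: "y \<notin> Omega_of (X t)" if "y = p \<or> y = q" for y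
    proof (cases "y \<in> Omega")
      case True
      show ?thesis by (rule Osgood_barrier[OF recip True _ _ t(1)]) (use that AB pq in auto)
    next
      case False
      then show ?thesis using Omega_of_subset by blast
    qed
    have sub: "{p<..<q} \<subseteq> Omega_of (X t)" using pq(3) sticky_initial[OF t(1)] by blast
    have eq: "a = p" "b = q"
    proof -
      have "p \<notin> {a<..<b}" "q \<notin> {a<..<b}" "a \<notin> {p<..<q}" "b \<notin> {p<..<q}"
        using outside ab sub by blast+
      then show "a = p" "b = q" using m0 pq by auto
    qed
    have "initial_cluster X C"
      unfolding initial_cluster_def ab(2) eq
      by (rule cluster_at_timeI) (use pq less in \<open>auto simp: Omega_of_X0\<close>)
    moreover have "m \<in> Sigma_zero \<Psi>"
      unfolding Sigma_zero_def
    proof (rule UnionI)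
      show "m \<in> {p..<q}" using C(2) ab eq by simp
      have env: "convex_envelope (primitive \<Psi>) x = B x" "primitive \<Psi> x = A x" if "x \<in> {p..<q}" for x
        using envelope_eq[of x] primitive_eq[of x] that pq by auto
      have "affine_on {p..<q} (convex_envelope (primitive \<Psi>))"
        unfolding affine_on_def
      proof (intro exI ballI)
        fix x assume x: "x \<in> {p..<q}"
        then show "convex_envelope (primitive \<Psi>) x = l * x + (B p - l * p)"
          using env(1)[OF x] Blin[of x] by (simp add: algebra_simps)
      qed
      moreover have "\<forall>x\<in>{p..<q}. convex_envelope (primitive \<Psi>) x = primitive \<Psi> x"
        using env AB by simp
      ultimately show "{p..<q} \<in> {J. \<exists>m' m''. 0 \<le> m' \<and> m' < m'' \<and> m'' \<le> 1 \<and> J = {m'..<m''} \<and>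
          affine_on J (convex_envelope (primitive \<Psi>)) \<and>
          (\<forall>x\<in>J. convex_envelope (primitive \<Psi>) x = primitive \<Psi> x)}"
        using pq less by blast
    qed
    ultimately show ?thesis by blast
  qed
qed

end

section \<open>Collapse of a level set of \<open>P\<close>\<close>

locale lagrangian_level = lagrangian +
  fixes a b \<alpha> :: real
  assumes ab: "0 \<le> a" "a < b" "b \<le> 1"
    and level: "\<And>x. a < x \<Longrightarrow> x < b \<Longrightarrow> P x = \<alpha>"
    and ends: "a \<notin> Omega_of P" "b \<notin> Omega_of P"
    and phi_nz: "\<not> (AE x in lborel. \<phi> x = 0)"
begin

lemma contact_a: "A a = B a" and contact_b: "A b = B b"
  using contact ends ab by auto

lemma Phi_pos: "0 < x \<Longrightarrow> 0 < Phi \<phi> x"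
  using Phi_pos_iff[OF protocol] phi_nz by simp

lemma in_Omega: "a < x \<Longrightarrow> x < b \<Longrightarrow> x \<in> Omega"
  using ab by (auto simp: Omega_def)

lemma mean_P:
  assumes "a \<le> p" "p < q" "q \<le> b"
  shows "mean P p q = \<alpha>"
  unfolding mean_def using seg_int_const_on[of p q P \<alpha>] level assms ab by simp

text \<open>Only the open interval is measured: \<open>a\<close> and \<open>b\<close> may lie
  outside \<Omega>, and \<open>P\<close> may jump at \<open>b\<close>, so the endpoints are treated
  separately.\<close>

definition spread_le :: "real \<Rightarrow> real \<Rightarrow> bool" where
  "spread_le t \<sigma> \<longleftrightarrow> (\<forall>x y. a < x \<longrightarrow> x < b \<longrightarrow> a < y \<longrightarrow> y < b \<longrightarrow> X t y - X t x \<le> \<sigma>)"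

lemma spread_leD: "spread_le t \<sigma> \<Longrightarrow> a < x \<Longrightarrow> x < b \<Longrightarrow> a < y \<Longrightarrow> y < b \<Longrightarrow> X t y - X t x \<le> \<sigma>"
  by (simp add: spread_le_def)

lemma spread_le_mono: "spread_le t \<sigma> \<Longrightarrow> \<sigma> \<le> \<tau> \<Longrightarrow> spread_le t \<tau>"
  unfolding spread_le_def by (meson order_trans)

lemma inner_gap_speed:
  assumes r: "good r" and xy: "a < x" "x \<le> y" "y < b"
  shows "gap_speed a x y b r \<le> - (mean (F r) y b - mean (F r) a x)"
  using gap_speed_upper[OF r, of a x y b] contact_a contact_b mean_P[of a x] mean_P[of y b] xy ab by simp

lemma inner_gap_decreasing:
  assumes "0 \<le> s" "s \<le> t" and xy: "a < x" "x \<le> y" "y < b"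
  shows "gap a x y b t \<le> gap a x y b s"
proof -
  have "gap a x y b t - gap a x y b s \<le> 0 * (t - s)"
  proof (rule gap_increment_le[OF assms(1,2)])
    fix r assume r: "good r"
    have "0 \<le> mean (F r) y b - mean (F r) a x"
      by (rule F_gap_nonneg) (use good_pos[OF r] xy ab in auto)
    then show "gap_speed a x y b r \<le> 0" using inner_gap_speed[OF r xy] by simp
  qed
  then show ?thesis by simp
qed

lemma spread_gap_le:
  assumes "0 \<le> t" "spread_le t \<sigma>" and xy: "a < x" "x \<le> y" "y < b"
  shows "gap a x y b t \<le> \<sigma>"
  by (rule gap_upper) (use assms ab in \<open>auto intro: spread_leD\<close>)

lemma spread_le_later:
  assumes "0 \<le> s" "s \<le> t" "spread_le s \<sigma>" "0 \<le> \<sigma>"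
  shows "spread_le t \<sigma>"
  unfolding spread_le_def
proof (intro allI impI)
  fix x y assume *: "a < x" "x < b" "a < y" "y < b"
  have O: "x \<in> Omega" "y \<in> Omega" using in_Omega * by auto
  show "X t y - X t x \<le> \<sigma>"
  proof (cases "x \<le> y")
    case True
    have "X t y - X t x \<le> gap a x y b t"
      by (rule gap_ge) (use assms * True O ab in auto)
    also have "\<dots> \<le> gap a x y b s" by (rule inner_gap_decreasing) (use assms * True in auto)
    also have "\<dots> \<le> \<sigma>" by (rule spread_gap_le) (use assms * True in auto)
    finally show ?thesis .
  next
    case False
    then show ?thesis using X_mono[of t y x] O assms by simp
  qed
qed

text \<open>An explicit substitute for Gronwall's inequality: inside the level set gaps are
  nonincreasing, so the closing speed, at least \<open>c\<close> times the current gap, is at least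
  \<open>c\<close> times the final one. Hence the final gap times \<open>1 + (t - s) * c\<close> is
  at most \<open>\<sigma>\<close>.\<close>

lemma spread_decay:
  assumes st: "0 \<le> s" "s \<le> t" and \<sigma>: "0 < \<sigma>" "spread_le s \<sigma>"
  shows "spread_le t (\<sigma> / (1 + (t - s) * ((b - a) * Phi \<phi> \<sigma> / \<sigma>)))"
  unfolding spread_le_def
proof (intro allI impI)
  fix x y assume *: "a < x" "x < b" "a < y" "y < b"
  define k where "k = Phi \<phi> \<sigma> / \<sigma>"
  have k: "0 < k" using Phi_pos[OF \<sigma>(1)] \<sigma>(1) by (simp add: k_def)
  have den: "0 < 1 + (t - s) * ((b - a) * k)"
    using k st ab by (intro add_pos_nonneg) auto
  have O: "x \<in> Omega" "y \<in> Omega" using in_Omega * by auto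
  have "X t y - X t x \<le> \<sigma> / (1 + (t - s) * ((b - a) * k))"
  proof (cases "x \<le> y")
    case False
    then have "X t y - X t x \<le> 0" using X_mono[of t y x] O st by simp
    also have "0 \<le> \<sigma> / (1 + (t - s) * ((b - a) * k))" using den \<sigma> by simp
    finally show ?thesis .
  next
    case True
    define u where "u = X t y - X t x"
    \<comment> \<open>\<open>u\<close> is bounded by the gap between the outer strips
      \<open>(a, a + e)\<close> and \<open>(b - e, b)\<close>, and the mass between the strips
      exerts the attraction. Letting \<open>e\<close> tend to 0 recovers the full mass
      \<open>b - a\<close>.\<close>
    have ineq: "u * (1 + (t - s) * ((b - a - 2 * e) * k)) \<le> \<sigma>" if e: "0 < e" "a + e < x" "y < b - e" for e
    proof -
      define p q where "p = a + e" and "q = b - e"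
      have pq: "a < p" "p < x" "y < q" "q < b" "p < q" using e True by (auto simp: p_def q_def)
      define c where "c = (q - p) * k"
      have c: "0 \<le> c" using pq k by (simp add: c_def)
      have "gap a p q b t - gap a p q b s \<le> - (c * gap a p q b t) * (t - s)"
      proof (rule gap_increment_le[OF st])
        fix r assume r: "good r" "s < r" "r < t"
        have r0: "0 \<le> r" using good_pos[OF r(1)] by simp
        have "spread_le r \<sigma>" by (rule spread_le_later[OF st(1)]) (use r \<sigma> in auto)
        then have "c * gap a p q b r \<le> mean (F r) q b - mean (F r) a p"
          using F_gap_lower_gap[of r a p q b \<sigma>] r0 pq ab \<sigma> by (auto simp: c_def k_def spread_le_def)
        moreover have "c * gap a p q b t \<le> c * gap a p q b r"
          by (intro mult_left_mono c inner_gap_decreasing) (use r r0 pq in auto)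
        ultimately show "gap_speed a p q b r \<le> - (c * gap a p q b t)"
          using inner_gap_speed[OF r(1), of p q] pq by simp
      qed
      moreover have "gap a p q b s \<le> \<sigma>" by (rule spread_gap_le) (use st \<sigma> pq in auto)
      ultimately have "gap a p q b t * (1 + (t - s) * c) \<le> \<sigma>" by (simp add: algebra_simps)
      moreover have "u \<le> gap a p q b t"
        unfolding u_def by (rule gap_ge) (use st pq ab O in auto)
      then have "u * (1 + (t - s) * c) \<le> gap a p q b t * (1 + (t - s) * c)"
        using c st by (intro mult_right_mono) auto
      ultimately show ?thesis by (simp add: c_def p_def q_def algebra_simps)
    qed
    have "((\<lambda>e. u * (1 + (t - s) * ((b - a - 2 * e) * k))) \<longlongrightarrow> u * (1 + (t - s) * ((b - a - 2 * 0) * k))) (at_right 0)"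
      by (intro tendsto_intros)
    moreover have "\<forall>\<^sub>F e in at_right 0. u * (1 + (t - s) * ((b - a - 2 * e) * k)) \<le> \<sigma>"
      unfolding eventually_at_right_field
      by (intro exI[of _ "min (x - a) (b - y)"]) (use * ineq in auto)
    ultimately have "u * (1 + (t - s) * ((b - a - 2 * 0) * k)) \<le> \<sigma>"
      by (intro tendsto_upperbound[of _ _ "at_right 0"]) auto
    then show ?thesis unfolding u_def[symmetric] using den by (simp add: pos_le_divide_eq)
  qed
  then show "X t y - X t x \<le> \<sigma> / (1 + (t - s) * ((b - a) * Phi \<phi> \<sigma> / \<sigma>))" by (simp add: k_def)
qed

lemma spread_vanishes:
  assumes M: "spread_le 0 M" and e: "0 < e"
  obtains T where "0 \<le> T" "\<And>t. T \<le> t \<Longrightarrow> spread_le t e"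
proof -
  define \<sigma> where "\<sigma> = max M e"
  have \<sigma>: "0 < \<sigma>" "spread_le 0 \<sigma>" using e spread_le_mono[OF M, of \<sigma>] by (auto simp: \<sigma>_def)
  define c where "c = (b - a) * Phi \<phi> \<sigma> / \<sigma>"
  have c: "0 < c" using Phi_pos[OF \<sigma>(1)] \<sigma> ab by (simp add: c_def)
  \<comment> \<open>This makes \<open>T * c = \<sigma> / e\<close>, and
    \<open>\<sigma> / (1 + \<sigma> / e) \<le> e\<close>.\<close>
  define T where "T = \<sigma> / (e * c)"
  have T: "0 \<le> T" using \<sigma> e c by (simp add: T_def)
  have "spread_le T (\<sigma> / (1 + (T - 0) * c))"
    unfolding c_def by (rule spread_decay) (use T \<sigma> in auto)
  moreover have "\<sigma> / (1 + (T - 0) * c) \<le> e"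
    using \<sigma> e c by (simp add: T_def divide_simps)
  ultimately have "spread_le T e" by (rule spread_le_mono)
  then show thesis using spread_le_later[OF T] e T by (intro that[of T]) auto
qed

text \<open>By \<open>spread_decay\<close> a spread of at most \<open>\<sigma> k\<close> is halved
  within time \<open>h k\<close>, and these times are summable because 1 / \<Phi> is integrable near
  0. Waiting first until the spread is at most 1 lets the scales start at
  \<open>k = 0\<close>.\<close>

lemma finite_time_collapse:
  assumes M: "spread_le 0 M" and recip: "reciprocal_integral \<phi> < \<infinity>"
  obtains T where "0 \<le> T" "cluster_at_time X T ({a..<b} \<inter> Omega)"
proof -
  obtain s where s: "0 \<le> s" "spread_le s 1" using spread_vanishes[OF M zero_less_one] by (metis order_refl)
  define \<sigma> where "\<sigma> k = (1/2::real) ^ k" for k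
  have \<sigma>: "0 < \<sigma> k" "\<sigma> (Suc k) = \<sigma> k / 2" for k by (simp_all add: \<sigma>_def)
  define h where "h k = \<sigma> k / ((b - a) * Phi \<phi> (\<sigma> k))" for k
  have h0: "0 < h k" for k using \<sigma>(1)[of k] Phi_pos[OF \<sigma>(1)[of k]] ab by (simp add: h_def)
  have "summable (\<lambda>k. inverse (b - a) * (\<sigma> k / Phi \<phi> (\<sigma> k)))"
    using reciprocal_integral_finite_iff[OF protocol Phi_pos] recip by (intro summable_mult) (simp add: \<sigma>_def)
  moreover have "(\<lambda>k. inverse (b - a) * (\<sigma> k / Phi \<phi> (\<sigma> k))) = h"
    by (auto simp: h_def divide_inverse)
  ultimately have sum: "summable h" by simp
  have spread: "spread_le (s + (\<Sum>j<k. h j)) (\<sigma> k)" for k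
  proof (induction k)
    case 0
    then show ?case using s by (simp add: \<sigma>_def)
  next
    case (Suc k)
    have "0 \<le> (\<Sum>j<k. h j)" by (intro sum_nonneg less_imp_le h0)
    then have "spread_le (s + (\<Sum>j<Suc k. h j)) (\<sigma> k / (1 + ((s + (\<Sum>j<Suc k. h j)) - (s + (\<Sum>j<k. h j))) * ((b - a) * Phi \<phi> (\<sigma> k) / \<sigma> k)))"
      by (intro spread_decay) (use s less_imp_le[OF h0[of k]] \<sigma> Suc in auto)
    moreover have "((s + (\<Sum>j<Suc k. h j)) - (s + (\<Sum>j<k. h j))) * ((b - a) * Phi \<phi> (\<sigma> k) / \<sigma> k) = 1"
      using Phi_pos[OF \<sigma>(1)[of k]] \<sigma>(1)[of k] ab by (simp add: h_def)
    ultimately show ?case by (simp add: \<sigma>(2) del: sum.lessThan_Suc)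
  qed
  define T where "T = s + (\<Sum>j. h j)"
  have T: "0 \<le> T" unfolding T_def by (intro add_nonneg_nonneg s(1) suminf_nonneg sum less_imp_le[OF h0])
  have sp: "spread_le T (\<sigma> k)" for k
  proof (rule spread_le_later[OF _ _ spread])
    show "0 \<le> s + (\<Sum>j<k. h j)" by (intro add_nonneg_nonneg s(1) sum_nonneg less_imp_le[OF h0])
    show "s + (\<Sum>j<k. h j) \<le> T"
      unfolding T_def using sum_le_suminf[OF sum, of "{..<k}"] h0 by (auto intro: less_imp_le)
    show "0 \<le> \<sigma> k" using \<sigma>(1)[of k] by simp
  qed
  have le0: "X T y - X T x \<le> 0" if xy: "a < x" "x < b" "a < y" "y < b" for x y
  proof (rule LIMSEQ_le_const)
    show "\<sigma> \<longlonglongrightarrow> 0" unfolding \<sigma>_def[abs_def] by (rule LIMSEQ_realpow_zero) auto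
    show "\<exists>N. \<forall>n\<ge>N. X T y - X T x \<le> \<sigma> n" using spread_leD[OF sp xy] by blast
  qed
  have "X T x = X T ((a + b) / 2)" if "a < x" "x < b" for x
    using le0[of x "(a + b) / 2"] le0[of "(a + b) / 2" x] that ab by simp
  from constant_imp_Omega_of[OF ab(1,3) this] have "{a<..<b} \<subseteq> Omega_of (X T)" .
  \<comment> \<open>The endpoints lie outside the constancy set of \<open>P\<close>, hence outside
    that of \<open>X T\<close>, so \<open>(a, b)\<close> is a whole component.\<close>
  then have "cluster_at_time X T ({a..<b} \<inter> Omega)"
    using Omega_of_X_subset_P[OF T] ends ab by (intro cluster_at_timeI) auto
  with T show thesis by (rule that)
qed

section \<open>Level sets which contain their right endpoint\<close>

context
  assumes b: "b \<in> Omega" "P b = \<alpha>" and right: "\<And>c. c \<in> Omega \<Longrightarrow> b < c \<Longrightarrow> \<alpha> < P c"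
begin

text \<open>\<open>P b = \<alpha>\<close> and \<open>P\<close> exceeds \<open>\<alpha>\<close> to
  the right of \<open>b\<close>, so by right-continuity \<open>P\<close> is constant on no interval
  starting at \<open>b\<close>. Points outside its constancy set, which are contact points,
  therefore accumulate at \<open>b\<close> from the right.\<close>

lemma contact_near_b:
  assumes e: "0 < e" and s: "0 \<le> s"
  obtains q where "b < q" "q < 1" "A q = B q" "P q \<le> \<alpha> + e" "X s q \<le> X s b + e"
proof -
  have b1: "b < 1" using b by (simp add: Omega_def)
  have "\<forall>\<^sub>F q in at_right b. P q < \<alpha> + e"
    by (rule order_tendstoD(2)[OF K_right[OF P_K b(1)]]) (use b e in simp)
  moreover have "\<forall>\<^sub>F q in at_right b. X s q < X s b + e"
    by (rule order_tendstoD(2)[OF K_right[OF X_K[OF s] b(1)]]) (use e in simp)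
  moreover have "\<forall>\<^sub>F q in at_right b. q < 1" using b1 by (auto simp: eventually_at_right_field)
  ultimately have "\<forall>\<^sub>F q in at_right b. P q < \<alpha> + e \<and> X s q < X s b + e \<and> q < 1"
    by eventually_elim simp
  then obtain u where u: "b < u" "\<And>q. b < q \<Longrightarrow> q < u \<Longrightarrow> P q < \<alpha> + e \<and> X s q < X s b + e \<and> q < 1"
    by (auto simp: eventually_at_right_field)
  have "\<not> {b<..<u} \<subseteq> Omega_of P"
  proof
    assume "{b<..<u} \<subseteq> Omega_of P"
    then obtain c where c: "\<And>x. x \<in> Omega \<Longrightarrow> b \<le> x \<Longrightarrow> x < u \<Longrightarrow> P x = c"
      using Omega_of_imp_constant_right[OF P_K _ u(1)] by metis
    define x where "x = (b + u) / 2"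
    have x: "b < x" "x < u" using u by (auto simp: x_def)
    then have xO: "x \<in> Omega" using u(2)[OF x] b by (simp add: Omega_def)
    show False using right[OF xO x(1)] c[OF xO] c[OF b(1)] b x u by simp
  qed
  then obtain q where "q \<in> {b<..<u}" "q \<notin> Omega_of P" by blast
  then have q: "b < q" "q < u" "q \<notin> Omega_of P" by simp_all
  have "A q = B q" by (rule contact) (use q u(2)[OF q(1,2)] b in \<open>auto simp: Omega_def\<close>)
  with q u(2)[OF q(1,2)] show thesis by (intro that[of q]) auto
qed

text \<open>A single particle carries no mass, so \<open>b\<close> is followed through the mean over
  \<open>(b, q)\<close> with a contact point \<open>q\<close> close to \<open>b\<close>. There
  \<open>P\<close> exceeds \<open>\<alpha>\<close> by at most \<open>e\<close>, and \<open>e\<close>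
  can be made arbitrarily small.\<close>

lemma endpoint_gap_decay:
  assumes h: "a < h" "h < b" and st: "0 \<le> s" "s \<le> t"
    and c: "\<And>r x y. s < r \<Longrightarrow> r < t \<Longrightarrow> a < x \<Longrightarrow> x < h \<Longrightarrow> b < y \<Longrightarrow> y < 1 \<Longrightarrow> c \<le> F r y - F r x"
  shows "X t b - mean (X t) a h \<le> (X s b - mean (X s) a h) - c * (t - s)"
proof (rule field_le_epsilon)
  fix e0 :: real assume e0: "0 < e0"
  \<comment> \<open>The error \<open>e\<close> in the initial position and the error
    \<open>e * (t - s)\<close> from the speed add up to \<open>e0\<close>.\<close>
  define e where "e = e0 / (1 + (t - s))"
  have e: "0 < e" "e * (1 + (t - s)) = e0" using e0 st by (auto simp: e_def)
  obtain q where q: "b < q" "q < 1" "A q = B q" "P q \<le> \<alpha> + e" "X s q \<le> X s b + e"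
    using contact_near_b[OF e(1) st(1)] by blast
  have "gap a h b q t - gap a h b q s \<le> (e - c) * (t - s)"
  proof (rule gap_increment_le[OF st])
    fix r assume r: "good r" "s < r" "r < t"
    have "mean P b q \<le> P q"
      by (rule K_mean_le[OF P_K]) (use q ab b in \<open>auto simp: Omega_def\<close>)
    moreover have "mean P a h = \<alpha>" by (rule mean_P) (use h in auto)
    moreover have "c \<le> mean (F r) b q - mean (F r) a h"
      by (rule F_gap_lower) (use c r st h q ab in auto)
    ultimately show "gap_speed a h b q r \<le> e - c"
      using gap_speed_upper[OF r(1), of a h b q] contact_a q h ab by simp
  qed
  moreover have "gap a h b q s \<le> (X s b + e) - mean (X s) a h"
    unfolding gap_def using K_mean_le[OF X_K[OF st(1)], of b q q] q ab by (simp add: Omega_def)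
  moreover have "X t b - mean (X t) a h \<le> gap a h b q t"
    unfolding gap_def using K_mean_ge[OF X_K, of t b q b] q ab b st by simp
  ultimately have "X t b - mean (X t) a h \<le> (X s b - mean (X s) a h) - c * (t - s) + (e + e * (t - s))"
    by (simp add: algebra_simps)
  also have "e + e * (t - s) = e0" using e(2) by (simp add: algebra_simps)
  finally show "X t b - mean (X t) a h \<le> (X s b - mean (X s) a h) - c * (t - s) + e0" .
qed

text \<open>Eventually all of \<open>(a, b)\<close> is within \<open>e / 4\<close> of the mean over
  its left half \<open>(a, h)\<close>. While \<open>b\<close> is at least \<open>e / 2\<close> away
  from that mean, the mass in \<open>(h, b)\<close> attracts it at a speed bounded below, which
  cannot last forever; and the distance never increases.\<close>

lemma endpoint_spread_vanishes:
  assumes M: "spread_le 0 M" and e: "0 < e"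
  obtains T where "0 \<le> T" "\<And>t x. T \<le> t \<Longrightarrow> a < x \<Longrightarrow> x < b \<Longrightarrow> X t b - X t x \<le> e"
proof -
  define h where "h = (a + b) / 2"
  have h: "a < h" "h < b" using ab by (auto simp: h_def)
  define S where "S t = X t b - mean (X t) a h" for t
  obtain T0 where T0: "0 \<le> T0" "\<And>t. T0 \<le> t \<Longrightarrow> spread_le t (e / 4)"
    using spread_vanishes[OF M, of "e / 4"] e by auto
  have S0: "0 \<le> S t" if "0 \<le> t" for t
    unfolding S_def using K_mean_le[OF X_K[OF that], of a h b] h ab b by simp
  have mean_close: "\<bar>X t x - mean (X t) a h\<bar> \<le> e / 4" if t: "T0 \<le> t" and x: "a < x" "x < b" for t x
  proof -
    have "X t x - e / 4 \<le> mean (X t) a h"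
      by (rule mean_lower) (use X_L2 T0 t x h ab spread_leD[OF T0(2)[OF t]] in \<open>force simp: algebra_simps\<close>)+
    moreover have "mean (X t) a h \<le> X t x + e / 4"
      by (rule mean_upper) (use X_L2 T0 t x h ab spread_leD[OF T0(2)[OF t]] in \<open>force simp: algebra_simps\<close>)+
    ultimately show ?thesis by linarith
  qed
  have "\<exists>T1\<ge>T0. S T1 < e / 2"
  proof (rule ccontr)
    assume "\<not> ?thesis"
    then have big: "e / 2 \<le> S t" if "T0 \<le> t" for t using that by (auto simp: not_less)
    define c where "c = (b - h) * Phi \<phi> (e / 4)"
    have c: "0 < c" using h Phi_pos[of "e / 4"] e by (simp add: c_def)
    define t where "t = T0 + S T0 / c + 1"
    have t: "T0 \<le> t" using c S0[OF T0(1)] by (simp add: t_def)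
    have "S t \<le> S T0 - c * (t - T0)"
      unfolding S_def
    proof (rule endpoint_gap_decay[OF h T0(1) t])
      fix r x y assume r: "T0 < r" "r < t" and x: "a < x" "x < h" and y: "b < y" "y < 1"
      have r0: "0 \<le> r" using r T0 by simp
      have O: "x \<in> Omega" "y \<in> Omega" using in_Omega[of x] x y h b by (auto simp: Omega_def)
      have "e / 2 \<le> X r b - mean (X r) a h" using big[of r] r by (simp add: S_def)
      moreover have "X r b \<le> X r y" using X_mono[OF r0 b(1) O(2)] y by simp
      moreover have "\<bar>X r x - mean (X r) a h\<bar> \<le> e / 4" by (rule mean_close) (use r x h in auto)
      ultimately have "e / 4 \<le> X r y - X r x" by linarith
      then have "Phi \<phi> (e / 4) \<le> Phi \<phi> (X r y - X r x)" by (rule Phi_mono[OF protocol])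
      then have "c \<le> (b - h) * Phi \<phi> (X r y - X r x)"
        unfolding c_def using h by (intro mult_left_mono) auto
      also have "\<dots> \<le> F r y - F r x"
        unfolding F_def by (rule alignment_lower[OF protocol X_K[OF r0] O]) (use x y h in auto)
      finally show "c \<le> F r y - F r x" .
    qed
    moreover have "c * (t - T0) = S T0 + c" using c by (simp add: t_def field_simps)
    ultimately have "S t \<le> - c" by simp
    with S0[of t] t T0 c show False by simp
  qed
  then obtain T1 where T1: "T0 \<le> T1" "S T1 < e / 2" by blast
  show thesis
  proof (rule that)
    show "0 \<le> T1" using T0 T1 by simp
    fix t x assume t: "T1 \<le> t" and x: "a < x" "x < b"
    have "S t \<le> S T1 - 0 * (t - T1)"
      unfolding S_def
    proof (rule endpoint_gap_decay[OF h])
      fix r x y assume "T1 < r" "a < x" "x < h" "b < y" "y < 1"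
      then show "0 \<le> F r y - F r x"
        using F_mono[of r x y] T0 T1 h ab by (simp add: Omega_def)
    qed (use T0 T1 t in auto)
    then have "X t b - mean (X t) a h < e / 2" using T1 by (simp add: S_def)
    moreover have "\<bar>X t x - mean (X t) a h\<bar> \<le> e / 4" by (rule mean_close) (use T1 t x in auto)
    ultimately show "X t b - X t x \<le> e" using e by linarith
  qed
qed

end

end

section \<open>Infinite-time clusters from a vanishing spread\<close>

context lagrangian_level
begin

lemma spread_half_open:
  assumes t: "0 \<le> t" and x: "x \<in> Omega" "a \<le> x" "x < b"
    and le: "\<And>z. a < z \<Longrightarrow> z < b \<Longrightarrow> v - X t z \<le> e"
  shows "v - X t x \<le> e"
proof (cases "a < x")
  case True
  then show ?thesis using le x by simp
next
  case False
  with x have xa: "x = a" by simp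
  have "((\<lambda>z. v - X t z) \<longlongrightarrow> v - X t a) (at_right a)"
    using K_right[OF X_K[OF t] x(1)] unfolding xa by (intro tendsto_intros)
  moreover have "\<forall>\<^sub>F z in at_right a. v - X t z \<le> e"
    unfolding eventually_at_right_field using le ab by blast
  ultimately show ?thesis unfolding xa by (intro tendsto_upperbound[of _ _ "at_right a"]) auto
qed

text \<open>\<open>L\<close> can exceed \<open>[a, b)\<close> only by the point \<open>b\<close>.
  That point needs the endpoint argument, and \<open>b \<in> L\<close> supplies its hypothesis
  \<open>P b = \<alpha>\<close>.\<close>

lemma level_spread_vanishes:
  assumes M: "spread_le 0 M" and e: "0 < e"
    and L: "L \<subseteq> {a..b} \<inter> Omega" "\<And>x. x \<in> L \<Longrightarrow> P x = \<alpha>" "\<And>c. c \<in> Omega \<Longrightarrow> b < c \<Longrightarrow> \<alpha> < P c"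
  obtains T where "0 \<le> T" "\<And>t x y. T \<le> t \<Longrightarrow> x \<in> L \<Longrightarrow> y \<in> L \<Longrightarrow> X t y - X t x \<le> e"
proof -
  obtain T0 where T0: "0 \<le> T0" "\<And>t. T0 \<le> t \<Longrightarrow> spread_le t e"
    using spread_vanishes[OF M e] by blast
  have half: "X t y - X t x \<le> e"
    if t: "T0 \<le> t" and x: "x \<in> Omega" "a \<le> x" "x < b" and y: "y \<in> Omega" "y < b" for t x y
  proof (cases "x \<le> y")
    case False
    then have "X t y \<le> X t x" using X_mono[of t y x] x y t T0 by simp
    with e show ?thesis by simp
  next
    case True
    show ?thesis
    proof (cases "a < y")
      case a: True
      show ?thesis
        by (rule spread_half_open) (use t T0 x y a spread_leD[OF T0(2)[OF t]] in auto)
    next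
      case False
      with True x have "x = y" by simp
      with e show ?thesis by simp
    qed
  qed
  have "\<exists>T\<ge>T0. \<forall>t\<ge>T. \<forall>x. x \<in> Omega \<and> a \<le> x \<and> x < b \<and> b \<in> L \<longrightarrow> X t b - X t x \<le> e"
  proof (cases "b \<in> L")
    case True
    then have b: "b \<in> Omega" "P b = \<alpha>" using L by auto
    obtain T where T: "0 \<le> T" "\<And>t x. T \<le> t \<Longrightarrow> a < x \<Longrightarrow> x < b \<Longrightarrow> X t b - X t x \<le> e"
      using endpoint_spread_vanishes[OF b L(3) M e] by metis
    show ?thesis
    proof (intro exI[of _ "max T T0"] conjI allI impI)
      fix t x assume "max T T0 \<le> t" and x: "x \<in> Omega \<and> a \<le> x \<and> x < b \<and> b \<in> L"
      then have t: "T \<le> t" by simp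
      show "X t b - X t x \<le> e"
        by (rule spread_half_open) (use T t x in auto)
    qed simp
  qed auto
  then obtain T where T: "T0 \<le> T"
    "\<And>t x. T \<le> t \<Longrightarrow> x \<in> Omega \<Longrightarrow> a \<le> x \<Longrightarrow> x < b \<Longrightarrow> b \<in> L \<Longrightarrow> X t b - X t x \<le> e"
    by blast
  show thesis
  proof (rule that)
    show "0 \<le> T" using T0 T by simp
    fix t x y assume t: "T \<le> t" and xy: "x \<in> L" "y \<in> L"
    have x: "x \<in> Omega" "a \<le> x" "x \<le> b" and y: "y \<in> Omega" "a \<le> y" "y \<le> b" using xy L by auto
    consider "x < b" "y < b" | "x < b" "y = b" | "x = b" using x y by linarith
    then show "X t y - X t x \<le> e"
    proof cases
      case 1
      then show ?thesis using half[of t x y] x y t T by simp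
    next
      case 2
      then show ?thesis using T(2)[of t x] x xy t by simp
    next
      case 3
      then have "X t y \<le> X t x" using X_mono[of t y x] x y t T T0 by simp
      with e show ?thesis by simp
    qed
  qed
qed

text \<open>Allowing any interval between \<open>(a, b)\<close> and \<open>L\<close> serves both the
  level set and its half-open version.\<close>

lemma infinite_time_clusterI:
  assumes M: "spread_le 0 M"
    and L: "L \<subseteq> {a..b} \<inter> Omega" "\<And>x. x \<in> L \<Longrightarrow> P x = \<alpha>" "\<And>c. c \<in> Omega \<Longrightarrow> b < c \<Longrightarrow> \<alpha> < P c"
    and I: "I \<subseteq> L" "is_interval I" "{a<..<b} \<subseteq> I"
  shows "infinite_time_cluster X I"
  unfolding infinite_time_cluster_def
proof (intro conjI)
  show "is_interval I" by (rule I)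
  show "I \<subseteq> Omega" using I L by blast
  have "(2 * a + b) / 3 \<in> {a<..<b}" "(a + 2 * b) / 3 \<in> {a<..<b}" "(2 * a + b) / 3 < (a + 2 * b) / 3"
    using ab by (auto simp: field_simps)
  then show "\<exists>x\<in>I. \<exists>y\<in>I. x < y" using I(3) by blast
  show "((\<lambda>t. SUP \<omega>1\<in>I. SUP \<omega>2\<in>I. ennreal \<bar>X t \<omega>1 - X t \<omega>2\<bar>) \<longlongrightarrow> 0) at_top"
  proof (rule order_tendstoI)
    fix u :: ennreal assume "0 < u"
    then obtain v where v: "0 < v" "v < u" using dense by blast
    then have "v \<noteq> top" by (metis less_top neq_top_trans order_less_imp_le)
    then obtain e where e: "0 \<le> e" "v = ennreal e" by (metis ennreal_cases)
    have e0: "0 < e" using v e by (cases "e = 0") auto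
    obtain T where T: "0 \<le> T" "\<And>t x y. T \<le> t \<Longrightarrow> x \<in> L \<Longrightarrow> y \<in> L \<Longrightarrow> X t y - X t x \<le> e"
      using level_spread_vanishes[OF M e0 L] by metis
    show "\<forall>\<^sub>F t in at_top. (SUP \<omega>1\<in>I. SUP \<omega>2\<in>I. ennreal \<bar>X t \<omega>1 - X t \<omega>2\<bar>) < u"
      using eventually_ge_at_top[of T]
    proof eventually_elim
      case (elim t)
      have "(SUP \<omega>1\<in>I. SUP \<omega>2\<in>I. ennreal \<bar>X t \<omega>1 - X t \<omega>2\<bar>) \<le> v"
      proof (intro SUP_least)
        fix x y assume "x \<in> I" "y \<in> I"
        then have "x \<in> L" "y \<in> L" using I by auto
        then have "\<bar>X t x - X t y\<bar> \<le> e" using T(2)[OF elim, of x y] T(2)[OF elim, of y x] by linarith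
        then show "ennreal \<bar>X t x - X t y\<bar> \<le> v" unfolding e(2) by (rule ennreal_leI)
      qed
      with v show ?case by simp
    qed
  qed simp
qed

end

section \<open>Clusters given by level sets of the projection\<close>

context lagrangian
begin

text \<open>Outside \<open>Sigma_plus\<close> the level set is nondegenerate. Monotonicity makes it
  an interval, right-continuity adds the left endpoint if that lies in \<Omega>, and by maximality
  \<open>P\<close> is not locally constant at either end.\<close>

lemma level_set_structure:
  assumes m: "m \<in> Omega" "m \<notin> Sigma_plus \<Psi>"
  defines "L \<equiv> {\<omega> \<in> Omega. P \<omega> = P m}"
  defines "a \<equiv> Inf L" and "b \<equiv> Sup L"
  shows "0 \<le> a" "a \<le> m" "m < b" "b \<le> 1" "L \<subseteq> {a..b} \<inter> Omega" "{a..<b} \<inter> Omega \<subseteq> L" "is_interval L"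
    "a \<notin> Omega_of P" "b \<notin> Omega_of P" "\<And>c. c \<in> Omega \<Longrightarrow> b < c \<Longrightarrow> P m < P c"
proof -
  have mL: "m \<in> L" using m by (simp add: L_def)
  obtain x where x: "x \<in> Omega" "m < x" "\<not> P m < P x" using m Sigma_plus_iff[OF m(1)] by blast
  have xL: "x \<in> L" using x m P_mono[of m x] by (simp add: L_def)
  have bd: "bdd_below L" "bdd_above L"
    by (auto intro!: bdd_belowI[of _ 0] bdd_aboveI[of _ 1] simp: L_def Omega_def)
  have a: "a \<le> l" and b: "l \<le> b" if "l \<in> L" for l
    unfolding a_def b_def using that bd by (auto intro: cInf_lower cSup_upper)
  show "0 \<le> a" unfolding a_def by (rule cInf_greatest) (use mL in \<open>auto simp: L_def Omega_def\<close>)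
  show "b \<le> 1" unfolding b_def by (rule cSup_least) (use mL in \<open>auto simp: L_def Omega_def\<close>)
  show "a \<le> m" by (rule a[OF mL])
  show "m < b" using b[OF xL] x by simp
  then have less: "a < b" using \<open>a \<le> m\<close> by simp
  show "L \<subseteq> {a..b} \<inter> Omega" using a b by (auto simp: L_def)
  have between: "z \<in> L" if "u \<in> L" "v \<in> L" "u \<le> z" "z \<le> v" for u v z
  proof -
    have "z \<in> Omega" using that by (auto simp: L_def Omega_def)
    then show ?thesis using that P_mono[of u z] P_mono[of z v] by (auto simp: L_def)
  qed
  then show "is_interval L" unfolding is_interval_1 by blast
  have level: "P z = P m" if z: "a < z" "z < b" for z
  proof -
    have "L \<noteq> {}" using mL by blast
    then obtain u v where "u \<in> L" "u < z" "v \<in> L" "z < v"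
      using z bd unfolding a_def b_def by (meson cInf_less_iff less_cSup_iff)
    then have "z \<in> L" using between[of u v z] by simp
    then show ?thesis by (simp add: L_def)
  qed
  have sub: "{a<..<b} \<subseteq> Omega_of P"
    by (rule constant_imp_Omega_of[OF \<open>0 \<le> a\<close> \<open>b \<le> 1\<close> level])
  obtain c where c: "\<And>z. z \<in> Omega \<Longrightarrow> a \<le> z \<Longrightarrow> z < b \<Longrightarrow> P z = c"
    using Omega_of_imp_constant_right[OF P_K sub less] by metis
  show "{a..<b} \<inter> Omega \<subseteq> L"
    using c[of m] c m \<open>a \<le> m\<close> \<open>m < b\<close> by (auto simp: L_def)
  show "P m < P c" if "c \<in> Omega" "b < c" for c
  proof -
    have "P m \<le> P c" using P_mono[of m c] m that \<open>m < b\<close> by simp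
    moreover have "c \<notin> L" using b[of c] that by auto
    ultimately show ?thesis using that by (auto simp: L_def)
  qed
  have nbhd: "\<exists>p q. p < z \<and> z < q \<and> (\<forall>y. p < y \<and> y < q \<longrightarrow> y \<in> Omega \<and> P y = P z)" if z: "z \<in> Omega_of P" for z
  proof -
    obtain p q where pq: "p < z" "z < q" "{p<..<q} \<subseteq> Omega_of P"
      using open_interval_around[OF open_Omega_of Omega_of_subset z] by metis
    moreover have "p < q" using pq by simp
    then obtain k where "\<And>y. p < y \<Longrightarrow> y < q \<Longrightarrow> P y = k" using Omega_of_imp_constant[OF pq(3)] by metis
    moreover have "{p<..<q} \<subseteq> Omega" using pq(3) Omega_of_subset by blast
    ultimately show ?thesis by (intro exI[of _ p] exI[of _ q]) auto
  qed
  show "a \<notin> Omega_of P"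
  proof
    assume "a \<in> Omega_of P"
    then obtain p q where pq: "p < a" "a < q" "\<And>y. p < y \<Longrightarrow> y < q \<Longrightarrow> y \<in> Omega \<and> P y = P a"
      using nbhd by blast
    \<comment> \<open>The midpoint lies in the neighbourhood of \<open>a\<close> as well as in
      \<open>(a, b)\<close>, which links the two values.\<close>
    have "P a = P m"
      using pq(3)[of "(a + min q b) / 2"] level[of "(a + min q b) / 2"] pq(1,2) less by (auto simp: min_def field_simps split: if_splits)
    then have "(p + a) / 2 \<in> L" using pq(3)[of "(p + a) / 2"] pq(1,2) by (simp add: L_def)
    with a[of "(p + a) / 2"] pq(1) show False by simp
  qed
  show "b \<notin> Omega_of P"
  proof
    assume "b \<in> Omega_of P"
    then obtain p q where pq: "p < b" "b < q" "\<And>y. p < y \<Longrightarrow> y < q \<Longrightarrow> y \<in> Omega \<and> P y = P b"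
      using nbhd by blast
    have "P b = P m"
      using pq(3)[of "(b + max p a) / 2"] level[of "(b + max p a) / 2"] pq(1,2) less by (auto simp: max_def field_simps split: if_splits)
    then have "(b + q) / 2 \<in> L" using pq(3)[of "(b + q) / 2"] pq(1,2) by (simp add: L_def)
    with b[of "(b + q) / 2"] pq(2) show False by simp
  qed
qed

lemma level_set_clusters:
  assumes m: "m \<in> Omega" "m \<notin> Sigma_plus \<Psi>" and nz: "\<not> (AE x in lborel. \<phi> x = 0)"
    and bd: "bounded (Xbar ` {\<omega> \<in> Omega. P \<omega> = P m})"
  defines "L \<equiv> {\<omega> \<in> Omega. P \<omega> = P m}"
  shows "infinite_time_cluster X L" "infinite_time_cluster_at X m (half_open L)"
    "reciprocal_integral \<phi> < \<infinity> \<Longrightarrow> finite_time_cluster X (half_open L)"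
proof -
  define a b where "a = Inf L" and "b = Sup L"
  note struct = level_set_structure[OF m, folded L_def, folded a_def b_def]
  have level: "P x = P m" if "a < x" "x < b" for x
    using that struct(6) struct(1,4) by (auto simp: L_def Omega_def subset_iff)
  interpret lagrangian_level \<phi> Xbar Vbar X a b "P m"
    by unfold_locales (use struct level nz in auto)
  obtain M where M: "\<And>x. x \<in> L \<Longrightarrow> \<bar>Xbar x\<bar> \<le> M"
    using bd unfolding L_def bounded_iff by auto
  have spread: "spread_le 0 (2 * M)"
    unfolding spread_le_def
  proof (intro allI impI)
    fix x y assume "a < x" "x < b" "a < y" "y < b"
    then have "x \<in> L" "y \<in> L" using level in_Omega by (auto simp: L_def)
    then show "X 0 y - X 0 x \<le> 2 * M" using M[of x] M[of y] X_0[of x] X_0[of y] by (auto simp: L_def)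
  qed
  have PL: "P x = P m" if "x \<in> L" for x using that by (simp add: L_def)
  have half: "half_open L = {a..<b} \<inter> Omega" by (simp add: half_open_def a_def b_def)
  have sub: "{a<..<b} \<subseteq> {a..<b} \<inter> Omega" using in_Omega by auto
  show "infinite_time_cluster X L"
    by (rule infinite_time_clusterI[OF spread struct(5) PL struct(10)]) (use sub struct(6,7) in auto)
  have "infinite_time_cluster X ({a..<b} \<inter> Omega)"
  proof (rule infinite_time_clusterI[OF spread struct(5) PL struct(10) struct(6) _ sub])
    show "is_interval ({a..<b} \<inter> Omega)"
      unfolding Omega_def by (intro is_interval_Int is_interval_co is_interval_oo)
  qed
  then show "infinite_time_cluster_at X m (half_open L)"
    unfolding infinite_time_cluster_at_def half using m struct(2,3) by auto
  show "finite_time_cluster X (half_open L)" if "reciprocal_integral \<phi> < \<infinity>"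
    using finite_time_collapse[OF spread that] unfolding half finite_time_cluster_def by metis
qed

end

text \<open>Endpoints and null sets shape several clauses. \<open>Xbar m' = Xbar m''\<close> is
  compatible with \<open>P m' < P m''\<close>, when \<open>P\<close> jumps at the right end
  \<open>m''\<close> of an initial plateau; the distance then opens from 0, so it has a positive
  lower bound only from a positive time \<open>s\<close> on. That \<phi> is not identically zero is
  read almost everywhere, as \<Phi> sees \<phi> only up to null sets. Finite-time clusters are
  half-open, whereas a level set may contain its right endpoint.\<close>

theorem theorem6p2:
  fixes \<phi> Xbar Vbar \<Psi> P :: "real \<Rightarrow> real"
    and X :: "real \<Rightarrow> real \<Rightarrow> real"
    and L :: "real \<Rightarrow> real set"
  assumes phi: "protocol \<phi>"
    and Xbar: "Xbar \<in> K"
    and Vbar: "Vbar \<in> H_of Xbar"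
    and X: "lagrangian_solution \<phi> Xbar Vbar X"
  defines "\<Psi> \<equiv> natural_velocity \<phi> Xbar Vbar"
    and "P \<equiv> proj_K \<Psi>"
    and "L \<equiv> level_set \<Psi>"
  shows "(\<forall>m'\<in>Omega. \<forall>m''\<in>Omega. P m' < P m'' \<longrightarrow>
          (Xbar m' < Xbar m'' \<longrightarrow> (\<exists>c>0. \<forall>t\<ge>0. X t m'' - X t m' \<ge> c)) \<and>
          (\<forall>s>0. \<exists>c>0. \<forall>t\<ge>s. X t m'' - X t m' \<ge> c)) \<and>
    (\<forall>m\<in>Omega. m \<in> Sigma_plus \<Psi> \<longrightarrow>
          \<not> (\<exists>C. finite_time_cluster X C \<and> m \<in> C) \<and>
          \<not> (\<exists>I. infinite_time_cluster_at X m I)) \<and>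
    (\<forall>m\<in>Omega. m \<in> Sigma_minus \<Psi> \<longrightarrow>
          (\<exists>T\<ge>0. \<forall>t\<ge>T. \<exists>C. cluster_at_time X t C \<and> m \<in> C)) \<and>
    (reciprocal_integral \<phi> = \<infinity> \<longrightarrow>
          (\<forall>m\<in>Omega. \<forall>C. finite_time_cluster X C \<and> m \<in> C \<longrightarrow>
             (m \<in> Sigma_zero \<Psi> \<and> initial_cluster X C) \<or>
             (\<exists>m_minus m_plus. {m_minus<..<m_plus} \<in> components (Sigma_minus \<Psi>) \<and>
                (m \<in> Sigma_minus \<Psi> \<or> m = m_minus) \<and> C \<subseteq> {m_minus..<m_plus}))) \<and>
    (\<not> (AE x in lborel. \<phi> x = 0) \<longrightarrow>
          (\<forall>m\<in>Omega. m \<notin> Sigma_plus \<Psi> \<and> bounded (Xbar ` L m) \<longrightarrow>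
             infinite_time_cluster X (L m) \<and> infinite_time_cluster_at X m (half_open (L m)))) \<and>
    (\<not> (AE x in lborel. \<phi> x = 0) \<and> reciprocal_integral \<phi> < \<infinity> \<longrightarrow>
          (\<forall>m\<in>Omega. m \<notin> Sigma_plus \<Psi> \<and> bounded (Xbar ` L m) \<longrightarrow>
             finite_time_cluster X (half_open (L m))))"
proof -
  interpret sol: lagrangian \<phi> Xbar Vbar X
    by unfold_locales (rule phi Xbar Vbar X)+
  have Psi: "sol.\<Psi> = \<Psi>" by (simp add: sol.\<Psi>_def \<Psi>_def)
  have P: "sol.P = P" by (simp add: sol.P_def P_def Psi)
  have L: "L m = {\<omega> \<in> Omega. sol.P \<omega> = sol.P m}" for m
    by (simp add: L_def level_set_def P P_def)
  show ?thesis
  proof (intro conjI ballI impI allI)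
    fix m' m'' assume m: "m' \<in> Omega" "m'' \<in> Omega" "P m' < P m''"
    obtain g \<delta> d where sep: "0 \<le> g" "Xbar m' < Xbar m'' \<Longrightarrow> 0 < g" "0 < \<delta>" "0 < d"
        "\<And>t. 0 \<le> t \<Longrightarrow> min (g + \<delta> * t) d \<le> X t m'' - X t m'"
      using sol.separation[OF m(1,2)] m(3) unfolding P by metis
    show "\<exists>c>0. \<forall>t\<ge>0. c \<le> X t m'' - X t m'" if "Xbar m' < Xbar m''"
    proof (intro exI[of _ "min g d"] conjI allI impI)
      show "0 < min g d" using sep that by simp
      fix t :: real assume t: "0 \<le> t"
      then have "0 \<le> \<delta> * t" using sep by simp
      with sep(5)[OF t] show "min g d \<le> X t m'' - X t m'" by linarith
    qed
    show "\<exists>c>0. \<forall>t\<ge>s. c \<le> X t m'' - X t m'" if s: "0 < s" for s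
    proof (intro exI[of _ "min (\<delta> * s) d"] conjI allI impI)
      show "0 < min (\<delta> * s) d" using sep s by simp
      fix t assume t: "s \<le> t"
      then have "\<delta> * s \<le> \<delta> * t" using sep by simp
      with sep(5)[of t] sep(1) s t show "min (\<delta> * s) d \<le> X t m'' - X t m'" by linarith
    qed
  next
    fix m assume m: "m \<in> Omega" "m \<in> Sigma_plus \<Psi>"
    show "\<not> (\<exists>C. finite_time_cluster X C \<and> m \<in> C)" "\<not> (\<exists>I. infinite_time_cluster_at X m I)"
      using sol.Sigma_plus_no_finite_cluster[of m] sol.Sigma_plus_no_infinite_cluster[of m] m
      unfolding Psi by blast+
  next
    fix m assume "m \<in> Sigma_minus \<Psi>"
    then show "\<exists>T\<ge>0. \<forall>t\<ge>T. \<exists>C. cluster_at_time X t C \<and> m \<in> C"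
      using sol.Sigma_minus_cluster[of m] unfolding Psi by metis
  next
    fix m C assume "reciprocal_integral \<phi> = \<infinity>" "finite_time_cluster X C \<and> m \<in> C"
    then show "(m \<in> Sigma_zero \<Psi> \<and> initial_cluster X C) \<or>
        (\<exists>m_minus m_plus. {m_minus<..<m_plus} \<in> components (Sigma_minus \<Psi>) \<and>
          (m \<in> Sigma_minus \<Psi> \<or> m = m_minus) \<and> C \<subseteq> {m_minus..<m_plus})"
      using sol.finite_cluster_cases[of C m] unfolding Psi by blast
  next
    fix m assume *: "\<not> (AE x in lborel. \<phi> x = 0)" "m \<in> Omega" "m \<notin> Sigma_plus \<Psi> \<and> bounded (Xbar ` L m)"
    then show "infinite_time_cluster X (L m)" "infinite_time_cluster_at X m (half_open (L m))"
      using sol.level_set_clusters(1,2)[of m] unfolding Psi L by blast+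
  next
    fix m assume "\<not> (AE x in lborel. \<phi> x = 0) \<and> reciprocal_integral \<phi> < \<infinity>" "m \<in> Omega"
      "m \<notin> Sigma_plus \<Psi> \<and> bounded (Xbar ` L m)"
    then show "finite_time_cluster X (half_open (L m))"
      using sol.level_set_clusters(3)[of m] unfolding Psi L by blast
  qed
qed

end
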